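(* Let $(M,J,g)$ be a connected nearly Kähler manifold. If the Ricci curvature $(R_{i\bar j})$ of the canonical connection is positive definite or negative definite at some point of $M$, then $(M,J,g)$ is Kähler.
   Context: An almost Hermitian manifold $(M,J,g)$ is a manifold $M$ of real dimension $2n$ with an almost complex structure $J$ and a Riemannian metric $g$ satisfying $g(JX,JY)=g(X,Y)$. It is nearly Kähler if $(D_XJ)X=0$ for every tangent vector field $X$, where $D$ is the Levi-Civita connection; it is Kähler if $J$ is integrable and the form $\omega_g(X,Y)=g(JX,Y)$ is closed. Write $\langle\cdot,\cdot\rangle$ for the complex bilinear extension of $g$ to $TM\otimes\mathbb C$. The torsion of a connection $\nabla$ is $\tau(X,Y)=\nabla_XY-\nabla_YX-[X,Y]$. The canonical connection $\nabla$ is the unique connection with $\nabla g=0$, $\nabla J=0$ and $\tau(X,\overline Y)=0$ for all $(1,0)$-vectors $X,Y$ (tensors and connections are extended complex linearly). Curvature of the canonical connection: $R(X,Y)Z=\nabla_X\nabla_YZ-\nabla_Y\nabla_XZ-\nabla_{[X,Y]}Z$ and $R(X,Y,Z,W)=\langle R(Z,W)X,Y\rangle$. For a local unitary $(1,0)$-frame $(e_1,\dots,e_n)$ (i.e. a local frame of $T^{1,0}M$ with $\langle e_i,\overline{e_j}\rangle=\delta_{ij}$), put $e_{\bar i}=\overline{e_i}$ and $R_{ABCD}=R(e_A,e_B,e_C,e_D)$. The first and second Ricci curvatures are $R'_{i\bar j}=\sum_{\lambda=1}^nR_{\lambda\bar\lambda i\bar j}$ and $R''_{i\bar j}=\sum_{\lambda=1}^nR_{i\bar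 j\lambda\bar\lambda}$. On a nearly Kähler manifold these coincide, and the common Hermitian form, denoted $R_{i\bar j}$, is called the Ricci curvature of the canonical connection. *)

theory Defs
  imports "HOL-Analysis.Analysis"
begin

section \<open>Smooth functions and smooth manifolds\<close>

text \<open>On an open subset of a Euclidean space: all iterated directional derivatives up to
  order k exist and are continuous.\<close>

primrec Ck_on :: "nat \<Rightarrow> 'a::euclidean_space set \<Rightarrow> ('a \<Rightarrow> 'b::real_normed_vector) \<Rightarrow> bool" where
  "Ck_on 0 S f \<longleftrightarrow> continuous_on S f"
| "Ck_on (Suc k) S f \<longleftrightarrow>
     (\<forall>x\<in>S. f differentiable (at x)) \<and>
     (\<forall>v. Ck_on k S (\<lambda>x. frechet_derivative f (at x) v))"

definition smooth_on :: "'a::euclidean_space set \<Rightarrow> ('a \<Rightarrow> 'b::real_normed_vector) \<Rightarrow> bool" where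
  "smooth_on S f \<longleftrightarrow> (\<forall>k. Ck_on k S f)"

text \<open>The manifold is the whole (Hausdorff, second countable) topological space 'm; its real
  dimension is DIM('e). A chart is a domain together with a coordinate map.\<close>

type_synonym ('m, 'e) chart = "'m set \<times> ('m \<Rightarrow> 'e)"

definition chart_inv :: "('m, 'e) chart \<Rightarrow> 'e \<Rightarrow> 'm" where
  "chart_inv c = inv_into (fst c) (snd c)"

definition is_chart :: "('m::topological_space, 'e::euclidean_space) chart \<Rightarrow> bool" where
  "is_chart c \<longleftrightarrow> open (fst c) \<and> open (snd c ` fst c) \<and>
     homeomorphism (fst c) (snd c ` fst c) (snd c) (chart_inv c)"

definition smooth_atlas ::
  "('m::{t2_space,second_countable_topology}, 'e::euclidean_space) chart set \<Rightarrow> bool" where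
  "smooth_atlas A \<longleftrightarrow> (\<forall>c\<in>A. is_chart c) \<and> (\<Union>c\<in>A. fst c) = UNIV \<and>
     (\<forall>c\<in>A. \<forall>d\<in>A. smooth_on (snd c ` (fst c \<inter> fst d)) (snd d \<circ> chart_inv c))"

definition smooth_fun ::
  "('m::topological_space, 'e::euclidean_space) chart set \<Rightarrow> 'm set \<Rightarrow> ('m \<Rightarrow> real) \<Rightarrow> bool" where
  "smooth_fun A U f \<longleftrightarrow> (\<forall>c\<in>A. smooth_on (snd c ` (U \<inter> fst c)) (f \<circ> chart_inv c))"

definition smooth_near ::
  "('m::topological_space, 'e::euclidean_space) chart set \<Rightarrow> 'm \<Rightarrow> ('m \<Rightarrow> real) \<Rightarrow> bool" where
  "smooth_near A p f \<longleftrightarrow> (\<exists>U. open U \<and> p \<in> U \<and> smooth_fun A U f)"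


section \<open>Tangent vectors and vector fields\<close>

text \<open>A tangent vector at p is identified with the directional derivative it induces on functions
  that are smooth near p. It is set to 0 on all other functions, so that tangent vectors are equal
  iff they agree on the functions smooth near p.

  The value type 'k is real for tangent vectors and complex for elements of the complexified
  tangent bundle.\<close>

type_synonym ('m, 'k) vec = "('m \<Rightarrow> real) \<Rightarrow> 'k"
type_synonym ('m, 'k) field = "'m \<Rightarrow> ('m, 'k) vec"

definition vzero :: "('m, 'k::real_normed_field) vec" where
  "vzero = (\<lambda>f. 0)"
definition vadd :: "('m, 'k::real_normed_field) vec \<Rightarrow> ('m, 'k) vec \<Rightarrow> ('m, 'k) vec" where
  "vadd u v = (\<lambda>f. u f + v f)"
definition vsub :: "('m, 'k::real_normed_field) vec \<Rightarrow> ('m, 'k) vec \<Rightarrow> ('m, 'k) vec" where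
  "vsub u v = (\<lambda>f. u f - v f)"
definition vscale :: "'k::real_normed_field \<Rightarrow> ('m, 'k) vec \<Rightarrow> ('m, 'k) vec" where
  "vscale a v = (\<lambda>f. a * v f)"

definition tangent_space ::
  "('m::topological_space, 'e::euclidean_space) chart set \<Rightarrow> 'm \<Rightarrow> ('m, real) vec set" where
  "tangent_space A p = {v. \<exists>c\<in>A. p \<in> fst c \<and> (\<exists>w.
     v = (\<lambda>f. if smooth_near A p f
              then frechet_derivative (f \<circ> chart_inv c) (at (snd c p)) w else 0))}"

text \<open>Smooth vector fields over an open set U; the values of X outside U are irrelevant.
  All notions below are expressed through vector fields over arbitrary open sets, i.e. they
  include local vector fields.\<close>

definition vfield ::
  "('m::topological_space, 'e::euclidean_space) chart set \<Rightarrow> 'm set \<Rightarrow> ('m, real) field \<Rightarrow> bool" where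
  "vfield A U X \<longleftrightarrow> (\<forall>p\<in>U. X p \<in> tangent_space A p) \<and>
     (\<forall>W f. open W \<and> W \<subseteq> U \<and> smooth_fun A W f \<longrightarrow> smooth_fun A W (\<lambda>p. X p f))"

definition lie_bracket ::
  "('m::topological_space, 'e::euclidean_space) chart set \<Rightarrow>
     ('m, real) field \<Rightarrow> ('m, real) field \<Rightarrow> ('m, real) field" where
  "lie_bracket A X Y = (\<lambda>p f. if smooth_near A p f
     then X p (\<lambda>q. Y q f) - Y p (\<lambda>q. X q f) else 0)"


section \<open>Almost Hermitian structures\<close>

type_synonym 'm endo = "'m \<Rightarrow> ('m, real) vec \<Rightarrow> ('m, real) vec"
type_synonym 'm metric = "'m \<Rightarrow> ('m, real) vec \<Rightarrow> ('m, real) vec \<Rightarrow> real"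

definition almost_complex ::
  "('m::topological_space, 'e::euclidean_space) chart set \<Rightarrow> 'm endo \<Rightarrow> bool" where
  "almost_complex A J \<longleftrightarrow>
     (\<forall>p. \<forall>u\<in>tangent_space A p. J p u \<in> tangent_space A p \<and> J p (J p u) = vscale (-1) u) \<and>
     (\<forall>p. \<forall>u\<in>tangent_space A p. \<forall>v\<in>tangent_space A p. J p (vadd u v) = vadd (J p u) (J p v)) \<and>
     (\<forall>p. \<forall>u\<in>tangent_space A p. \<forall>a. J p (vscale a u) = vscale a (J p u)) \<and>
     (\<forall>U X. open U \<and> vfield A U X \<longrightarrow> vfield A U (\<lambda>p. J p (X p)))"

definition riemannian_metric ::
  "('m::topological_space, 'e::euclidean_space) chart set \<Rightarrow> 'm metric \<Rightarrow> bool" where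
  "riemannian_metric A g \<longleftrightarrow>
     (\<forall>p. \<forall>u\<in>tangent_space A p. \<forall>v\<in>tangent_space A p. g p u v = g p v u) \<and>
     (\<forall>p. \<forall>u\<in>tangent_space A p. \<forall>v\<in>tangent_space A p. \<forall>w\<in>tangent_space A p.
        g p (vadd u v) w = g p u w + g p v w) \<and>
     (\<forall>p. \<forall>u\<in>tangent_space A p. \<forall>v\<in>tangent_space A p. \<forall>a. g p (vscale a u) v = a * g p u v) \<and>
     (\<forall>p. \<forall>u\<in>tangent_space A p. u \<noteq> vzero \<longrightarrow> g p u u > 0) \<and>
     (\<forall>U X Y. open U \<and> vfield A U X \<and> vfield A U Y \<longrightarrow> smooth_fun A U (\<lambda>p. g p (X p) (Y p)))"

definition almost_hermitian ::
  "nat \<Rightarrow> ('m::{t2_space,second_countable_topology}, 'e::euclidean_space) chart set \<Rightarrow>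
     'm endo \<Rightarrow> 'm metric \<Rightarrow> bool" where
  "almost_hermitian n A J g \<longleftrightarrow>
     smooth_atlas A \<and> DIM('e) = 2 * n \<and> almost_complex A J \<and> riemannian_metric A g \<and>
     (\<forall>p. \<forall>u\<in>tangent_space A p. \<forall>v\<in>tangent_space A p. g p (J p u) (J p v) = g p u v)"


section \<open>Connections on the tangent bundle\<close>

type_synonym 'm conn = "('m, real) field \<Rightarrow> ('m, real) field \<Rightarrow> ('m, real) field"

text \<open>A connection acts on vector fields over every open set, compatibly with restriction
  (second clause).\<close>

definition connection ::
  "('m::topological_space, 'e::euclidean_space) chart set \<Rightarrow> 'm conn \<Rightarrow> bool" where
  "connection A D \<longleftrightarrow>
     (\<forall>U X Y. open U \<and> vfield A U X \<and> vfield A U Y \<longrightarrow> vfield A U (D X Y)) \<and>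
     (\<forall>U X Y X' Y'. open U \<and> vfield A U X \<and> vfield A U Y \<and>
        (\<forall>p\<in>U. X' p = X p) \<and> (\<forall>p\<in>U. Y' p = Y p) \<longrightarrow> (\<forall>p\<in>U. D X' Y' p = D X Y p)) \<and>
     (\<forall>U X Y Z. open U \<and> vfield A U X \<and> vfield A U Y \<and> vfield A U Z \<longrightarrow> (\<forall>p\<in>U.
        D (\<lambda>q. vadd (X q) (Y q)) Z p = vadd (D X Z p) (D Y Z p) \<and>
        D X (\<lambda>q. vadd (Y q) (Z q)) p = vadd (D X Y p) (D X Z p))) \<and>
     (\<forall>U X Y f. open U \<and> vfield A U X \<and> vfield A U Y \<and> smooth_fun A U f \<longrightarrow> (\<forall>p\<in>U.
        D (\<lambda>q. vscale (f q) (X q)) Y p = vscale (f p) (D X Y p) \<and>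
        D X (\<lambda>q. vscale (f q) (Y q)) p = vadd (vscale (X p f) (Y p)) (vscale (f p) (D X Y p))))"

definition torsion ::
  "('m::topological_space, 'e::euclidean_space) chart set \<Rightarrow> 'm conn \<Rightarrow>
     ('m, real) field \<Rightarrow> ('m, real) field \<Rightarrow> ('m, real) field" where
  "torsion A D X Y = (\<lambda>p. vsub (vsub (D X Y p) (D Y X p)) (lie_bracket A X Y p))"

definition metric_connection ::
  "('m::topological_space, 'e::euclidean_space) chart set \<Rightarrow> 'm metric \<Rightarrow> 'm conn \<Rightarrow> bool" where
  "metric_connection A g D \<longleftrightarrow>
     (\<forall>U X Y Z. open U \<and> vfield A U X \<and> vfield A U Y \<and> vfield A U Z \<longrightarrow>
        (\<forall>p\<in>U. X p (\<lambda>q. g q (Y q) (Z q)) = g p (D X Y p) (Z p) + g p (Y p) (D X Z p)))"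

definition levi_civita ::
  "('m::topological_space, 'e::euclidean_space) chart set \<Rightarrow> 'm metric \<Rightarrow> 'm conn \<Rightarrow> bool" where
  "levi_civita A g D \<longleftrightarrow> connection A D \<and> metric_connection A g D \<and>
     (\<forall>U X Y. open U \<and> vfield A U X \<and> vfield A U Y \<longrightarrow> (\<forall>p\<in>U. torsion A D X Y p = vzero))"

definition cov_deriv_J :: "'m conn \<Rightarrow> 'm endo \<Rightarrow> ('m, real) field \<Rightarrow> ('m, real) field \<Rightarrow> ('m, real) field"
  where "cov_deriv_J D J X Y = (\<lambda>p. vsub (D X (\<lambda>q. J q (Y q)) p) (J p (D X Y p)))"

definition nearly_kaehler ::
  "nat \<Rightarrow> ('m::{t2_space,second_countable_topology}, 'e::euclidean_space) chart set \<Rightarrow>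
     'm endo \<Rightarrow> 'm metric \<Rightarrow> bool" where
  "nearly_kaehler n A J g \<longleftrightarrow> almost_hermitian n A J g \<and>
     (\<exists>D. levi_civita A g D \<and>
       (\<forall>U X. open U \<and> vfield A U X \<longrightarrow> (\<forall>p\<in>U. cov_deriv_J D J X X p = vzero)))"

text \<open>Integrability is the vanishing of the Nijenhuis tensor.\<close>

definition nijenhuis ::
  "('m::topological_space, 'e::euclidean_space) chart set \<Rightarrow> 'm endo \<Rightarrow>
     ('m, real) field \<Rightarrow> ('m, real) field \<Rightarrow> ('m, real) field" where
  "nijenhuis A J X Y = (let JX = (\<lambda>q. J q (X q)); JY = (\<lambda>q. J q (Y q)) in
     (\<lambda>p. vsub (vsub (vsub (lie_bracket A JX JY p) (J p (lie_bracket A JX Y p)))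
                 (J p (lie_bracket A X JY p))) (lie_bracket A X Y p)))"

definition integrable_acs ::
  "('m::topological_space, 'e::euclidean_space) chart set \<Rightarrow> 'm endo \<Rightarrow> bool" where
  "integrable_acs A J \<longleftrightarrow>
     (\<forall>U X Y. open U \<and> vfield A U X \<and> vfield A U Y \<longrightarrow> (\<forall>p\<in>U. nijenhuis A J X Y p = vzero))"

definition fundamental_form :: "'m endo \<Rightarrow> 'm metric \<Rightarrow> 'm metric" where
  "fundamental_form J g = (\<lambda>p u v. g p (J p u) v)"

definition closed_2form ::
  "('m::topological_space, 'e::euclidean_space) chart set \<Rightarrow>
     ('m \<Rightarrow> ('m, real) vec \<Rightarrow> ('m, real) vec \<Rightarrow> real) \<Rightarrow> bool" where
  "closed_2form A \<omega> \<longleftrightarrow>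
     (\<forall>U X Y Z. open U \<and> vfield A U X \<and> vfield A U Y \<and> vfield A U Z \<longrightarrow> (\<forall>p\<in>U.
        X p (\<lambda>q. \<omega> q (Y q) (Z q)) + Y p (\<lambda>q. \<omega> q (Z q) (X q)) + Z p (\<lambda>q. \<omega> q (X q) (Y q))
        - \<omega> p (lie_bracket A X Y p) (Z p) - \<omega> p (lie_bracket A Y Z p) (X p)
        - \<omega> p (lie_bracket A Z X p) (Y p) = 0))"

definition kaehler ::
  "nat \<Rightarrow> ('m::{t2_space,second_countable_topology}, 'e::euclidean_space) chart set \<Rightarrow>
     'm endo \<Rightarrow> 'm metric \<Rightarrow> bool" where
  "kaehler n A J g \<longleftrightarrow> almost_hermitian n A J g \<and> integrable_acs A J \<and>
     closed_2form A (fundamental_form J g)"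


section \<open>Complexification\<close>

definition re_vec :: "('m, complex) vec \<Rightarrow> ('m, real) vec" where
  "re_vec z = (\<lambda>f. Re (z f))"
definition im_vec :: "('m, complex) vec \<Rightarrow> ('m, real) vec" where
  "im_vec z = (\<lambda>f. Im (z f))"
definition complex_vec :: "('m, real) vec \<Rightarrow> ('m, real) vec \<Rightarrow> ('m, complex) vec" where
  "complex_vec u v = (\<lambda>f. Complex (u f) (v f))"

definition re_field :: "('m, complex) field \<Rightarrow> ('m, real) field" where
  "re_field X = (\<lambda>p. re_vec (X p))"
definition im_field :: "('m, complex) field \<Rightarrow> ('m, real) field" where
  "im_field X = (\<lambda>p. im_vec (X p))"
definition cnj_field :: "('m, complex) field \<Rightarrow> ('m, complex) field" where
  "cnj_field X = (\<lambda>p f. cnj (X p f))"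

definition complex_vfield ::
  "('m::topological_space, 'e::euclidean_space) chart set \<Rightarrow> 'm set \<Rightarrow> ('m, complex) field \<Rightarrow> bool" where
  "complex_vfield A U X \<longleftrightarrow> vfield A U (re_field X) \<and> vfield A U (im_field X)"

text \<open>Complex linear extensions of endomorphisms, of the metric, and of bilinear operations on
  vector fields (connections, Lie bracket, torsion).\<close>

definition endo_C :: "'m endo \<Rightarrow> 'm \<Rightarrow> ('m, complex) vec \<Rightarrow> ('m, complex) vec" where
  "endo_C J p z = complex_vec (J p (re_vec z)) (J p (im_vec z))"

definition metric_C :: "'m metric \<Rightarrow> 'm \<Rightarrow> ('m, complex) vec \<Rightarrow> ('m, complex) vec \<Rightarrow> complex" where
  "metric_C g p z w = Complex
     (g p (re_vec z) (re_vec w) - g p (im_vec z) (im_vec w))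
     (g p (re_vec z) (im_vec w) + g p (im_vec z) (re_vec w))"

definition ext_C ::
  "(('m, real) field \<Rightarrow> ('m, real) field \<Rightarrow> ('m, real) field) \<Rightarrow>
     ('m, complex) field \<Rightarrow> ('m, complex) field \<Rightarrow> ('m, complex) field" where
  "ext_C B X Y = (\<lambda>p. complex_vec
     (vsub (B (re_field X) (re_field Y) p) (B (im_field X) (im_field Y) p))
     (vadd (B (re_field X) (im_field Y) p) (B (im_field X) (re_field Y) p)))"

definition T10 ::
  "('m::topological_space, 'e::euclidean_space) chart set \<Rightarrow> 'm endo \<Rightarrow> 'm \<Rightarrow> ('m, complex) vec set" where
  "T10 A J p = {z. re_vec z \<in> tangent_space A p \<and> im_vec z \<in> tangent_space A p \<and>
     endo_C J p z = vscale \<i> z}"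

definition field_10 ::
  "('m::topological_space, 'e::euclidean_space) chart set \<Rightarrow> 'm endo \<Rightarrow> 'm set \<Rightarrow> ('m, complex) field \<Rightarrow> bool"
  where "field_10 A J U X \<longleftrightarrow> complex_vfield A U X \<and> (\<forall>p\<in>U. X p \<in> T10 A J p)"


section \<open>The canonical connection and its Ricci curvature\<close>

definition canonical_connection ::
  "('m::topological_space, 'e::euclidean_space) chart set \<Rightarrow> 'm endo \<Rightarrow> 'm metric \<Rightarrow> 'm conn \<Rightarrow> bool" where
  "canonical_connection A J g D \<longleftrightarrow> connection A D \<and> metric_connection A g D \<and>
     (\<forall>U X Y. open U \<and> vfield A U X \<and> vfield A U Y \<longrightarrow> (\<forall>p\<in>U. cov_deriv_J D J X Y p = vzero)) \<and>
     (\<forall>U X Y. open U \<and> field_10 A J U X \<and> field_10 A J U Y \<longrightarrow>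
        (\<forall>p\<in>U. ext_C (torsion A D) X (cnj_field Y) p = vzero))"

definition curvature ::
  "('m::topological_space, 'e::euclidean_space) chart set \<Rightarrow> 'm conn \<Rightarrow>
     ('m, complex) field \<Rightarrow> ('m, complex) field \<Rightarrow> ('m, complex) field \<Rightarrow> ('m, complex) field" where
  "curvature A D X Y Z = (let DC = ext_C D in
     (\<lambda>p. vsub (vsub (DC X (DC Y Z) p) (DC Y (DC X Z) p)) (DC (ext_C (lie_bracket A) X Y) Z p)))"

definition curvature4 ::
  "('m::topological_space, 'e::euclidean_space) chart set \<Rightarrow> 'm metric \<Rightarrow> 'm conn \<Rightarrow>
     ('m, complex) field \<Rightarrow> ('m, complex) field \<Rightarrow> ('m, complex) field \<Rightarrow> ('m, complex) field \<Rightarrow>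
     'm \<Rightarrow> complex" where
  "curvature4 A g D X Y Z W p = metric_C g p (curvature A D Z W X p) (Y p)"

definition unitary_frame ::
  "nat \<Rightarrow> ('m::topological_space, 'e::euclidean_space) chart set \<Rightarrow> 'm endo \<Rightarrow> 'm metric \<Rightarrow>
     'm set \<Rightarrow> (nat \<Rightarrow> ('m, complex) field) \<Rightarrow> bool" where
  "unitary_frame n A J g U e \<longleftrightarrow>
     (\<forall>i<n. field_10 A J U (e i)) \<and>
     (\<forall>p\<in>U. \<forall>z\<in>T10 A J p. \<exists>c. z = (\<lambda>f. \<Sum>i<n. c i * e i p f)) \<and>
     (\<forall>p\<in>U. \<forall>i<n. \<forall>j<n. metric_C g p (e i p) (cnj_field (e j) p) = (if i = j then 1 else 0))"

definition first_ricci ::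
  "nat \<Rightarrow> ('m::topological_space, 'e::euclidean_space) chart set \<Rightarrow> 'm metric \<Rightarrow> 'm conn \<Rightarrow>
     (nat \<Rightarrow> ('m, complex) field) \<Rightarrow> 'm \<Rightarrow> nat \<Rightarrow> nat \<Rightarrow> complex" where
  "first_ricci n A g D e p i j =
     (\<Sum>l<n. curvature4 A g D (e l) (cnj_field (e l)) (e i) (cnj_field (e j)) p)"

definition pos_definite :: "nat \<Rightarrow> (nat \<Rightarrow> nat \<Rightarrow> complex) \<Rightarrow> bool" where
  "pos_definite n H \<longleftrightarrow> (\<forall>i<n. \<forall>j<n. H j i = cnj (H i j)) \<and>
     (\<forall>\<xi>. (\<exists>i<n. \<xi> i \<noteq> 0) \<longrightarrow> Re (\<Sum>i<n. \<Sum>j<n. H i j * \<xi> i * cnj (\<xi> j)) > 0)"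

definition neg_definite :: "nat \<Rightarrow> (nat \<Rightarrow> nat \<Rightarrow> complex) \<Rightarrow> bool" where
  "neg_definite n H \<longleftrightarrow> pos_definite n (\<lambda>i j. - H i j)"

text \<open>On a nearly Kaehler manifold the first and the second Ricci curvature of the canonical
  connection (the sum of R(e_i, cnj e_j, e_l, cnj e_l) over l) coincide; the common form is
  represented here by the first one. Definiteness does not
  depend on the local unitary frame around p.\<close>

definition ricci_positive_at ::
  "nat \<Rightarrow> ('m::topological_space, 'e::euclidean_space) chart set \<Rightarrow> 'm endo \<Rightarrow> 'm metric \<Rightarrow> 'm conn \<Rightarrow>
     'm \<Rightarrow> bool" where
  "ricci_positive_at n A J g D p \<longleftrightarrow> (\<exists>U e. open U \<and> p \<in> U \<and> unitary_frame n A J g U e \<and>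
     pos_definite n (first_ricci n A g D e p))"

definition ricci_negative_at ::
  "nat \<Rightarrow> ('m::topological_space, 'e::euclidean_space) chart set \<Rightarrow> 'm endo \<Rightarrow> 'm metric \<Rightarrow> 'm conn \<Rightarrow>
     'm \<Rightarrow> bool" where
  "ricci_negative_at n A J g D p \<longleftrightarrow> (\<exists>U e. open U \<and> p \<in> U \<and> unitary_frame n A J g U e \<and>
     neg_definite n (first_ricci n A g D e p))"

end

theory Submission
  imports Defs
begin

text \<open>Let \<tau> be the torsion of the canonical connection. The nearly Kaehler condition
  makes \<langle>\<tau>(X, Y), Z\<rangle> totally skew with \<tau>(JX, Y) = - J\<tau>(X, Y), that is,
  a form of type (3,0) + (0,3). Comparing types in the first Bianchi identity shows that \<tau> is
  parallel, and then that the curvature is symmetric under exchange of pairs. So the curvature acts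
  trivially on \<tau>. Let S be the sum of R(u, Ju) over a unitary basis of vectors u; by pair
  symmetry, S is the first Ricci curvature composed with J. At a point where the Ricci curvature is
  definite, S acting trivially on \<tau> gives a vanishing sum of terms Ric(\<tau>(a, b), \<tau>(a,
  b)) over an orthonormal basis, hence \<tau> = 0 there. In a chart the components of a parallel
  tensor satisfy a linear differential equation along segments, so the zero set of \<tau> is open and
  closed, and \<tau> vanishes identically; then J is integrable and the fundamental form is
  closed.\<close>

section \<open>Calculus of smooth functions\<close>

text \<open>Types are handled through real fields: a (1,0)-vector is X - iJX with X real, so a
  statement about types becomes a linear identity between real values with J inserted in some slots.
  Total skewness gives more than a symmetry: the inner product depends on its arguments only at the
  point, and skewness spreads this to every slot of \<tau>, so that arbitrary local fields can be
  used in tensor identities. Definiteness is given at a single point. Parallelism therefore serves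
  twice: it makes S act trivially on \<tau> at that point, and it carries the vanishing of \<tau> to
  the rest of M. Since S is skew, pairing its action on \<tau> with \<tau> itself yields only the
  trivial 0 = 0; the Ricci form appears after pairing with \<tau>(J ., .). M need not carry a global
  frame or global coordinates, so each argument takes place over a fixed open set U, and only
  pointwise conclusions leave it.\<close>

lemma frechet_derivative_cong_open:
  assumes "open S" "x \<in> S" "\<And>y. y \<in> S \<Longrightarrow> f y = g y"
  shows "frechet_derivative f (at x) = frechet_derivative g (at x)"
proof -
  have "(f has_derivative D) (at x) \<longleftrightarrow> (g has_derivative D) (at x)" for D
    using has_derivative_transform_within_open[OF _ assms(1,2), of f D UNIV g]
      has_derivative_transform_within_open[OF _ assms(1,2), of g D UNIV f] assms(3) by auto
  \<comment> \<open>\<open>frechet_derivative\<close> is a choice among the possible derivatives;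
    equal predicates give the same choice, also where f is not differentiable.\<close>
  then show ?thesis unfolding frechet_derivative_def by presburger
qed

lemma frechet_derivative_eqI: "(f has_derivative D) (at x) \<Longrightarrow> frechet_derivative f (at x) v = D v"
  using frechet_derivative_at by metis

lemma Ck_on_cong:
  assumes "open S" "Ck_on k S f" "\<And>y. y \<in> S \<Longrightarrow> f y = g y"
  shows "Ck_on k S g"
  using assms(2,3)
proof (induction k arbitrary: f g)
  case 0
  then show ?case using continuous_on_cong by (metis Ck_on.simps(1))
next
  case (Suc k)
  have "g differentiable (at x)" if "x \<in> S" for x
  proof -
    have "f differentiable (at x)" using Suc.prems(1) that by simp
    then obtain D where "(f has_derivative D) (at x)" unfolding differentiable_def ..
    then have "(g has_derivative D) (at x)"
      using assms(1) that Suc.prems(2) by (rule has_derivative_transform_within_open)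
    then show ?thesis by (rule differentiableI)
  qed
  moreover have "Ck_on k S (\<lambda>x. frechet_derivative g (at x) v)" for v
  proof (rule Suc.IH)
    show "Ck_on k S (\<lambda>x. frechet_derivative f (at x) v)" using Suc.prems(1) by simp
    show "frechet_derivative f (at y) v = frechet_derivative g (at y) v" if "y \<in> S" for y
      by (rule fun_cong[OF frechet_derivative_cong_open]) (use assms(1) that Suc.prems(2) in auto)
  qed
  ultimately show ?case unfolding Ck_on.simps by blast
qed

lemma Ck_on_subset: "Ck_on k S f \<Longrightarrow> T \<subseteq> S \<Longrightarrow> Ck_on k T f"
  by (induction k arbitrary: f) (auto intro: continuous_on_subset)

lemma Ck_on_continuous: "Ck_on k S f \<Longrightarrow> continuous_on S f"
  by (cases k) (auto simp: differentiable_imp_continuous_within continuous_at_imp_continuous_on)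

text \<open>The recursion speaks of the derivatives of f and not of f itself at order k, so the
  descent takes an induction of its own; it ends with differentiable functions being
  continuous.\<close>

lemma Ck_on_Suc_imp: "Ck_on (Suc k) S f \<Longrightarrow> Ck_on k S f"
proof (induction k arbitrary: f)
  case 0
  then show ?case using Ck_on_continuous Ck_on.simps(1) by blast
next
  case (Suc k)
  have "\<forall>v. Ck_on k S (\<lambda>x. frechet_derivative f (at x) v)"
    using Suc.prems Suc.IH unfolding Ck_on.simps(2)[of "Suc k" S f] by blast
  then show ?case using Suc.prems by simp
qed

lemma Ck_on_const: "Ck_on k S (\<lambda>_. c)"
proof (induction k arbitrary: c)
  case (Suc k)
  have "frechet_derivative (\<lambda>_. c) (at x) v = 0" for x :: 'a and v
    by (rule frechet_derivative_eqI[OF has_derivative_const])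
  then show ?case using Suc by simp
qed simp

lemma Ck_on_add:
  assumes "open S" "Ck_on k S f" "Ck_on k S g"
  shows "Ck_on k S (\<lambda>x. f x + g x)"
  using assms(2,3)
proof (induction k arbitrary: f g)
  case 0
  then show ?case by (simp add: continuous_on_add)
next
  case (Suc k)
  have "Ck_on k S (\<lambda>x. frechet_derivative (\<lambda>x. f x + g x) (at x) v)" for v
  proof (rule Ck_on_cong[OF assms(1) Suc.IH])
    fix y assume "y \<in> S"
    then have "f differentiable (at y)" "g differentiable (at y)" using Suc.prems by auto
    then show "frechet_derivative f (at y) v + frechet_derivative g (at y) v =
      frechet_derivative (\<lambda>x. f x + g x) (at y) v"
      by (intro frechet_derivative_eqI[symmetric] has_derivative_add)
        (simp_all add: frechet_derivative_works)
  qed (use Suc.prems in auto)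
  then show ?case using Suc.prems unfolding Ck_on.simps by (blast intro: differentiable_add)
qed

lemma Ck_on_mult:
  fixes f g :: "'a::euclidean_space \<Rightarrow> real"
  assumes "open S" "Ck_on k S f" "Ck_on k S g"
  shows "Ck_on k S (\<lambda>x. f x * g x)"
  using assms(2,3)
proof (induction k arbitrary: f g)
  case 0
  then show ?case unfolding Ck_on.simps by (rule continuous_on_mult)
next
  case (Suc k)
  have fg: "Ck_on k S f" "Ck_on k S g" using Suc.prems by (blast intro: Ck_on_Suc_imp)+
  have "Ck_on k S (\<lambda>x. frechet_derivative (\<lambda>x. f x * g x) (at x) v)" for v
  proof (rule Ck_on_cong[OF assms(1)])
    show "Ck_on k S (\<lambda>x. f x * frechet_derivative g (at x) v + frechet_derivative f (at x) v * g x)"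
      using Suc.prems fg
      by (intro Ck_on_add[OF assms(1)] Suc.IH[of f "\<lambda>x. frechet_derivative g (at x) v"]
          Suc.IH[of "\<lambda>x. frechet_derivative f (at x) v" g]) simp_all
  next
    fix y assume "y \<in> S"
    then have "f differentiable (at y)" "g differentiable (at y)" using Suc.prems by auto
    then show "f y * frechet_derivative g (at y) v + frechet_derivative f (at y) v * g y =
      frechet_derivative (\<lambda>x. f x * g x) (at y) v"
      by (intro frechet_derivative_eqI[symmetric] has_derivative_mult)
        (simp_all add: frechet_derivative_works)
  qed
  then show ?case using Suc.prems unfolding Ck_on.simps by (blast intro: differentiable_mult)
qed

lemma Ck_on_sum:
  assumes "open S" "\<And>i. i \<in> I \<Longrightarrow> Ck_on k S (f i)"
  shows "Ck_on k S (\<lambda>x. \<Sum>i\<in>I. f i x)"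
  using assms(2)
  by (induction I rule: infinite_finite_induct) (simp_all add: Ck_on_const Ck_on_add[OF assms(1)])

lemma Ck_on_inner:
  assumes "open S" "Ck_on k S f"
  shows "Ck_on k S (\<lambda>x. f x \<bullet> b)"
  using assms(2)
proof (induction k arbitrary: f)
  case 0
  then show ?case by (simp add: continuous_on_inner)
next
  case (Suc k)
  have D: "((\<lambda>x. f x \<bullet> b) has_derivative (\<lambda>v. frechet_derivative f (at y) v \<bullet> b)) (at y)"
    if "y \<in> S" for y
    using Suc.prems that by (intro has_derivative_inner_left) (auto simp: frechet_derivative_works)
  have "Ck_on k S (\<lambda>x. frechet_derivative (\<lambda>x. f x \<bullet> b) (at x) v)" for v
  proof (rule Ck_on_cong[OF assms(1) Suc.IH])
    show "Ck_on k S (\<lambda>x. frechet_derivative f (at x) v)" using Suc.prems by simp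
    show "frechet_derivative f (at y) v \<bullet> b = frechet_derivative (\<lambda>x. f x \<bullet> b) (at y) v"
      if "y \<in> S" for y using frechet_derivative_eqI[OF D[OF that]] by simp
  qed
  then show ?case using D by (auto simp: differentiable_def)
qed

text \<open>The chain rule in coordinates of the intermediate space. It presents the derivative as a
  sum of products of real functions, to which the closure lemmas for \<open>Ck_on\<close>
  apply.\<close>

lemma frechet_derivative_compose_basis:
  fixes h :: "'a::euclidean_space \<Rightarrow> 'b::euclidean_space" and f :: "'b \<Rightarrow> real"
  assumes "h differentiable (at x)" "f differentiable (at (h x))"
  shows "frechet_derivative (f \<circ> h) (at x) v =
    (\<Sum>b\<in>Basis. (frechet_derivative h (at x) v \<bullet> b) * frechet_derivative f (at (h x)) b)"
proof -
  let ?f = "frechet_derivative f (at (h x))" and ?w = "frechet_derivative h (at x) v"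
  have lin: "linear ?f" using assms(2) by (rule linear_frechet_derivative)
  have "frechet_derivative (f \<circ> h) (at x) v = ?f ?w"
    using frechet_derivative_compose assms by (metis comp_apply)
  also have "\<dots> = ?f (\<Sum>b\<in>Basis. (?w \<bullet> b) *\<^sub>R b)" by (simp only: euclidean_representation)
  also have "\<dots> = (\<Sum>b\<in>Basis. (?w \<bullet> b) * ?f b)"
    by (simp add: linear_sum[OF lin] linear_cmul[OF lin])
  finally show ?thesis .
qed

lemma Ck_on_compose:
  fixes h :: "'a::euclidean_space \<Rightarrow> 'b::euclidean_space" and f :: "'b \<Rightarrow> real"
  assumes "open S" "open T" "h ` S \<subseteq> T" "Ck_on k S h" "Ck_on k T f"
  shows "Ck_on k S (f \<circ> h)"
  using assms(4,5)
proof (induction k arbitrary: f)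
  case 0
  then show ?case using assms(3) continuous_on_compose continuous_on_subset by (metis Ck_on.simps(1))
next
  case (Suc k)
  have d: "h differentiable (at x)" "f differentiable (at (h x))" if "x \<in> S" for x
    using Suc.prems that assms(3) by auto
  have "Ck_on k S (\<lambda>x. frechet_derivative (f \<circ> h) (at x) v)" for v
  proof (rule Ck_on_cong[OF assms(1)])
    \<comment> \<open>The derivative of f enters as another composite with h, which is why the
      induction hypothesis is kept general in f.\<close>
    show "Ck_on k S (\<lambda>x. \<Sum>b\<in>Basis. (frechet_derivative h (at x) v \<bullet> b) *
        ((\<lambda>y. frechet_derivative f (at y) b) \<circ> h) x)"
    proof (rule Ck_on_sum[OF assms(1)], rule Ck_on_mult[OF assms(1)])
      fix b :: 'b
      show "Ck_on k S (\<lambda>x. frechet_derivative h (at x) v \<bullet> b)"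
        by (rule Ck_on_inner[OF assms(1)]) (use Suc.prems(1) in simp)
      show "Ck_on k S (\<lambda>x. ((\<lambda>y. frechet_derivative f (at y) b) \<circ> h) x)"
        unfolding eta_contract_eq
        by (rule Suc.IH[OF Ck_on_Suc_imp[OF Suc.prems(1)]]) (use Suc.prems(2) in simp)
    qed
  qed (simp add: frechet_derivative_compose_basis d)
  then show ?case using d by (simp del: o_apply add: differentiable_chain_at)
qed

lemma smooth_on_cong: "open S \<Longrightarrow> smooth_on S f \<Longrightarrow> (\<And>y. y \<in> S \<Longrightarrow> f y = g y) \<Longrightarrow> smooth_on S g"
  unfolding smooth_on_def using Ck_on_cong by metis

lemma smooth_on_subset: "smooth_on S f \<Longrightarrow> T \<subseteq> S \<Longrightarrow> smooth_on T f"
  unfolding smooth_on_def using Ck_on_subset by metis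

lemma smooth_on_const: "smooth_on S (\<lambda>_. c)"
  by (simp add: smooth_on_def Ck_on_const)

lemma smooth_on_add: "open S \<Longrightarrow> smooth_on S f \<Longrightarrow> smooth_on S g \<Longrightarrow> smooth_on S (\<lambda>x. f x + g x)"
  by (simp add: smooth_on_def Ck_on_add)

lemma smooth_on_mult:
  fixes f g :: "'a::euclidean_space \<Rightarrow> real"
  shows "open S \<Longrightarrow> smooth_on S f \<Longrightarrow> smooth_on S g \<Longrightarrow> smooth_on S (\<lambda>x. f x * g x)"
  by (simp add: smooth_on_def Ck_on_mult)

lemma smooth_on_inner: "open S \<Longrightarrow> smooth_on S f \<Longrightarrow> smooth_on S (\<lambda>x. f x \<bullet> b)"
  by (simp add: smooth_on_def Ck_on_inner)

lemma smooth_on_compose: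
  fixes h :: "'a::euclidean_space \<Rightarrow> 'b::euclidean_space" and f :: "'b \<Rightarrow> real"
  shows "open S \<Longrightarrow> open T \<Longrightarrow> h ` S \<subseteq> T \<Longrightarrow> smooth_on S h \<Longrightarrow> smooth_on T f \<Longrightarrow> smooth_on S (f \<circ> h)"
  by (simp add: smooth_on_def Ck_on_compose)

lemma smooth_on_differentiable: "smooth_on S f \<Longrightarrow> x \<in> S \<Longrightarrow> f differentiable (at x)"
  unfolding smooth_on_def by (metis Ck_on.simps(2))

lemma smooth_on_continuous: "smooth_on S f \<Longrightarrow> continuous_on S f"
  unfolding smooth_on_def by (metis Ck_on.simps(1))

lemma smooth_on_derivative: "smooth_on S f \<Longrightarrow> smooth_on S (\<lambda>x. frechet_derivative f (at x) v)"
  unfolding smooth_on_def by (metis Ck_on.simps(2))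

section \<open>Smooth functions and tangent vectors on a manifold\<close>

text \<open>The constant coordinate vector w as a field. The default 0 copies the one in
  \<open>tangent_space\<close>, so that tangent vectors are literally values of
  \<open>chart_vec\<close>.\<close>

definition chart_vec ::
  "('m::topological_space, 'e::euclidean_space) chart set \<Rightarrow> ('m, 'e) chart \<Rightarrow> 'e \<Rightarrow> ('m, real) field"
  where "chart_vec A c w p = (\<lambda>f. if smooth_near A p f
     then frechet_derivative (f \<circ> chart_inv c) (at (snd c p)) w else 0)"

locale atlas =
  fixes A :: "('m::{t2_space,second_countable_topology}, 'e::euclidean_space) chart set"
  assumes smooth_atlas: "smooth_atlas A"
begin

lemma chart: "c \<in> A \<Longrightarrow> is_chart c"
  using smooth_atlas by (simp add: smooth_atlas_def)

lemma chart_open: "c \<in> A \<Longrightarrow> open (fst c)"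
  using chart by (simp add: is_chart_def)

lemma ex_chart: "\<exists>c\<in>A. p \<in> fst c"
proof -
  have "p \<in> (\<Union>c\<in>A. fst c)" using smooth_atlas by (simp add: smooth_atlas_def)
  then show ?thesis by blast
qed

lemma chart_inv_left [simp]: "c \<in> A \<Longrightarrow> q \<in> fst c \<Longrightarrow> chart_inv c (snd c q) = q"
  using chart unfolding is_chart_def homeomorphism_def by blast

lemma chart_image_open: "c \<in> A \<Longrightarrow> open W \<Longrightarrow> open (snd c ` (W \<inter> fst c))"
proof -
  assume c: "c \<in> A" and "open W"
  then have h: "homeomorphism (fst c) (snd c ` fst c) (snd c) (chart_inv c)" "open (snd c ` fst c)"
    using chart unfolding is_chart_def by auto
  have "openin (top_of_set (fst c)) (W \<inter> fst c)"
    using \<open>open W\<close> by (metis inf_commute openin_open_Int)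
  then have "openin (top_of_set (snd c ` fst c)) (snd c ` (W \<inter> fst c))"
    using homeomorphism_imp_open_map[OF h(1)] by blast
  then show ?thesis using h(2) openin_open_trans by blast
qed

lemma chart_image_open': "c \<in> A \<Longrightarrow> open W \<Longrightarrow> W \<subseteq> fst c \<Longrightarrow> open (snd c ` W)"
  using chart_image_open[of c W] by (simp add: Int_absorb2)

lemma transition_smooth:
  "c \<in> A \<Longrightarrow> d \<in> A \<Longrightarrow> smooth_on (snd c ` (fst c \<inter> fst d)) (snd d \<circ> chart_inv c)"
  using smooth_atlas by (simp add: smooth_atlas_def)

lemma smooth_funD: "smooth_fun A U f \<Longrightarrow> c \<in> A \<Longrightarrow> smooth_on (snd c ` (U \<inter> fst c)) (f \<circ> chart_inv c)"
  by (simp add: smooth_fun_def)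

lemma smooth_fun_cong:
  assumes "open U" "smooth_fun A U f" "\<And>q. q \<in> U \<Longrightarrow> f q = h q"
  shows "smooth_fun A U h"
  unfolding smooth_fun_def
proof
  fix c assume c: "c \<in> A"
  show "smooth_on (snd c ` (U \<inter> fst c)) (h \<circ> chart_inv c)"
    by (rule smooth_on_cong[OF chart_image_open[OF c assms(1)] smooth_funD[OF assms(2) c]])
      (use assms(3) c in auto)
qed

lemma smooth_fun_subset: "smooth_fun A U f \<Longrightarrow> W \<subseteq> U \<Longrightarrow> smooth_fun A W f"
  unfolding smooth_fun_def by (meson Int_mono image_mono order_refl smooth_on_subset)

lemma smooth_fun_const: "smooth_fun A U (\<lambda>_. c)"
  by (simp add: smooth_fun_def o_def smooth_on_const)

lemma smooth_fun_add:
  "open U \<Longrightarrow> smooth_fun A U f \<Longrightarrow> smooth_fun A U h \<Longrightarrow> smooth_fun A U (\<lambda>q. f q + h q)"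
  unfolding smooth_fun_def o_def by (intro ballI smooth_on_add chart_image_open) auto

lemma smooth_fun_mult:
  "open U \<Longrightarrow> smooth_fun A U f \<Longrightarrow> smooth_fun A U h \<Longrightarrow> smooth_fun A U (\<lambda>q. f q * h q)"
  unfolding smooth_fun_def o_def by (intro ballI smooth_on_mult chart_image_open) auto

lemma smooth_fun_cmult: "open U \<Longrightarrow> smooth_fun A U f \<Longrightarrow> smooth_fun A U (\<lambda>q. a * f q)"
  by (simp add: smooth_fun_mult smooth_fun_const)

text \<open>One chart around W suffices, because in any other chart the function is precomposed with
  a smooth transition map.\<close>

lemma smooth_funI_chart:
  assumes c: "c \<in> A" and W: "open W" "W \<subseteq> fst c" and f: "smooth_on (snd c ` W) (f \<circ> chart_inv c)"
  shows "smooth_fun A W f"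
  unfolding smooth_fun_def
proof
  fix d assume d: "d \<in> A"
  let ?S = "snd d ` (W \<inter> fst d)"
  have "smooth_on ?S (snd c \<circ> chart_inv d)"
    by (rule smooth_on_subset[OF transition_smooth[OF d c]]) (use W in blast)
  moreover have "(snd c \<circ> chart_inv d) ` ?S \<subseteq> snd c ` W" using d by auto
  ultimately have "smooth_on ?S ((f \<circ> chart_inv c) \<circ> (snd c \<circ> chart_inv d))"
    using smooth_on_compose chart_image_open[OF d W(1)] chart_image_open'[OF c W] f by blast
  then show "smooth_on ?S (f \<circ> chart_inv d)"
    by (rule smooth_on_cong[OF chart_image_open[OF d W(1)]]) (use W c d in auto)
qed

lemma smooth_fun_coord: "c \<in> A \<Longrightarrow> smooth_fun A (fst c) (\<lambda>q. snd c q \<bullet> b)"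
proof (rule smooth_funI_chart)
  assume c: "c \<in> A"
  have o: "open (snd c ` fst c)" using chart_image_open'[OF c] chart_open[OF c] by blast
  have "smooth_on (snd c ` fst c) ((\<lambda>x. x \<bullet> b) \<circ> (snd c \<circ> chart_inv c))"
    unfolding o_def using smooth_on_inner[OF o transition_smooth[OF c c, unfolded Int_absorb]]
    by (simp add: o_def)
  then show "smooth_on (snd c ` fst c) ((\<lambda>q. snd c q \<bullet> b) \<circ> chart_inv c)" by (simp add: o_def)
qed (auto simp: chart_open)

section \<open>Germs of smooth functions and tangent vectors\<close>

lemma smooth_nearI: "open U \<Longrightarrow> p \<in> U \<Longrightarrow> smooth_fun A U f \<Longrightarrow> smooth_near A p f"
  unfolding smooth_near_def by blast

lemma smooth_nearE:
  assumes "smooth_near A p f" "open V" "p \<in> V"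
  obtains U where "open U" "p \<in> U" "U \<subseteq> V" "smooth_fun A U f"
proof -
  obtain W where W: "open W" "p \<in> W" "smooth_fun A W f" using assms(1) unfolding smooth_near_def by blast
  show thesis
    by (rule that[of "W \<inter> V"]) (use W assms smooth_fun_subset in auto)
qed

lemma smooth_near_cong:
  assumes "open U" "p \<in> U" "\<And>q. q \<in> U \<Longrightarrow> f q = h q"
  shows "smooth_near A p f \<longleftrightarrow> smooth_near A p h"
proof -
  have *: "smooth_near A p h" if f: "smooth_near A p f" and fh: "\<And>q. q \<in> U \<Longrightarrow> f q = h q" for f h
  proof -
    obtain W where "open W" "p \<in> W" "W \<subseteq> U" "smooth_fun A W f"
      by (rule smooth_nearE[OF f assms(1,2)])
    then have "smooth_fun A W h" using fh by (intro smooth_fun_cong[of W f h]) auto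
    then show ?thesis using \<open>open W\<close> \<open>p \<in> W\<close> by (intro smooth_nearI)
  qed
  show ?thesis using *[of f h] *[of h f] assms(3) by auto
qed

lemma smooth_near_differentiable:
  assumes "smooth_near A p f" "c \<in> A" "p \<in> fst c"
  shows "(f \<circ> chart_inv c) differentiable (at (snd c p))"
proof -
  obtain W where "open W" "p \<in> W" "smooth_fun A W f" using assms(1) unfolding smooth_near_def by blast
  then show ?thesis
    using smooth_on_differentiable[OF smooth_funD[OF \<open>smooth_fun A W f\<close> assms(2)]] assms by blast
qed

text \<open>The chain rule along the transition map. It makes the existential choice of a chart in
  \<open>tangent_space\<close> harmless.\<close>

lemma chart_vec_change:
  assumes c: "c \<in> A" "p \<in> fst c" and d: "d \<in> A" "p \<in> fst d"
  shows "chart_vec A c w p =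
    chart_vec A d (frechet_derivative (snd d \<circ> chart_inv c) (at (snd c p)) w) p"
proof -
  have "frechet_derivative (f \<circ> chart_inv c) (at (snd c p)) w = frechet_derivative (f \<circ> chart_inv d)
      (at (snd d p)) (frechet_derivative (snd d \<circ> chart_inv c) (at (snd c p)) w)"
    if "smooth_near A p f" for f
  proof -
    let ?S = "snd c ` (fst d \<inter> fst c)" and ?h = "snd d \<circ> chart_inv c"
    have p: "snd c p \<in> ?S" using c d by blast
    have "frechet_derivative (f \<circ> chart_inv c) (at (snd c p)) =
        frechet_derivative ((f \<circ> chart_inv d) \<circ> ?h) (at (snd c p))"
      by (rule frechet_derivative_cong_open[OF chart_image_open[OF c(1) chart_open[OF d(1)]] p])
        (use c d in auto)
    also have "\<dots> = frechet_derivative (f \<circ> chart_inv d) (at (?h (snd c p))) \<circ>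
        frechet_derivative ?h (at (snd c p))"
    proof (rule frechet_derivative_compose)
      show "?h differentiable at (snd c p)"
        using smooth_on_differentiable[OF transition_smooth[OF c(1) d(1)]] c d by blast
      show "(f \<circ> chart_inv d) differentiable at (?h (snd c p))"
        using smooth_near_differentiable[OF that d] c by simp
    qed
    finally show ?thesis using c by simp
  qed
  then show ?thesis unfolding chart_vec_def by auto
qed

lemma tangent_space_chart:
  assumes "c \<in> A" "p \<in> fst c"
  shows "tangent_space A p = range (\<lambda>w. chart_vec A c w p)"
proof -
  have "tangent_space A p = {v. \<exists>d\<in>A. p \<in> fst d \<and> (\<exists>w. v = chart_vec A d w p)}"
    by (simp add: tangent_space_def chart_vec_def)
  also have "\<dots> = range (\<lambda>w. chart_vec A c w p)"
    using chart_vec_change[OF _ _ assms] assms by blast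
  finally show ?thesis .
qed

lemma chart_vec_linear:
  assumes "c \<in> A" "p \<in> fst c"
  shows "chart_vec A c (w + w') p f = chart_vec A c w p f + chart_vec A c w' p f"
    and "chart_vec A c (a *\<^sub>R w) p f = a * chart_vec A c w p f"
    and "chart_vec A c 0 p f = 0"
    and "chart_vec A c (\<Sum>b\<in>B. k b *\<^sub>R b) p f = (\<Sum>b\<in>B. k b * chart_vec A c b p f)"
proof -
  \<comment> \<open>Both cases are linear in w: off the functions smooth near p every
    \<open>chart_vec\<close> is 0.\<close>
  consider "smooth_near A p f" | "\<not> smooth_near A p f" by blast
  then have "linear (\<lambda>w. chart_vec A c w p f)"
  proof cases
    case 1
    then have "linear (frechet_derivative (f \<circ> chart_inv c) (at (snd c p)))"
      using smooth_near_differentiable assms linear_frechet_derivative by blast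
    then show ?thesis using 1 by (simp add: chart_vec_def)
  next
    case 2
    then show ?thesis by (simp add: chart_vec_def linear_iff)
  qed
  note l = this
  show "chart_vec A c (w + w') p f = chart_vec A c w p f + chart_vec A c w' p f"
    "chart_vec A c (a *\<^sub>R w) p f = a * chart_vec A c w p f"
    "chart_vec A c 0 p f = 0"
    "chart_vec A c (\<Sum>b\<in>B. k b *\<^sub>R b) p f = (\<Sum>b\<in>B. k b * chart_vec A c b p f)"
    using linear_add[OF l] linear_cmul[OF l] linear_0[OF l] linear_sum[OF l, of "\<lambda>b. k b *\<^sub>R b" B]
    by simp_all
qed

lemma chart_vec_tangent: "c \<in> A \<Longrightarrow> p \<in> fst c \<Longrightarrow> chart_vec A c w p \<in> tangent_space A p"
  by (simp add: tangent_space_chart)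

lemma tangentE:
  assumes "v \<in> tangent_space A p"
  obtains c w where "c \<in> A" "p \<in> fst c" "v = chart_vec A c w p"
proof -
  obtain c where c: "c \<in> A" "p \<in> fst c" using ex_chart by blast
  then show thesis using that assms tangent_space_chart[OF c] by blast
qed

lemma tangent_add:
  assumes "u \<in> tangent_space A p" "v \<in> tangent_space A p"
  shows "vadd u v \<in> tangent_space A p"
proof -
  obtain c where c: "c \<in> A" "p \<in> fst c" using ex_chart by blast
  then obtain w w' where "u = chart_vec A c w p" "v = chart_vec A c w' p"
    using assms tangent_space_chart by auto
  then have "vadd u v = chart_vec A c (w + w') p"
    using chart_vec_linear(1)[OF c] by (auto simp: vadd_def)
  then show ?thesis using chart_vec_tangent[OF c] by simp
qed

lemma tangent_scale:
  assumes "u \<in> tangent_space A p"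
  shows "vscale a u \<in> tangent_space A p"
proof -
  obtain c w where c: "c \<in> A" "p \<in> fst c" "u = chart_vec A c w p"
    using assms by (rule tangentE)
  then have "vscale a u = chart_vec A c (a *\<^sub>R w) p"
    using chart_vec_linear(2)[OF c(1,2)] by (auto simp: vscale_def)
  then show ?thesis using chart_vec_tangent[OF c(1,2)] by simp
qed

lemma vsub_eq: "vsub u v = vadd u (vscale (-1) v)"
  by (simp add: vsub_def vadd_def vscale_def)

lemma tangent_zero: "vzero \<in> tangent_space A p"
proof -
  obtain c where c: "c \<in> A" "p \<in> fst c" using ex_chart by blast
  then have "chart_vec A c 0 p = vzero" using chart_vec_linear(3)[OF c] by (auto simp: vzero_def)
  then show ?thesis using chart_vec_tangent[OF c, of 0] by simp
qed

text \<open>A tangent vector sees only the germ of a function. The smoothness test in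
  \<open>chart_vec\<close> is itself local, so the default value agrees too.\<close>

lemma tangent_cong:
  assumes "v \<in> tangent_space A p" "open U" "p \<in> U" "\<And>q. q \<in> U \<Longrightarrow> f q = h q"
  shows "v f = v h"
proof -
  obtain c w where c: "c \<in> A" "p \<in> fst c" "v = chart_vec A c w p"
    using assms(1) by (rule tangentE)
  have "frechet_derivative (f \<circ> chart_inv c) (at (snd c p)) = frechet_derivative (h \<circ> chart_inv c) (at (snd c p))"
    by (rule frechet_derivative_cong_open[OF chart_image_open[OF c(1) assms(2)]])
      (use assms c in auto)
  moreover have "smooth_near A p f \<longleftrightarrow> smooth_near A p h"
    using assms(2-4) by (rule smooth_near_cong)
  ultimately show ?thesis by (simp add: c(3) chart_vec_def)
qed

lemma smooth_near_add:
  assumes "smooth_near A p f" "smooth_near A p h"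
  shows "smooth_near A p (\<lambda>q. f q + h q)"
proof -
  obtain W where W: "open W" "p \<in> W" "smooth_fun A W f" using assms(1) unfolding smooth_near_def by blast
  obtain V where V: "open V" "p \<in> V" "V \<subseteq> W" "smooth_fun A V h"
    using smooth_nearE[OF assms(2) W(1,2)] by blast
  have "smooth_fun A V (\<lambda>q. f q + h q)"
    by (rule smooth_fun_add[OF V(1) smooth_fun_subset[OF W(3) V(3)] V(4)])
  then show ?thesis by (rule smooth_nearI[OF V(1,2)])
qed

lemma smooth_near_cmult:
  assumes "smooth_near A p f"
  shows "smooth_near A p (\<lambda>q. a * f q)"
proof -
  obtain W where W: "open W" "p \<in> W" "smooth_fun A W f" using assms(1) unfolding smooth_near_def by blast
  show ?thesis by (rule smooth_nearI[OF W(1,2) smooth_fun_cmult[OF W(1,3)]])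
qed

lemma tangent_fun_add:
  assumes "v \<in> tangent_space A p" "smooth_near A p f" "smooth_near A p h"
  shows "v (\<lambda>q. f q + h q) = v f + v h"
proof -
  obtain c w where c: "c \<in> A" "p \<in> fst c" "v = chart_vec A c w p"
    using assms(1) by (rule tangentE)
  have "frechet_derivative ((\<lambda>q. f q + h q) \<circ> chart_inv c) (at (snd c p)) w =
      frechet_derivative (f \<circ> chart_inv c) (at (snd c p)) w +
      frechet_derivative (h \<circ> chart_inv c) (at (snd c p)) w"
    unfolding o_def
    by (rule frechet_derivative_eqI[OF has_derivative_add])
      (use smooth_near_differentiable[OF _ c(1,2)] assms in
        \<open>simp_all add: frechet_derivative_works[symmetric] o_def\<close>)
  then show ?thesis using assms smooth_near_add by (simp add: c(3) chart_vec_def)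
qed

lemma tangent_fun_const: "v \<in> tangent_space A p \<Longrightarrow> v (\<lambda>_. a) = 0"
proof -
  assume "v \<in> tangent_space A p"
  then obtain c w where c: "c \<in> A" "p \<in> fst c" "v = chart_vec A c w p" by (rule tangentE)
  have "frechet_derivative ((\<lambda>_. a) \<circ> chart_inv c) (at (snd c p)) w = 0"
    unfolding o_def by (rule frechet_derivative_eqI[OF has_derivative_const])
  then show ?thesis by (simp add: c(3) chart_vec_def)
qed

lemma tangent_fun_cmult:
  assumes "v \<in> tangent_space A p" "smooth_near A p f"
  shows "v (\<lambda>q. a * f q) = a * v f"
proof -
  obtain c w where c: "c \<in> A" "p \<in> fst c" "v = chart_vec A c w p"
    using assms(1) by (rule tangentE)
  have "frechet_derivative ((\<lambda>q. a * f q) \<circ> chart_inv c) (at (snd c p)) w =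
      a * frechet_derivative (f \<circ> chart_inv c) (at (snd c p)) w"
    unfolding o_def
    by (rule frechet_derivative_eqI[OF has_derivative_mult_right])
      (use smooth_near_differentiable[OF _ c(1,2)] assms in
        \<open>simp_all add: frechet_derivative_works[symmetric] o_def\<close>)
  then show ?thesis using assms smooth_near_cmult by (simp add: c(3) chart_vec_def)
qed

lemma chart_vec_coord:
  assumes "c \<in> A" "p \<in> fst c"
  shows "chart_vec A c w p (\<lambda>q. snd c q \<bullet> b) = w \<bullet> b"
proof -
  have o: "open (snd c ` fst c)" using chart_image_open'[OF assms(1)] chart_open[OF assms(1)] by blast
  have "frechet_derivative ((\<lambda>q. snd c q \<bullet> b) \<circ> chart_inv c) (at (snd c p)) =
    frechet_derivative (\<lambda>x. x \<bullet> b) (at (snd c p))"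
    by (rule frechet_derivative_cong_open[OF o]) (use assms in auto)
  moreover have "frechet_derivative (\<lambda>x. x \<bullet> b) (at (snd c p)) w = w \<bullet> b"
    by (rule frechet_derivative_eqI[OF has_derivative_inner_left[OF has_derivative_ident]])
  moreover have "smooth_near A p (\<lambda>q. snd c q \<bullet> b)"
    using smooth_nearI smooth_fun_coord chart_open assms by blast
  ultimately show ?thesis by (simp add: chart_vec_def)
qed

text \<open>The values on the coordinate functions are the components of the vector, by
  \<open>chart_vec_coord\<close>. Later this expands the arguments of the torsion in a
  chart.\<close>

lemma tangent_coords:
  assumes "c \<in> A" "p \<in> fst c" "v \<in> tangent_space A p"
  shows "v = (\<lambda>f. \<Sum>b\<in>Basis. v (\<lambda>q. snd c q \<bullet> b) * chart_vec A c b p f)"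
proof -
  obtain w where w: "v = chart_vec A c w p" using assms tangent_space_chart by auto
  have "chart_vec A c w p = chart_vec A c (\<Sum>b\<in>Basis. (w \<bullet> b) *\<^sub>R b) p"
    by (simp only: euclidean_representation)
  then show ?thesis
    unfolding w chart_vec_coord[OF assms(1,2)]
    using chart_vec_linear(4)[OF assms(1,2), of "\<lambda>b. w \<bullet> b" Basis] by (intro ext) simp
qed

section \<open>Smooth vector fields\<close>

lemma vfield_subset: "vfield A U X \<Longrightarrow> W \<subseteq> U \<Longrightarrow> vfield A W X"
  unfolding vfield_def by (meson subset_trans subsetD)

lemma vfield_tangent: "vfield A U X \<Longrightarrow> p \<in> U \<Longrightarrow> X p \<in> tangent_space A p"
  unfolding vfield_def by blast

lemma vfield_smooth: "open U \<Longrightarrow> vfield A U X \<Longrightarrow> smooth_fun A U f \<Longrightarrow> smooth_fun A U (\<lambda>p. X p f)"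
  unfolding vfield_def by blast

lemma vfield_cong:
  assumes "open U" "vfield A U X" "\<And>p. p \<in> U \<Longrightarrow> X p = Y p"
  shows "vfield A U Y"
  unfolding vfield_def
proof (intro conjI allI ballI impI)
  show "Y p \<in> tangent_space A p" if "p \<in> U" for p
    using vfield_tangent[OF assms(2) that] assms(3)[OF that] by simp
  show "smooth_fun A W (\<lambda>p. Y p f)" if W: "open W \<and> W \<subseteq> U \<and> smooth_fun A W f" for W f
  proof (rule smooth_fun_cong)
    show "smooth_fun A W (\<lambda>p. X p f)" using assms(2) W unfolding vfield_def by blast
    show "X p f = Y p f" if "p \<in> W" for p using assms(3)[of p] W that by auto
  qed (use W in blast)
qed

lemma vfieldI:
  assumes "\<And>p. p \<in> U \<Longrightarrow> X p \<in> tangent_space A p"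
    and "\<And>W f. open W \<Longrightarrow> W \<subseteq> U \<Longrightarrow> smooth_fun A W f \<Longrightarrow> smooth_fun A W (\<lambda>p. X p f)"
  shows "vfield A U X"
  using assms unfolding vfield_def by blast

lemma vfield_add:
  assumes "vfield A U X" "vfield A U Y"
  shows "vfield A U (\<lambda>q. vadd (X q) (Y q))"
proof (rule vfieldI)
  show "vadd (X p) (Y p) \<in> tangent_space A p" if "p \<in> U" for p
    by (rule tangent_add[OF vfield_tangent[OF assms(1) that] vfield_tangent[OF assms(2) that]])
  show "smooth_fun A W (\<lambda>p. vadd (X p) (Y p) f)" if "open W" "W \<subseteq> U" "smooth_fun A W f" for W f
    unfolding vadd_def
    using smooth_fun_add[OF that(1) vfield_smooth[OF that(1) vfield_subset[OF assms(1) that(2)] that(3)]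
      vfield_smooth[OF that(1) vfield_subset[OF assms(2) that(2)] that(3)]] .
qed

lemma vfield_scale:
  assumes "vfield A U X" "smooth_fun A U f"
  shows "vfield A U (\<lambda>q. vscale (f q) (X q))"
proof (rule vfieldI)
  show "vscale (f p) (X p) \<in> tangent_space A p" if "p \<in> U" for p
    by (rule tangent_scale[OF vfield_tangent[OF assms(1) that]])
  show "smooth_fun A W (\<lambda>p. vscale (f p) (X p) h)" if "open W" "W \<subseteq> U" "smooth_fun A W h" for W h
    unfolding vscale_def
    using smooth_fun_mult[OF that(1) smooth_fun_subset[OF assms(2) that(2)]
      vfield_smooth[OF that(1) vfield_subset[OF assms(1) that(2)] that(3)]] .
qed

lemma vfield_cscale: "vfield A U X \<Longrightarrow> vfield A U (\<lambda>q. vscale a (X q))"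
  using vfield_scale[of U X "\<lambda>_. a"] smooth_fun_const by blast

lemma vfield_sub: "vfield A U X \<Longrightarrow> vfield A U Y \<Longrightarrow> vfield A U (\<lambda>q. vsub (X q) (Y q))"
  using vfield_add[of U X "\<lambda>q. vscale (-1) (Y q)"] vfield_cscale[of U Y "-1"] by (simp add: vsub_eq)

lemma chart_vec_vfield:
  assumes c: "c \<in> A"
  shows "vfield A (fst c) (chart_vec A c w)"
proof (rule vfieldI)
  show "chart_vec A c w p \<in> tangent_space A p" if "p \<in> fst c" for p
    using chart_vec_tangent c that by blast
  fix W f assume W: "open W" "W \<subseteq> fst c" "smooth_fun A W f"
  show "smooth_fun A W (\<lambda>p. chart_vec A c w p f)"
  proof (rule smooth_funI_chart[OF c])
    have s: "smooth_on (snd c ` W) (f \<circ> chart_inv c)"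
      using W smooth_funD[of W f c] c by (simp add: Int_absorb2)
    have "chart_vec A c w p f = frechet_derivative (f \<circ> chart_inv c) (at (snd c p)) w" if "p \<in> W" for p
      using smooth_nearI W that by (auto simp: chart_vec_def)
    then show "smooth_on (snd c ` W) ((\<lambda>p. chart_vec A c w p f) \<circ> chart_inv c)"
      using W c by (intro smooth_on_cong[OF _ smooth_on_derivative[OF s, of w]]) (auto simp: chart_image_open')
  qed (use W in auto)
qed

end

section \<open>Vector fields, brackets and connections\<close>

text \<open>Named pointwise operations, so that linearity rules can be stated and matched for
  fields. The scalars of \<open>fscale\<close> are constants; pointwise dependence comes later from
  \<open>t_pointwise\<close>.\<close>

definition fadd :: "('m, real) field \<Rightarrow> ('m, real) field \<Rightarrow> ('m, real) field" where
  "fadd X Y = (\<lambda>q. vadd (X q) (Y q))"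
definition fsub :: "('m, real) field \<Rightarrow> ('m, real) field \<Rightarrow> ('m, real) field" where
  "fsub X Y = (\<lambda>q. vsub (X q) (Y q))"
definition fscale :: "real \<Rightarrow> ('m, real) field \<Rightarrow> ('m, real) field" where
  "fscale a X = (\<lambda>q. vscale a (X q))"

lemmas vec_defs = vadd_def vsub_def vscale_def vzero_def

context atlas
begin

lemma tangent_fun_diff:
  assumes "v \<in> tangent_space A p" "smooth_near A p f" "smooth_near A p h"
  shows "v (\<lambda>q. f q - h q) = v f - v h"
  using tangent_fun_add[OF assms(1,2) smooth_near_cmult[OF assms(3), of "-1"]]
    tangent_fun_cmult[OF assms(1,3), of "-1"] by simp

lemma lie_bracket_lie_bracket:
  assumes W: "open W" "p \<in> W" "smooth_fun A W f"
    and X: "vfield A W X" and Y: "vfield A W Y" and Z: "vfield A W Z"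
  shows "lie_bracket A X (lie_bracket A Y Z) p f =
    (X p (\<lambda>q. Y q (\<lambda>r. Z r f)) - X p (\<lambda>q. Z q (\<lambda>r. Y r f))) -
    (Y p (\<lambda>q. Z q (\<lambda>r. X r f)) - Z p (\<lambda>q. Y q (\<lambda>r. X r f)))"
proof -
  note sm = vfield_smooth[OF W(1)]
  note near = smooth_nearI[OF W(1,2)]
  \<comment> \<open>The bracket is given by its formula only on functions smooth near the point;
    this holds for f throughout W, and locality of X p does the rest.\<close>
  have "X p (\<lambda>q. lie_bracket A Y Z q f) = X p (\<lambda>q. Y q (\<lambda>r. Z r f) - Z q (\<lambda>r. Y r f))"
  proof (rule tangent_cong[OF vfield_tangent[OF X W(2)] W(1,2)])
    show "lie_bracket A Y Z q f = Y q (\<lambda>r. Z r f) - Z q (\<lambda>r. Y r f)" if "q \<in> W" for q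
      using smooth_nearI[OF W(1) that W(3)] by (simp add: lie_bracket_def)
  qed
  also have "\<dots> = X p (\<lambda>q. Y q (\<lambda>r. Z r f)) - X p (\<lambda>q. Z q (\<lambda>r. Y r f))"
    by (rule tangent_fun_diff[OF vfield_tangent[OF X W(2)] near[OF sm[OF Y sm[OF Z W(3)]]]
          near[OF sm[OF Z sm[OF Y W(3)]]]])
  finally show ?thesis
    using near[OF W(3)] near[OF sm[OF X W(3)]] by (simp add: lie_bracket_def)
qed

lemma jacobi:
  assumes U: "open U" "p \<in> U" and X: "vfield A U X" and Y: "vfield A U Y" and Z: "vfield A U Z"
  shows "lie_bracket A X (lie_bracket A Y Z) p f + lie_bracket A Y (lie_bracket A Z X) p f +
    lie_bracket A Z (lie_bracket A X Y) p f = 0"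
proof (cases "smooth_near A p f")
  case True
  \<comment> \<open>On W the three double brackets expand into twelve third-order terms, which
    cancel in pairs. For f not smooth near p each outer bracket is 0 by its default value.\<close>
  then obtain W where W: "open W" "p \<in> W" "W \<subseteq> U" "smooth_fun A W f" by (rule smooth_nearE[OF _ U])
  note vf = vfield_subset[OF X W(3)] vfield_subset[OF Y W(3)] vfield_subset[OF Z W(3)]
  show ?thesis
    using lie_bracket_lie_bracket[OF W(1,2,4) vf(1,2,3)]
      lie_bracket_lie_bracket[OF W(1,2,4) vf(2,3,1)]
      lie_bracket_lie_bracket[OF W(1,2,4) vf(3,1,2)] by linarith
qed (simp add: lie_bracket_def)

lemma vf_fadd: "vfield A U X \<Longrightarrow> vfield A U Y \<Longrightarrow> vfield A U (fadd X Y)"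
  unfolding fadd_def by (rule vfield_add)

lemma vf_fsub: "vfield A U X \<Longrightarrow> vfield A U Y \<Longrightarrow> vfield A U (fsub X Y)"
  unfolding fsub_def by (rule vfield_sub)

lemma vf_fscale: "vfield A U X \<Longrightarrow> vfield A U (fscale a X)"
  unfolding fscale_def by (rule vfield_cscale)

end

text \<open>Everything takes place over one open set U. In the end U is an arbitrary open set, a
  chart domain, or the intersection of an open set with a chart domain.\<close>

locale hermitian_region = atlas A
  for A :: "('m::{t2_space,second_countable_topology}, 'e::euclidean_space) chart set" +
  fixes J :: "'m endo" and g :: "'m metric" and U :: "'m set"
  assumes acs: "almost_complex A J" and riem: "riemannian_metric A g" and open_U: "open U"
    and herm: "\<And>p u v. u \<in> tangent_space A p \<Longrightarrow> v \<in> tangent_space A p \<Longrightarrow> g p (J p u) (J p v) = g p u v"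
begin

abbreviation VF :: "('m, real) field \<Rightarrow> bool" where "VF \<equiv> vfield A U"

definition fJ :: "('m, real) field \<Rightarrow> ('m, real) field" where "fJ X = (\<lambda>q. J q (X q))"
definition ip :: "('m, real) field \<Rightarrow> ('m, real) field \<Rightarrow> 'm \<Rightarrow> real" where "ip X Y p = g p (X p) (Y p)"

lemma J_tangent: "u \<in> tangent_space A p \<Longrightarrow> J p u \<in> tangent_space A p"
  and J_J: "u \<in> tangent_space A p \<Longrightarrow> J p (J p u) = vscale (-1) u"
  and J_add: "u \<in> tangent_space A p \<Longrightarrow> v \<in> tangent_space A p \<Longrightarrow> J p (vadd u v) = vadd (J p u) (J p v)"
  and J_scale: "u \<in> tangent_space A p \<Longrightarrow> J p (vscale a u) = vscale a (J p u)"
proof -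
  note a1 = acs[unfolded almost_complex_def, THEN conjunct1]
    and a2 = acs[unfolded almost_complex_def, THEN conjunct2, THEN conjunct1]
    and a3 = acs[unfolded almost_complex_def, THEN conjunct2, THEN conjunct2, THEN conjunct1]
  show "u \<in> tangent_space A p \<Longrightarrow> J p u \<in> tangent_space A p" using a1 by simp
  show "u \<in> tangent_space A p \<Longrightarrow> J p (J p u) = vscale (-1) u" using a1 by simp
  show "u \<in> tangent_space A p \<Longrightarrow> v \<in> tangent_space A p \<Longrightarrow> J p (vadd u v) = vadd (J p u) (J p v)"
    using a2 by simp
  show "u \<in> tangent_space A p \<Longrightarrow> J p (vscale a u) = vscale a (J p u)" using a3 by simp
qed

lemma J_sub: "u \<in> tangent_space A p \<Longrightarrow> v \<in> tangent_space A p \<Longrightarrow> J p (vsub u v) = vsub (J p u) (J p v)"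
  by (simp add: vsub_eq J_add J_scale tangent_scale)

lemma vf_fJ: "VF X \<Longrightarrow> VF (fJ X)"
  unfolding fJ_def
  using acs[unfolded almost_complex_def, THEN conjunct2, THEN conjunct2, THEN conjunct2] open_U by simp

lemma g_sym: "u \<in> tangent_space A p \<Longrightarrow> v \<in> tangent_space A p \<Longrightarrow> g p u v = g p v u"
  and g_add: "u \<in> tangent_space A p \<Longrightarrow> v \<in> tangent_space A p \<Longrightarrow> w \<in> tangent_space A p \<Longrightarrow>
    g p (vadd u v) w = g p u w + g p v w"
  and g_scale: "u \<in> tangent_space A p \<Longrightarrow> v \<in> tangent_space A p \<Longrightarrow> g p (vscale a u) v = a * g p u v"
  and g_pos: "u \<in> tangent_space A p \<Longrightarrow> u \<noteq> vzero \<Longrightarrow> g p u u > 0"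
proof -
  note r = riem[unfolded riemannian_metric_def]
  show "u \<in> tangent_space A p \<Longrightarrow> v \<in> tangent_space A p \<Longrightarrow> g p u v = g p v u"
    using conjunct1[OF r] by metis
  show "u \<in> tangent_space A p \<Longrightarrow> v \<in> tangent_space A p \<Longrightarrow> w \<in> tangent_space A p \<Longrightarrow>
    g p (vadd u v) w = g p u w + g p v w"
    using conjunct1[OF conjunct2[OF r]] by simp
  show "u \<in> tangent_space A p \<Longrightarrow> v \<in> tangent_space A p \<Longrightarrow> g p (vscale a u) v = a * g p u v"
    using conjunct1[OF conjunct2[OF conjunct2[OF r]]] by simp
  show "u \<in> tangent_space A p \<Longrightarrow> u \<noteq> vzero \<Longrightarrow> g p u u > 0"
    using conjunct1[OF conjunct2[OF conjunct2[OF conjunct2[OF r]]]] by simp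
qed

lemma g_sub: "u \<in> tangent_space A p \<Longrightarrow> v \<in> tangent_space A p \<Longrightarrow> w \<in> tangent_space A p \<Longrightarrow>
    g p (vsub u v) w = g p u w - g p v w"
  by (simp add: vsub_eq g_add g_scale tangent_scale)

lemma g_zero: "v \<in> tangent_space A p \<Longrightarrow> g p vzero v = 0"
  using g_scale[OF tangent_zero, of v p 0] by (simp add: vec_defs)

lemma vf_tangent: "VF X \<Longrightarrow> p \<in> U \<Longrightarrow> X p \<in> tangent_space A p"
  by (rule vfield_tangent)

lemmas vf_intros = vf_fadd vf_fsub vf_fscale vf_fJ

lemma ip_smooth: "VF X \<Longrightarrow> VF Y \<Longrightarrow> smooth_fun A U (ip X Y)"
  using riem[unfolded riemannian_metric_def, THEN conjunct2, THEN conjunct2, THEN conjunct2, THEN conjunct2]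
    open_U unfolding ip_def by simp

lemma ip_sym: "VF X \<Longrightarrow> VF Y \<Longrightarrow> p \<in> U \<Longrightarrow> ip X Y p = ip Y X p"
  unfolding ip_def by (intro g_sym vf_tangent)

lemma ip_add1: "VF X \<Longrightarrow> VF Y \<Longrightarrow> VF Z \<Longrightarrow> p \<in> U \<Longrightarrow> ip (fadd X Y) Z p = ip X Z p + ip Y Z p"
  unfolding ip_def fadd_def by (intro g_add vf_tangent)

lemma ip_sub1: "VF X \<Longrightarrow> VF Y \<Longrightarrow> VF Z \<Longrightarrow> p \<in> U \<Longrightarrow> ip (fsub X Y) Z p = ip X Z p - ip Y Z p"
  unfolding ip_def fsub_def by (intro g_sub vf_tangent)

lemma ip_scale1: "VF X \<Longrightarrow> VF Z \<Longrightarrow> p \<in> U \<Longrightarrow> ip (fscale a X) Z p = a * ip X Z p"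
  unfolding ip_def fscale_def by (intro g_scale vf_tangent)

lemma ip_add2: "VF X \<Longrightarrow> VF Y \<Longrightarrow> VF Z \<Longrightarrow> p \<in> U \<Longrightarrow> ip Z (fadd X Y) p = ip Z X p + ip Z Y p"
  using ip_add1[of X Y Z p] ip_sym[of "fadd X Y" Z p] ip_sym[of X Z p] ip_sym[of Y Z p]
  by (simp add: vf_intros)

lemma ip_sub2: "VF X \<Longrightarrow> VF Y \<Longrightarrow> VF Z \<Longrightarrow> p \<in> U \<Longrightarrow> ip Z (fsub X Y) p = ip Z X p - ip Z Y p"
  using ip_sub1[of X Y Z p] ip_sym[of "fsub X Y" Z p] ip_sym[of X Z p] ip_sym[of Y Z p]
  by (simp add: vf_intros)

lemma ip_scale2: "VF X \<Longrightarrow> VF Z \<Longrightarrow> p \<in> U \<Longrightarrow> ip Z (fscale a X) p = a * ip Z X p"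
  using ip_scale1[of X Z p a] ip_sym[of "fscale a X" Z p] ip_sym[of X Z p]
  by (simp add: vf_intros)

lemma ip_J: "VF X \<Longrightarrow> VF Y \<Longrightarrow> p \<in> U \<Longrightarrow> ip (fJ X) Y p = - ip X (fJ Y) p"
proof -
  assume h: "VF X" "VF Y" "p \<in> U"
  note t = vf_tangent[OF h(1,3)] vf_tangent[OF h(2,3)]
  have "g p (J p (X p)) (Y p) = g p (J p (J p (X p))) (J p (Y p))"
    using herm[OF J_tangent[OF t(1)] t(2)] by simp
  then show ?thesis using t by (simp add: ip_def fJ_def J_J g_scale J_tangent)
qed

text \<open>The metric is nondegenerate: test with Z = X - Y.\<close>

lemma ip_eqI:
  assumes "VF X" "VF Y" "p \<in> U" "\<And>Z. VF Z \<Longrightarrow> ip X Z p = ip Y Z p"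
  shows "X p = Y p"
proof -
  have "g p (fsub X Y p) (fsub X Y p) = 0"
    using ip_sub1[OF assms(1,2) vf_fsub[OF assms(1,2)] assms(3)] assms(4)[OF vf_fsub[OF assms(1,2)]]
    unfolding ip_def by simp
  then have "fsub X Y p = vzero"
    using g_pos[OF vf_tangent[OF vf_fsub[OF assms(1,2)] assms(3)]] by fastforce
  then have "X p f = Y p f" for f
    unfolding fsub_def vsub_def vzero_def by (meson eq_iff_diff_eq_0)
  then show ?thesis by blast
qed

lemma vf_fun_add:
  "VF X \<Longrightarrow> p \<in> U \<Longrightarrow> smooth_fun A U f \<Longrightarrow> smooth_fun A U h \<Longrightarrow> X p (\<lambda>q. f q + h q) = X p f + X p h"
  by (rule tangent_fun_add[OF vf_tangent smooth_nearI[OF open_U] smooth_nearI[OF open_U]])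

lemma vf_fun_cong: "VF X \<Longrightarrow> p \<in> U \<Longrightarrow> (\<And>q. q \<in> U \<Longrightarrow> f q = h q) \<Longrightarrow> X p f = X p h"
  by (rule tangent_cong[OF vf_tangent open_U])

lemma vf_fun_cmult: "VF X \<Longrightarrow> p \<in> U \<Longrightarrow> smooth_fun A U f \<Longrightarrow> X p (\<lambda>q. a * f q) = a * X p f"
  by (rule tangent_fun_cmult[OF vf_tangent smooth_nearI[OF open_U]])

lemma vf_fun_const: "VF X \<Longrightarrow> p \<in> U \<Longrightarrow> X p (\<lambda>_. a) = 0"
  by (rule tangent_fun_const[OF vf_tangent])

end

text \<open>Common ground of the two connections: the canonical one enters as the parent of
  \<open>nk_region\<close>, the Levi-Civita connection through the sublocale
  \<open>L\<close>.\<close>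

locale conn_region = hermitian_region A J g U
  for A :: "('m::{t2_space,second_countable_topology}, 'e::euclidean_space) chart set"
    and J g U +
  fixes D :: "'m conn"
  assumes conn: "connection A D" and metric: "metric_connection A g D"
begin

lemmas conn' = conn[unfolded connection_def]

lemma vf_D: "VF X \<Longrightarrow> VF Y \<Longrightarrow> VF (D X Y)"
  using conjunct1[OF conn'] open_U by simp

lemma D_cong:
  assumes "VF X" "VF Y" "p \<in> U" "\<And>p. p \<in> U \<Longrightarrow> X' p = X p" "\<And>p. p \<in> U \<Longrightarrow> Y' p = Y p"
  shows "D X' Y' p = D X Y p"
  by (rule conjunct1[OF conjunct2[OF conn'], rule_format, of U X Y X' Y' p]) (use assms open_U in simp_all)

lemma D_add:
  assumes "VF X" "VF Y" "VF Z" "p \<in> U"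
  shows D_add1: "D (fadd X Y) Z p = vadd (D X Z p) (D Y Z p)"
    and D_add2: "D X (fadd Y Z) p = vadd (D X Y p) (D X Z p)"
  using conjunct1[OF conjunct2[OF conjunct2[OF conn']], rule_format, of U X Y Z p] open_U assms
  unfolding fadd_def by simp_all

lemma D_scale1: "VF X \<Longrightarrow> VF Y \<Longrightarrow> p \<in> U \<Longrightarrow> D (fscale a X) Y p = vscale a (D X Y p)"
  and D_scale2: "VF X \<Longrightarrow> VF Y \<Longrightarrow> p \<in> U \<Longrightarrow> D X (fscale a Y) p = vscale a (D X Y p)"
proof -
  assume h: "VF X" "VF Y" "p \<in> U"
  have "D (\<lambda>q. vscale a (X q)) Y p = vscale a (D X Y p) \<and>
    D X (\<lambda>q. vscale a (Y q)) p = vadd (vscale (X p (\<lambda>_. a)) (Y p)) (vscale a (D X Y p))"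
    using conjunct2[OF conjunct2[OF conjunct2[OF conn']], rule_format, of U X Y "\<lambda>_. a" p]
      open_U h smooth_fun_const[of U a] by simp
  then show "D (fscale a X) Y p = vscale a (D X Y p)" "D X (fscale a Y) p = vscale a (D X Y p)"
    using vf_fun_const[OF h(1,3), of a] by (simp_all add: fscale_def vec_defs)
qed

lemma fsub_eq: "fsub X Y = fadd X (fscale (-1) Y)"
  by (simp add: fsub_def fadd_def fscale_def vec_defs)

lemma D_sub1: "VF X \<Longrightarrow> VF Y \<Longrightarrow> VF Z \<Longrightarrow> p \<in> U \<Longrightarrow> D (fsub X Y) Z p = vsub (D X Z p) (D Y Z p)"
  and D_sub2: "VF X \<Longrightarrow> VF Y \<Longrightarrow> VF Z \<Longrightarrow> p \<in> U \<Longrightarrow> D X (fsub Y Z) p = vsub (D X Y p) (D X Z p)"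
  unfolding fsub_eq
  by (simp_all only: D_add1 D_add2 D_scale1 D_scale2 vf_fscale vsub_eq)

lemma D_metric: "VF X \<Longrightarrow> VF Y \<Longrightarrow> VF Z \<Longrightarrow> p \<in> U \<Longrightarrow> X p (ip Y Z) = ip (D X Y) Z p + ip Y (D X Z) p"
  using metric[unfolded metric_connection_def, rule_format, of U X Y Z p] open_U
  unfolding ip_def by simp

end

section \<open>Nearly Kaehler manifolds over an open set\<close>

locale nk_region = conn_region A J g U nabla
  for A :: "('m::{t2_space,second_countable_topology}, 'e::euclidean_space) chart set"
    and J g U and nabla :: "'m conn" +
  fixes D :: "'m conn"
  assumes lc: "connection A D" "metric_connection A g D"
    and torsion_free: "\<And>X Y p. vfield A U X \<Longrightarrow> vfield A U Y \<Longrightarrow> p \<in> U \<Longrightarrow> torsion A D X Y p = vzero"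
    and nk: "\<And>X p. vfield A U X \<Longrightarrow> p \<in> U \<Longrightarrow> cov_deriv_J D J X X p = vzero"
    and J_parallel: "\<And>X Y p. vfield A U X \<Longrightarrow> vfield A U Y \<Longrightarrow> p \<in> U \<Longrightarrow> cov_deriv_J nabla J X Y p = vzero"
    and type_11: "\<And>X Y p. field_10 A J U X \<Longrightarrow> field_10 A J U Y \<Longrightarrow> p \<in> U \<Longrightarrow>
      ext_C (torsion A nabla) X (cnj_field Y) p = vzero"
begin

sublocale L: conn_region A J g U D
  using lc by unfold_locales

text \<open>The Levi-Civita connection hands its properties to the bracket: smoothness, bilinearity
  and congruence of brackets over U are all derived from this formula.\<close>

lemma lb_eq: "VF X \<Longrightarrow> VF Y \<Longrightarrow> p \<in> U \<Longrightarrow> lie_bracket A X Y p = fsub (D X Y) (D Y X) p"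
proof -
  assume "VF X" "VF Y" "p \<in> U"
  then have "torsion A D X Y p f = 0" for f using torsion_free by (simp add: vzero_def)
  then show ?thesis by (auto simp: torsion_def fsub_def vsub_def)
qed

lemma vf_lb: "VF X \<Longrightarrow> VF Y \<Longrightarrow> VF (lie_bracket A X Y)"
  by (rule vfield_cong[OF open_U, of "fsub (D X Y) (D Y X)"]) (auto simp: lb_eq intro: vf_fsub L.vf_D)

lemma tor_eq: "torsion A nabla X Y = fsub (fsub (nabla X Y) (nabla Y X)) (lie_bracket A X Y)"
  by (simp add: torsion_def fsub_def)

lemma vf_tor: "VF X \<Longrightarrow> VF Y \<Longrightarrow> VF (torsion A nabla X Y)"
  unfolding tor_eq by (intro vf_fsub vf_D vf_lb)

lemmas vf = vf_intros vf_D L.vf_D vf_lb vf_tor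
declare vf [simp]

lemma fJ_fJ: "VF X \<Longrightarrow> p \<in> U \<Longrightarrow> fJ (fJ X) p = fscale (-1) X p"
  by (simp add: fJ_def fscale_def J_J[OF vf_tangent])

lemma lb_skew: "lie_bracket A X Y p = fscale (-1) (lie_bracket A Y X) p"
  by (auto simp: lie_bracket_def fscale_def vscale_def)

lemma lb_add: "VF X \<Longrightarrow> VF Y \<Longrightarrow> VF Z \<Longrightarrow> p \<in> U \<Longrightarrow>
    lie_bracket A (fadd X Y) Z p = fadd (lie_bracket A X Z) (lie_bracket A Y Z) p"
  by (simp add: lb_eq fsub_def L.D_add1 L.D_add2) (simp add: fadd_def fsub_def lb_eq vec_defs algebra_simps)

lemma lb_scale: "VF X \<Longrightarrow> VF Z \<Longrightarrow> p \<in> U \<Longrightarrow>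
    lie_bracket A (fscale a X) Z p = fscale a (lie_bracket A X Z) p"
  by (simp add: lb_eq fsub_def L.D_scale1 L.D_scale2) (simp add: fscale_def fsub_def lb_eq vec_defs algebra_simps)

lemma lb_cong: "VF X \<Longrightarrow> VF X' \<Longrightarrow> VF Z \<Longrightarrow> p \<in> U \<Longrightarrow> (\<And>q. q \<in> U \<Longrightarrow> X q = X' q) \<Longrightarrow>
    lie_bracket A X Z p = lie_bracket A X' Z p"
  using L.D_cong[of X' Z p X Z] L.D_cong[of Z X' p Z X] by (simp add: lb_eq fsub_def)

lemma tor_skew: "torsion A nabla X Y p = fscale (-1) (torsion A nabla Y X) p"
  using lb_skew[of X Y p] by (auto simp: torsion_def fscale_def vec_defs)

lemma tor_add: "VF X \<Longrightarrow> VF Y \<Longrightarrow> VF Z \<Longrightarrow> p \<in> U \<Longrightarrow>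
    torsion A nabla (fadd X Y) Z p = fadd (torsion A nabla X Z) (torsion A nabla Y Z) p"
  by (simp add: torsion_def lb_add D_add1 D_add2) (simp add: fadd_def torsion_def vec_defs algebra_simps)

lemma tor_scale: "VF X \<Longrightarrow> VF Z \<Longrightarrow> p \<in> U \<Longrightarrow>
    torsion A nabla (fscale a X) Z p = fscale a (torsion A nabla X Z) p"
  by (simp add: torsion_def lb_scale D_scale1 D_scale2) (simp add: fscale_def torsion_def vec_defs algebra_simps)

lemma tor_cong: "VF X \<Longrightarrow> VF X' \<Longrightarrow> VF Z \<Longrightarrow> p \<in> U \<Longrightarrow> (\<And>q. q \<in> U \<Longrightarrow> X q = X' q) \<Longrightarrow>
    torsion A nabla X Z p = torsion A nabla X' Z p"
  using D_cong[of X' Z p X Z] D_cong[of Z X' p Z X] lb_cong[of X X' Z p] by (simp add: torsion_def)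

lemma nabla_J: "VF X \<Longrightarrow> VF Y \<Longrightarrow> p \<in> U \<Longrightarrow> nabla X (fJ Y) p = fJ (nabla X Y) p"
proof -
  assume "VF X" "VF Y" "p \<in> U"
  then have "cov_deriv_J nabla J X Y p f = 0" for f using J_parallel by (simp add: vzero_def)
  then show ?thesis by (auto simp: cov_deriv_J_def fJ_def vsub_def)
qed

lemma D_J: "VF X \<Longrightarrow> p \<in> U \<Longrightarrow> D X (fJ X) p = fJ (D X X) p"
proof -
  assume "VF X" "p \<in> U"
  then have "cov_deriv_J D J X X p f = 0" for f using nk by (simp add: vzero_def)
  then show ?thesis by (auto simp: cov_deriv_J_def fJ_def vsub_def)
qed

text \<open>The torsion with its value lowered by the metric, so that identities for \<tau> become
  linear relations between real numbers.\<close>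

definition t :: "('m, real) field \<Rightarrow> ('m, real) field \<Rightarrow> ('m, real) field \<Rightarrow> 'm \<Rightarrow> real" where
  "t X Y Z = ip (torsion A nabla X Y) Z"

lemma ip_cong1: "X p = X' p \<Longrightarrow> ip X Y p = ip X' Y p"
  and ip_cong2: "Y p = Y' p \<Longrightarrow> ip X Y p = ip X Y' p"
  by (simp_all add: ip_def)

lemma t_skew12: "VF X \<Longrightarrow> VF Y \<Longrightarrow> VF Z \<Longrightarrow> p \<in> U \<Longrightarrow> t X Y Z p = - t Y X Z p"
  using ip_cong1[of "torsion A nabla X Y" p "fscale (-1) (torsion A nabla Y X)" Z, OF tor_skew] ip_scale1[of "torsion A nabla Y X" Z p "-1"] by (simp add: t_def)

lemma t_add1: "VF X \<Longrightarrow> VF X' \<Longrightarrow> VF Y \<Longrightarrow> VF Z \<Longrightarrow> p \<in> U \<Longrightarrow>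
    t (fadd X X') Y Z p = t X Y Z p + t X' Y Z p"
  using ip_cong1[of "torsion A nabla (fadd X X') Y" p "fadd (torsion A nabla X Y) (torsion A nabla X' Y)" Z, OF tor_add] by (simp add: t_def ip_add1)

lemma t_add3: "VF X \<Longrightarrow> VF Y \<Longrightarrow> VF Z \<Longrightarrow> VF Z' \<Longrightarrow> p \<in> U \<Longrightarrow>
    t X Y (fadd Z Z') p = t X Y Z p + t X Y Z' p"
  by (simp add: t_def ip_add2)

lemma t_add2: "VF X \<Longrightarrow> VF Y \<Longrightarrow> VF Y' \<Longrightarrow> VF Z \<Longrightarrow> p \<in> U \<Longrightarrow>
    t X (fadd Y Y') Z p = t X Y Z p + t X Y' Z p"
  using t_skew12[of X "fadd Y Y'" Z p] t_skew12[of X Y Z p] t_skew12[of X Y' Z p] by (simp add: t_add1)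

lemma t_JJ1: "VF X \<Longrightarrow> VF Y \<Longrightarrow> VF Z \<Longrightarrow> p \<in> U \<Longrightarrow> t (fJ (fJ X)) Y Z p = - t X Y Z p"
proof -
  assume h: "VF X" "VF Y" "VF Z" "p \<in> U"
  have "torsion A nabla (fJ (fJ X)) Y p = torsion A nabla (fscale (-1) X) Y p"
    by (rule tor_cong) (use h fJ_fJ in auto)
  also have "\<dots> = fscale (-1) (torsion A nabla X Y) p" using h by (simp add: tor_scale)
  finally show ?thesis using ip_cong1[of "torsion A nabla (fJ (fJ X)) Y" p _ Z] h
    by (simp add: t_def ip_scale1)
qed

lemma t_JJ2: "VF X \<Longrightarrow> VF Y \<Longrightarrow> VF Z \<Longrightarrow> p \<in> U \<Longrightarrow> t X (fJ (fJ Y)) Z p = - t X Y Z p"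
  using t_skew12[of X "fJ (fJ Y)" Z p] t_skew12[of X Y Z p] t_JJ1[of Y X Z p] by simp

lemma t_JJ3: "VF X \<Longrightarrow> VF Y \<Longrightarrow> VF Z \<Longrightarrow> p \<in> U \<Longrightarrow> t X Y (fJ (fJ Z)) p = - t X Y Z p"
  using ip_cong2[of "fJ (fJ Z)" p "fscale (-1) Z" "torsion A nabla X Y"] by (simp add: t_def fJ_fJ ip_scale2)

lemma re_im_complex_vec [simp]: "re_vec (complex_vec u v) = u" "im_vec (complex_vec u v) = v"
  by (simp_all add: re_vec_def im_vec_def complex_vec_def)

text \<open>Since J J X = - X, applying J to X - iJX multiplies it by i.\<close>

lemma type_10_vec:
  assumes X: "VF X" and q: "q \<in> U"
  shows "complex_vec (X q) (fscale (-1) (fJ X) q) \<in> T10 A J q"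
proof -
  have "J q (fscale (-1) (fJ X) q) = fscale (-1) (fJ (fJ X)) q"
    using J_scale[OF vf_tangent[OF vf_fJ[OF X] q], of "-1"] by (simp add: fscale_def fJ_def)
  also have "\<dots> = X q" using fJ_fJ[OF X q] by (simp add: fscale_def vscale_def)
  finally have "J q (fscale (-1) (fJ X) q) = X q" .
  then show ?thesis
    unfolding T10_def mem_Collect_eq endo_C_def re_im_complex_vec using X q vf_tangent[of _ q]
    by (auto simp add: complex_vec_def complex_eq_iff) (auto simp: vscale_def fscale_def fJ_def complex_eq_iff)
qed

text \<open>The vanishing of the torsion on (1,0)- and (0,1)-vectors is applied to
  X - i JX and Y + i JY.\<close>

lemma t_J12:
  assumes "VF X" "VF Y" "VF Z" "p \<in> U"
  shows "t (fJ X) Y Z p = t X (fJ Y) Z p"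
proof -
  let ?c = "\<lambda>X. (\<lambda>q. complex_vec (X q) (fscale (-1) (fJ X) q))"
  have re: "re_field (?c X) = X" and im: "im_field (?c X) = fscale (-1) (fJ X)" for X
    by (simp_all add: re_field_def im_field_def re_vec_def im_vec_def complex_vec_def)
  have re': "re_field (cnj_field (?c X)) = X" and im': "im_field (cnj_field (?c X)) = fJ X" for X
    by (auto simp add: re_field_def im_field_def re_vec_def im_vec_def complex_vec_def cnj_field_def
        fscale_def vscale_def)
  have f: "field_10 A J U (?c X)" if "VF X" for X
    unfolding field_10_def complex_vfield_def re im using type_10_vec that by simp
  have "ext_C (torsion A nabla) (?c X) (cnj_field (?c Y)) p h = 0" for h
    using type_11[OF f f assms(4)] assms by (simp add: vzero_def)
  \<comment> \<open>This is the imaginary part of \<tau>(X - iJX, Y + iJY).\<close>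
  then have "fadd (torsion A nabla X (fJ Y)) (torsion A nabla (fscale (-1) (fJ X)) Y) p h = 0" for h
    unfolding ext_C_def re im re' im' by (simp add: complex_vec_def complex_eq_iff fadd_def)
  then have "torsion A nabla X (fJ Y) p = torsion A nabla (fJ X) Y p"
    using tor_scale[of "fJ X" Y p "-1"] assms by (auto simp: fadd_def fscale_def vec_defs)
  then show ?thesis
    using ip_cong1[of "torsion A nabla X (fJ Y)" p "torsion A nabla (fJ X) Y" Z] by (simp add: t_def)
qed

text \<open>The difference of the two connections is determined by the torsion. The nearly Kaehler
  condition then says \<^term>\<open>t Z X (fJ X) p + 3 * t Z (fJ X) X p = 0\<close>, and substituting JX for X shows that
  both terms vanish.\<close>

lemma t_J_diag:
  assumes X: "VF X" and Z: "VF Z" and p: "p \<in> U"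
  shows "t Z (fJ X) X p = 0"
proof -
  \<comment> \<open>The difference tensor <D_X Y - nabla_X Y, Z>. It is skew in Y and Z because both
    connections are metric, and antisymmetrizing it in X and Y gives - t because D has no
    torsion.\<close>
  define a where "a X Y Z = ip (D X Y) Z p - ip (nabla X Y) Z p" for X Y Z
  have skew: "a X Y Z = - a X Z Y" if "VF X" "VF Y" "VF Z" for X Y Z
    using D_metric[OF that p] L.D_metric[OF that p] that p
    by (simp add: a_def ip_sym[of Y "D X Z"] ip_sym[of Y "nabla X Z"])
  have ta: "t X Y Z p = a Y X Z - a X Y Z" if "VF X" "VF Y" "VF Z" for X Y Z
    using that p ip_cong1[of "lie_bracket A X Y" p "fsub (D X Y) (D Y X)" Z, OF lb_eq]
    by (simp add: t_def tor_eq ip_sub1 a_def)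
  \<comment> \<open>Both (D_X J) X and nabla J vanish, so the operator D_X - nabla_X, applied to X
    itself, commutes with J.\<close>
  have nk': "a X (fJ X) Z = - a X X (fJ Z)" if "VF X" "VF Z" for X Z
    using that p ip_cong1[of "D X (fJ X)" p "fJ (D X X)" Z, OF D_J] ip_cong1[of "nabla X (fJ X)" p "fJ (nabla X X)" Z, OF nabla_J]
    by (simp add: a_def ip_J)
  have eq: "t Z X (fJ X) p + 3 * t Z (fJ X) X p = 0" if "VF X" for X
  proof -
    note v = that Z p
    have "t X X Y p = 0" if "VF Y" for Y using t_skew12[OF v(1) v(1) that p] by simp
    then have "a X X (fJ Z) = - t (fJ Z) X X p"
      using ta[of X "fJ Z" X] skew[of X "fJ Z" X] skew[of "fJ Z" X X] t_skew12[of X "fJ Z" X p] v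
      by simp
    also have "\<dots> = - t Z (fJ X) X p" using t_J12[of Z X X p] v by simp
    finally have 1: "a X (fJ X) Z = t Z (fJ X) X p" using nk'[OF v(1,2)] by simp
    \<comment> \<open>By \<open>t_J12\<close> the expression is symmetric under the exchange of X
      and JX, by \<open>t_skew12\<close> it is skew.\<close>
    have 2: "t X (fJ X) Z p = 0"
      using t_J12[of X X Z p] t_skew12[of X "fJ X" Z p] v by simp
    show ?thesis
      using 1 2 ta[of X "fJ X" Z] ta[of "fJ X" Z X] ta[of Z X "fJ X"] t_skew12[of "fJ X" Z X p]
        skew[of X "fJ X" Z] skew[of "fJ X" X Z] skew[of Z X "fJ X"] v by simp
  qed
  show ?thesis
    using eq[OF X] eq[OF vf_fJ[OF X]] t_JJ3[of Z "fJ X" X p] t_JJ2[of Z X "fJ X" p] assms by simp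
qed

text \<open>Put JX for Z in \<open>t_J_diag\<close>: moving this J onto the first slot leaves t X Y
  Y = 0, and polarization turns this into skewness.\<close>

lemma t_skew23:
  assumes "VF X" "VF Y" "VF Z" "p \<in> U"
  shows "t X Y Z p = - t X Z Y p"
proof -
  have diag: "t X Y Y p = 0" if "VF Y" for Y
    using t_J_diag[of Y "fJ X" p] t_J12[of "fJ X" Y Y p] t_JJ1[of X Y Y p] that assms by simp
  show ?thesis
    using diag[OF vf_fadd[OF assms(2,3)]] diag[OF assms(2)] diag[OF assms(3)] assms
    by (simp add: t_add2 t_add3)
qed

text \<open>Polarization of \<open>t_J_diag\<close>. Together with \<open>t_J12\<close> it lets J
  move freely among the three slots, which is the real form of type (3,0) + (0,3).\<close>

lemma t_J23:
  assumes "VF X" "VF Y" "VF Z" "p \<in> U"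
  shows "t X (fJ Y) Z p = t X Y (fJ Z) p"
proof -
  have "fJ (fadd Y Z) p = fadd (fJ Y) (fJ Z) p"
    using J_add[OF vf_tangent[OF assms(2,4)] vf_tangent[OF assms(3,4)]] by (simp add: fJ_def fadd_def)
  then have "t X W (fJ (fadd Y Z)) p = t X W (fadd (fJ Y) (fJ Z)) p" for W
    unfolding t_def by (rule ip_cong2)
  then have "t X (fJ (fadd Y Z)) W p = t X (fadd (fJ Y) (fJ Z)) W p" if "VF W" for W
    using assms that t_skew23[of X "fJ (fadd Y Z)" W p] t_skew23[of X "fadd (fJ Y) (fJ Z)" W p] by simp
  then have "t X (fJ Y) Z p + t X (fJ Z) Y p = 0"
    using t_J_diag[OF vf_fadd[OF assms(2,3)] assms(1,4)] t_J_diag[OF assms(2,1,4)]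
      t_J_diag[OF assms(3,1,4)] assms by (simp add: t_add2 t_add3)
  then show ?thesis using t_skew23[of X "fJ Z" Y p] assms by simp
qed

text \<open>For the last slot this is clear from the metric, and skewness carries it to the other
  two. It is how \<tau> is seen to be a tensor.\<close>

lemma t_pointwise:
  assumes "VF X" "VF Y" "VF Z" "VF X'" "VF Y'" "VF Z'" "p \<in> U" "X p = X' p" "Y p = Y' p" "Z p = Z' p"
  shows "t X Y Z p = t X' Y' Z' p"
proof -
  have 3: "t X Y Z p = t X Y Z' p" if "VF X" "VF Y" "VF Z" "VF Z'" "Z p = Z' p" for X Y Z Z'
    using ip_cong2[of Z p Z' "torsion A nabla X Y", OF that(5)] by (simp add: t_def)
  have 2: "t X Y Z p = t X Y' Z p" if "VF X" "VF Y" "VF Z" "VF Y'" "Y p = Y' p" for X Y Y' Z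
    using 3[of X Z Y Y'] t_skew23[of X Y Z p] t_skew23[of X Y' Z p] that assms(7) by simp
  have 1: "t X Y Z p = t X' Y Z p" if "VF X" "VF Y" "VF Z" "VF X'" "X p = X' p" for X X' Y Z
    using 2[of Y X Z X'] t_skew12[of X Y Z p] t_skew12[of X' Y Z p] that assms(7) by simp
  show ?thesis using 1[of X Y Z X'] 2[of X' Y Z Y'] 3[of X' Y' Z Z'] assms by simp
qed

end

section \<open>Algebraic consequences of the first Bianchi identity\<close>

text \<open>In the application V is the set of vector fields, R the curvature, b the covariant derivative of
  the torsion, \<^term>\<open>s X Y Z W\<close> the inner product of the torsions of X, Y and of Z, W, all at a
  fixed point.\<close>

locale bianchi_algebra =
  fixes V :: "'v \<Rightarrow> bool" and J :: "'v \<Rightarrow> 'v" and R b s :: "'v \<Rightarrow> 'v \<Rightarrow> 'v \<Rightarrow> 'v \<Rightarrow> real"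
  assumes J [simp]: "V X \<Longrightarrow> V (J X)"
    and R12: "\<lbrakk>V X; V Y; V Z; V W\<rbrakk> \<Longrightarrow> R X Y Z W = - R Y X Z W"
    and R34: "\<lbrakk>V X; V Y; V Z; V W\<rbrakk> \<Longrightarrow> R X Y Z W = - R X Y W Z"
    and R_J: "\<lbrakk>V X; V Y; V Z; V W\<rbrakk> \<Longrightarrow> R X Y Z (J W) = - R X Y (J Z) W"
    and R_JJ1: "\<lbrakk>V X; V Y; V Z; V W\<rbrakk> \<Longrightarrow> R (J (J X)) Y Z W = - R X Y Z W"
    and R_JJ3: "\<lbrakk>V X; V Y; V Z; V W\<rbrakk> \<Longrightarrow> R X Y (J (J Z)) W = - R X Y Z W"
    and b23: "\<lbrakk>V X; V Y; V Z; V W\<rbrakk> \<Longrightarrow> b X Y Z W = - b X Z Y W"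
    and b34: "\<lbrakk>V X; V Y; V Z; V W\<rbrakk> \<Longrightarrow> b X Y Z W = - b X Y W Z"
    and b_J3: "\<lbrakk>V X; V Y; V Z; V W\<rbrakk> \<Longrightarrow> b X Y (J Z) W = b X (J Y) Z W"
    and b_J4: "\<lbrakk>V X; V Y; V Z; V W\<rbrakk> \<Longrightarrow> b X Y Z (J W) = b X (J Y) Z W"
    and b_JJ1: "\<lbrakk>V X; V Y; V Z; V W\<rbrakk> \<Longrightarrow> b (J (J X)) Y Z W = - b X Y Z W"
    and b_JJ2: "\<lbrakk>V X; V Y; V Z; V W\<rbrakk> \<Longrightarrow> b X (J (J Y)) Z W = - b X Y Z W"
    and s12: "\<lbrakk>V X; V Y; V Z; V W\<rbrakk> \<Longrightarrow> s X Y Z W = - s Y X Z W"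
    and s_sym: "\<lbrakk>V X; V Y; V Z; V W\<rbrakk> \<Longrightarrow> s X Y Z W = s Z W X Y"
    and s_J2: "\<lbrakk>V X; V Y; V Z; V W\<rbrakk> \<Longrightarrow> s X (J Y) Z W = s (J X) Y Z W"
    and s_J3: "\<lbrakk>V X; V Y; V Z; V W\<rbrakk> \<Longrightarrow> s X Y (J Z) W = - s (J X) Y Z W"
    and s_J4: "\<lbrakk>V X; V Y; V Z; V W\<rbrakk> \<Longrightarrow> s X Y Z (J W) = - s (J X) Y Z W"
    and s_JJ: "\<lbrakk>V X; V Y; V Z; V W\<rbrakk> \<Longrightarrow> s (J (J X)) Y Z W = - s X Y Z W"
    and bianchi: "\<lbrakk>V X; V Y; V Z; V W\<rbrakk> \<Longrightarrow> R X Y Z W + R Y Z X W + R Z X Y W =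
      b X Y Z W + b Y Z X W + b Z X Y W + s X Y Z W + s Y Z X W + s Z X Y W"
begin

lemma R_JJ2: "\<lbrakk>V X; V Y; V Z; V W\<rbrakk> \<Longrightarrow> R X (J (J Y)) Z W = - R X Y Z W"
  using R12[of X "J (J Y)" Z W] R12[of X Y Z W] by (simp add: R_JJ1)

text \<open>A normal form for the positions of J: at most one in each of the first three slots of
  \<open>R\<close>, in each of the first two of \<open>b\<close>, and in the first of
  \<open>s\<close>. The remaining values are then treated as unknowns of a linear system.\<close>

lemmas J_normal = R_J R_JJ1 R_JJ2 R_JJ3 b_J3 b_J4 b_JJ1 b_JJ2 s_J2 s_J3 s_J4 s_JJ

text \<open>The part of the Bianchi identity on three (1,0)-vectors: the curvature takes values in
  (1,0)-vectors and the derivative of the torsion in (0,1)-vectors, so both vanish separately.\<close>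

lemma bianchi_30:
  assumes "V X" "V Y" "V Z" "V W"
  shows bianchi_30_R: "R X Y Z W - R (J X) (J Y) Z W - R (J X) Y (J Z) W - R X (J Y) (J Z) W +
      (R Y Z X W - R (J Y) (J Z) X W - R (J Y) Z (J X) W - R Y (J Z) (J X) W) +
      (R Z X Y W - R (J Z) (J X) Y W - R (J Z) X (J Y) W - R Z (J X) (J Y) W) = 0"
    and bianchi_30_b: "b X Y Z W - b (J X) (J Y) Z W + (b Y Z X W - b (J Y) (J Z) X W) +
      (b Z X Y W - b (J Z) (J X) Y W) = 0"
proof -
  \<comment> \<open>With signs +, -, -, - the instances in \<open>1\<close> form the real part of
    the identity on X - iJX, Y - iJY, Z - iJZ. Those in \<open>2\<close> are the same with JX and JW
    for X and W. On these vectors JX contributes a factor i, while JW contributes -i in the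
    curvature and i in b. So \<open>1\<close> and \<open>2\<close> equate the same curvature sum to
    b and to -b, the terms in s cancelling in each.\<close>
  note 1 = bianchi[of X Y Z W] bianchi[of "J X" "J Y" Z W] bianchi[of "J X" Y "J Z" W]
    bianchi[of X "J Y" "J Z" W]
  note 2 = bianchi[of "J X" Y Z "J W"] bianchi[of "J (J X)" "J Y" Z "J W"]
    bianchi[of "J (J X)" Y "J Z" "J W"] bianchi[of "J X" "J Y" "J Z" "J W"]
  show "R X Y Z W - R (J X) (J Y) Z W - R (J X) Y (J Z) W - R X (J Y) (J Z) W +
      (R Y Z X W - R (J Y) (J Z) X W - R (J Y) Z (J X) W - R Y (J Z) (J X) W) +
      (R Z X Y W - R (J Z) (J X) Y W - R (J Z) X (J Y) W - R Z (J X) (J Y) W) = 0"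
    and "b X Y Z W - b (J X) (J Y) Z W + (b Y Z X W - b (J Y) (J Z) X W) +
      (b Z X Y W - b (J Z) (J X) Y W) = 0"
    using 1 2 assms by (simp_all add: J_normal)
qed

text \<open>The defect \<open>m\<close> alternates in its last three slots and its cyclic sums over
  the first three vanish. The cyclic identities for all four choices of the last vector form a
  nonsingular linear system in the four values of \<open>m\<close>, one for each first vector. In
  terms of types: where b is nonzero, X has the type opposite to that of Y, Z and W.\<close>

lemma b_J1:
  assumes "V X" "V Y" "V Z" "V W"
  shows "b (J X) (J Y) Z W = b X Y Z W"
proof -
  define m where "m X Y Z W = b X Y Z W - b (J X) (J Y) Z W" for X Y Z W
  have m: "m X Y Z W = - m X Z Y W" "m X Y Z W = - m X Y W Z" if "V X" "V Y" "V Z" "V W" for X Y Z W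
    using b23[of X Y Z W] b23[of "J X" "J Y" Z W] b34[of X Y Z W] b34[of "J X" "J Y" Z W] that
    by (simp_all add: m_def J_normal)
  have cyc: "m X Y Z W + m Y Z X W + m Z X Y W = 0" if "V X" "V Y" "V Z" "V W" for X Y Z W
    using bianchi_30_b[OF that] by (simp add: m_def)
  have "m X Y Z W = 0"
    using cyc[OF assms(1,2,3,4)] cyc[OF assms(1,2,4,3)] cyc[OF assms(1,3,4,2)] cyc[OF assms(2,3,4,1)]
      m[OF assms(1,2,3,4)] m[OF assms(1,2,4,3)] m[OF assms(1,3,4,2)] m[OF assms(1,3,2,4)] m[OF assms(1,4,2,3)] m[OF assms(1,4,3,2)]
      m[OF assms(2,1,3,4)] m[OF assms(2,1,4,3)] m[OF assms(2,3,4,1)] m[OF assms(2,3,1,4)] m[OF assms(2,4,1,3)] m[OF assms(2,4,3,1)]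
      m[OF assms(3,2,1,4)] m[OF assms(3,2,4,1)] m[OF assms(3,1,4,2)] m[OF assms(3,1,2,4)] m[OF assms(3,4,2,1)] m[OF assms(3,4,1,2)]
      m[OF assms(4,2,3,1)] m[OF assms(4,2,1,3)] m[OF assms(4,3,1,2)] m[OF assms(4,3,2,1)] m[OF assms(4,1,2,3)] m[OF assms(4,1,3,2)]
    by linarith
  then show ?thesis by (simp add: m_def)
qed

text \<open>The (0,1)-valued part of the Bianchi identity on X + iJX, Y - iJY, Z - iJZ: only the
  derivative of \<tau> along the first vector and the curvature of the last two applied to the first
  survive. By \<open>b_J1\<close> the four terms in the real part of b are equal, hence the
  4.\<close>

lemma b_curvature:
  assumes "V X" "V Y" "V Z" "V W"
  shows "4 * b X Y Z W = R Y Z X W - R (J Y) (J Z) X W + R (J Y) Z (J X) W + R Y (J Z) (J X) W"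
proof -
  note 1 = bianchi[of X Y Z W] bianchi[of "J X" "J Y" Z W] bianchi[of "J X" Y "J Z" W]
    bianchi[of X "J Y" "J Z" W]
  note 2 = bianchi[of "J X" Y Z "J W"] bianchi[of "J (J X)" "J Y" Z "J W"]
    bianchi[of "J (J X)" Y "J Z" "J W"] bianchi[of "J X" "J Y" "J Z" "J W"]
  show ?thesis using 1 2 assms by (simp add: J_normal b_J1)
qed

theorem b_zero:
  assumes "V X" "V Y" "V Z" "V W"
  shows "b X Y Z W = 0"
proof -
  \<comment> \<open>b is invariant under cyclic permutation of Y, Z, W, so
    \<open>b_curvature\<close> may be summed over these. By \<open>R34\<close> and
    \<open>R_J\<close> the right-hand sides add up to minus the expression in
    \<open>bianchi_30_R\<close> for Y, Z, W against X, which is 0.\<close>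
  have "b X Z W Y = b X Y Z W" "b X W Y Z = b X Y Z W"
    using b23[OF assms(1,3,4,2)] b34[OF assms(1,4,3,2)] b34[OF assms(1,3,2,4)] b23[OF assms(1,2,3,4)] b34[OF assms(1,4,2,3)]
      b23[OF assms(1,4,3,2)] b34[OF assms(1,3,4,2)] by linarith+
  then show ?thesis
    using bianchi_30_R[OF assms(2,3,4,1)] b_curvature[OF assms(1,2,3,4)] b_curvature[OF assms(1,3,4,2)] b_curvature[OF assms(1,4,2,3)]
      R34[OF assms(2,3,1,4)] R34[OF J[OF assms(2)] J[OF assms(3)] assms(1) assms(4)] R34[OF J[OF assms(2)] assms(3) J[OF assms(1)] assms(4)] R34[OF assms(2) J[OF assms(3)] J[OF assms(1)] assms(4)]
      R34[OF assms(3,4,1,2)] R34[OF J[OF assms(3)] J[OF assms(4)] assms(1) assms(2)] R34[OF J[OF assms(3)] assms(4) J[OF assms(1)] assms(2)] R34[OF assms(3) J[OF assms(4)] J[OF assms(1)] assms(2)]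
      R34[OF assms(4,2,1,3)] R34[OF J[OF assms(4)] J[OF assms(2)] assms(1) assms(3)] R34[OF J[OF assms(4)] assms(2) J[OF assms(1)] assms(3)] R34[OF assms(4) J[OF assms(2)] J[OF assms(1)] assms(3)] assms
    by (simp add: J_normal)
qed

lemma s34: "\<lbrakk>V X; V Y; V Z; V W\<rbrakk> \<Longrightarrow> s X Y Z W = - s X Y W Z"
  using s_sym[of X Y Z W] s_sym[of X Y W Z] s12[of Z W X Y] by simp

theorem R_pair_sym:
  assumes "V X" "V Y" "V Z" "V W"
  shows "R X Y Z W = R Z W X Y"
proof -
  have B: "R X Y Z W + R Y Z X W + R Z X Y W = s X Y Z W + s Y Z X W + s Z X Y W"
    if "V X" "V Y" "V Z" "V W" for X Y Z W
    using bianchi[OF that] b_zero that by simp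
  \<comment> \<open>In the sum of the Bianchi identities for the four rotations of X, Y, Z, W
    everything on the left cancels except twice R Z X Y W minus twice R Y W Z X. The right-hand side
    reduces in the same way and is 0 by \<open>s_sym\<close>.\<close>
  have "R Z X Y W = R Y W Z X" if v: "V X" "V Y" "V Z" "V W" for X Y Z W
    using B[OF v(1,2,3,4)] B[OF v(2,3,4,1)] B[OF v(3,4,1,2)] B[OF v(4,1,2,3)]
      R34[OF v(2,3,4,1)] R34[OF v(3,4,2,1)] R12[OF v(4,2,3,1)] R12[OF v(4,1,3,2)] R34[OF v(1,4,3,2)]
      R12[OF v(1,3,4,2)] R34[OF v(3,1,4,2)] R12[OF v(4,1,2,3)] R34[OF v(1,2,4,3)] R34[OF v(2,4,1,3)]
      s34[OF v(2,3,4,1)] s34[OF v(3,4,2,1)] s12[OF v(4,2,3,1)] s12[OF v(4,1,3,2)] s34[OF v(1,4,3,2)]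
      s12[OF v(1,3,4,2)] s34[OF v(3,1,4,2)] s12[OF v(4,1,2,3)] s34[OF v(1,2,4,3)] s34[OF v(2,4,1,3)]
      s_sym[OF v(3,1,2,4)]
    by linarith
  then show ?thesis using assms by blast
qed

end

section \<open>Curvature of the canonical connection\<close>

context nk_region
begin

definition Rm :: "('m, real) field \<Rightarrow> ('m, real) field \<Rightarrow> ('m, real) field \<Rightarrow> ('m, real) field" where
  "Rm X Y Z = fsub (fsub (nabla X (nabla Y Z)) (nabla Y (nabla X Z))) (nabla (lie_bracket A X Y) Z)"

text \<open>The two slots of the curvature operator come first, so this is the real form of
  \<open>curvature4\<close> with its pairs exchanged.\<close>

definition R4 :: "('m, real) field \<Rightarrow> ('m, real) field \<Rightarrow> ('m, real) field \<Rightarrow> ('m, real) field \<Rightarrow> 'm \<Rightarrow> real"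
  where "R4 X Y Z W = ip (Rm X Y Z) W"

definition nabla_t :: "('m, real) field \<Rightarrow> ('m, real) field \<Rightarrow> ('m, real) field \<Rightarrow> ('m, real) field \<Rightarrow> 'm \<Rightarrow> real"
  where "nabla_t W X Y Z p =
    W p (t X Y Z) - t (nabla W X) Y Z p - t X (nabla W Y) Z p - t X Y (nabla W Z) p"

lemma vf_Rm [simp]: "VF X \<Longrightarrow> VF Y \<Longrightarrow> VF Z \<Longrightarrow> VF (Rm X Y Z)"
  unfolding Rm_def by simp

lemma t_smooth: "VF X \<Longrightarrow> VF Y \<Longrightarrow> VF Z \<Longrightarrow> smooth_fun A U (t X Y Z)"
  by (simp add: t_def ip_smooth)

lemma R4_eq: "VF X \<Longrightarrow> VF Y \<Longrightarrow> VF Z \<Longrightarrow> VF W \<Longrightarrow> p \<in> U \<Longrightarrow> R4 X Y Z W p =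
    ip (nabla X (nabla Y Z)) W p - ip (nabla Y (nabla X Z)) W p - ip (nabla (lie_bracket A X Y) Z) W p"
  by (simp add: R4_def Rm_def ip_sub1)

lemma R4_12: "VF X \<Longrightarrow> VF Y \<Longrightarrow> VF Z \<Longrightarrow> VF W \<Longrightarrow> p \<in> U \<Longrightarrow> R4 X Y Z W p = - R4 Y X Z W p"
proof -
  assume h: "VF X" "VF Y" "VF Z" "VF W" "p \<in> U"
  have "nabla (lie_bracket A X Y) Z p = nabla (fscale (-1) (lie_bracket A Y X)) Z p"
    by (rule D_cong) (use h lb_skew in auto)
  also have "\<dots> = fscale (-1) (nabla (lie_bracket A Y X) Z) p"
    using h by (simp add: D_scale1) (simp add: fscale_def)
  finally have "ip (nabla (lie_bracket A X Y) Z) W p = - ip (nabla (lie_bracket A Y X) Z) W p"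
    using ip_cong1[of "nabla (lie_bracket A X Y) Z" p "fscale (-1) (nabla (lie_bracket A Y X) Z)" W] h
    by (simp add: ip_scale1)
  then show ?thesis using h by (simp add: R4_eq)
qed

lemma R4_34: "VF X \<Longrightarrow> VF Y \<Longrightarrow> VF Z \<Longrightarrow> VF W \<Longrightarrow> p \<in> U \<Longrightarrow> R4 X Y Z W p = - R4 X Y W Z p"
proof -
  assume h: "VF X" "VF Y" "VF Z" "VF W" "p \<in> U"
  \<comment> \<open>Two derivatives of <Z, W>. Antisymmetrizing in X and Y cancels the mixed terms
    and leaves the curvature acting on one factor at a time.\<close>
  have second: "X p (\<lambda>q. Y q (ip Z W)) = ip (nabla X (nabla Y Z)) W p + ip (nabla Y Z) (nabla X W) p +
      (ip (nabla X Z) (nabla Y W) p + ip Z (nabla X (nabla Y W)) p)" if "VF X" "VF Y" for X Y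
  proof -
    have "X p (\<lambda>q. Y q (ip Z W)) = X p (\<lambda>q. ip (nabla Y Z) W q + ip Z (nabla Y W) q)"
      by (rule vf_fun_cong[OF that(1) h(5)]) (use that h D_metric in auto)
    also have "\<dots> = X p (ip (nabla Y Z) W) + X p (ip Z (nabla Y W))"
      by (rule vf_fun_add) (use that h ip_smooth in auto)
    finally show ?thesis using D_metric[of X "nabla Y Z" W p] D_metric[of X Z "nabla Y W" p] that h by simp
  qed
  have "smooth_near A p (ip Z W)" using smooth_nearI[OF open_U h(5)] ip_smooth h by blast
  then have "lie_bracket A X Y p (ip Z W) = X p (\<lambda>q. Y q (ip Z W)) - Y p (\<lambda>q. X q (ip Z W))"
    by (simp add: lie_bracket_def)
  then have "ip (nabla (lie_bracket A X Y) Z) W p + ip Z (nabla (lie_bracket A X Y) W) p =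
      X p (\<lambda>q. Y q (ip Z W)) - Y p (\<lambda>q. X q (ip Z W))"
    using D_metric[of "lie_bracket A X Y" Z W p] h by simp
  then show ?thesis
    using second[OF h(1,2)] second[OF h(2,1)] h ip_sym[of Z "nabla X (nabla Y W)" p]
      ip_sym[of Z "nabla Y (nabla X W)" p] ip_sym[of Z "nabla (lie_bracket A X Y) W" p]
    by (simp add: R4_eq)
qed

lemma nabla_nabla_J:
  assumes "VF X" "VF Y" "VF Z" "p \<in> U"
  shows "nabla X (nabla Y (fJ Z)) p = fJ (nabla X (nabla Y Z)) p"
proof -
  have "nabla X (nabla Y (fJ Z)) p = nabla X (fJ (nabla Y Z)) p"
    by (rule D_cong) (use assms nabla_J in auto)
  then show ?thesis using assms by (simp add: nabla_J)
qed

lemma R4_J34: "VF X \<Longrightarrow> VF Y \<Longrightarrow> VF Z \<Longrightarrow> VF W \<Longrightarrow> p \<in> U \<Longrightarrow> R4 X Y (fJ Z) W p = - R4 X Y Z (fJ W) p"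
  using ip_cong1[of "nabla X (nabla Y (fJ Z))" p "fJ (nabla X (nabla Y Z))" W]
    ip_cong1[of "nabla Y (nabla X (fJ Z))" p "fJ (nabla Y (nabla X Z))" W]
    ip_cong1[of "nabla (lie_bracket A X Y) (fJ Z)" p "fJ (nabla (lie_bracket A X Y) Z)" W]
  by (simp add: R4_eq nabla_nabla_J nabla_J ip_J)

text \<open>Prepares \<open>R4_JJ1\<close>: J J X = - X holds as an identity of fields on U, and
  since X also occurs under a derivative, equality on all of U is what is used.\<close>

lemma R4_cong1:
  assumes "VF X" "VF X'" "VF Y" "VF Z" "VF W" "p \<in> U" "\<And>q. q \<in> U \<Longrightarrow> X q = X' q"
  shows "R4 X Y Z W p = R4 X' Y Z W p"
proof -
  have "nabla X (nabla Y Z) p = nabla X' (nabla Y Z) p"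
    by (rule D_cong) (use assms in auto)
  moreover have "nabla Y (nabla X Z) p = nabla Y (nabla X' Z) p"
    by (rule D_cong) (use assms D_cong[of X' Z _ X Z] in auto)
  moreover have "nabla (lie_bracket A X Y) Z p = nabla (lie_bracket A X' Y) Z p"
    by (rule D_cong) (use assms lb_cong[of X X' Y] in auto)
  ultimately show ?thesis using assms by (simp add: R4_eq ip_def)
qed

lemma R4_scale1:
  assumes "VF X" "VF Y" "VF Z" "VF W" "p \<in> U"
  shows "R4 (fscale a X) Y Z W p = a * R4 X Y Z W p"
proof -
  have "nabla (fscale a X) (nabla Y Z) p = fscale a (nabla X (nabla Y Z)) p"
    using assms by (simp add: D_scale1) (simp add: fscale_def)
  moreover have "nabla (fscale a X) Z q = fscale a (nabla X Z) q" if "q \<in> U" for q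
    using assms that by (simp add: D_scale1) (simp add: fscale_def)
  then have "nabla Y (nabla (fscale a X) Z) p = nabla Y (fscale a (nabla X Z)) p"
    by (intro D_cong) (use assms in auto)
  moreover have "nabla Y (fscale a (nabla X Z)) p = fscale a (nabla Y (nabla X Z)) p"
    using assms by (simp add: D_scale2) (simp add: fscale_def)
  moreover have "nabla (lie_bracket A (fscale a X) Y) Z p = nabla (fscale a (lie_bracket A X Y)) Z p"
    by (rule D_cong) (use assms lb_scale in auto)
  moreover have "nabla (fscale a (lie_bracket A X Y)) Z p = fscale a (nabla (lie_bracket A X Y) Z) p"
    using assms by (simp add: D_scale1) (simp add: fscale_def)
  ultimately show ?thesis
    using assms ip_cong1[of "nabla (fscale a X) (nabla Y Z)" p "fscale a (nabla X (nabla Y Z))" W]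
      ip_cong1[of "nabla Y (nabla (fscale a X) Z)" p "fscale a (nabla Y (nabla X Z))" W]
      ip_cong1[of "nabla (lie_bracket A (fscale a X) Y) Z" p "fscale a (nabla (lie_bracket A X Y) Z)" W]
    by (simp add: R4_eq ip_scale1 right_diff_distrib)
qed

section \<open>The first Bianchi identity of a connection with torsion\<close>

lemma nabla_t_eq:
  assumes "VF W" "VF X" "VF Y" "VF Z" "p \<in> U"
  shows "nabla_t W X Y Z p = ip (nabla W (torsion A nabla X Y)) Z p - t (nabla W X) Y Z p - t X (nabla W Y) Z p"
  using D_metric[of W "torsion A nabla X Y" Z p] assms by (simp add: nabla_t_def t_def)

text \<open>The torsion formula is used for Y and Z, then for X and [Y, Z]. The terms are grouped
  for the cyclic sum: the left-hand sides add up to curvatures, the double brackets cancel by the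
  Jacobi identity, and what remains is nabla \<tau> plus \<tau> of \<tau>.\<close>

lemma nabla_difference:
  assumes "VF X" "VF Y" "VF Z" "VF W" "p \<in> U"
  shows "ip (nabla X (nabla Y Z)) W p - ip (nabla X (nabla Z Y)) W p - ip (nabla (lie_bracket A Y Z) X) W p =
    ip (lie_bracket A X (lie_bracket A Y Z)) W p + ip (nabla X (torsion A nabla Y Z)) W p +
    t X (nabla Y Z) W p - t X (nabla Z Y) W p - t X (torsion A nabla Y Z) W p"
proof -
  let ?l = "lie_bracket A Y Z" and ?\<tau> = "torsion A nabla Y Z"
  have "fsub (nabla Y Z) (nabla Z Y) = fadd ?l ?\<tau>"
    by (intro ext) (simp add: fsub_def fadd_def torsion_def vec_defs)
  then have *: "nabla X (fsub (nabla Y Z) (nabla Z Y)) p = nabla X (fadd ?l ?\<tau>) p" by simp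
  then have "fsub (nabla X (nabla Y Z)) (nabla X (nabla Z Y)) p = fadd (nabla X ?l) (nabla X ?\<tau>) p"
    using assms by (simp add: D_sub2 D_add2) (simp add: fsub_def fadd_def)
  then have "ip (fsub (nabla X (nabla Y Z)) (nabla X (nabla Z Y))) W p = ip (fadd (nabla X ?l) (nabla X ?\<tau>)) W p"
    by (simp add: ip_def)
  then have 1: "ip (nabla X (nabla Y Z)) W p - ip (nabla X (nabla Z Y)) W p = ip (nabla X ?l) W p + ip (nabla X ?\<tau>) W p"
    using assms by (simp add: ip_sub1 ip_add1)
  have 2: "t X ?l W p = ip (nabla X ?l) W p - ip (nabla ?l X) W p - ip (lie_bracket A X ?l) W p"
    using assms by (simp add: t_def tor_eq[of X ?l] ip_sub1)
  \<comment> \<open>The bracket inside t is itself replaced by covariant derivatives and torsion;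
    \<open>t_pointwise\<close> permits this.\<close>
  have "?l p = fadd (nabla Y Z) (fscale (-1) (fadd (nabla Z Y) ?\<tau>)) p"
    by (auto simp: fadd_def fscale_def torsion_def vec_defs)
  then have "t X ?l W p = t X (fadd (nabla Y Z) (fscale (-1) (fadd (nabla Z Y) ?\<tau>))) W p"
    using assms by (intro t_pointwise) auto
  moreover have "t X (fscale (-1) V) W p = - t X V W p" if "VF V" for V
    using that assms t_skew12[of X "fscale (-1) V" W p] t_skew12[of X V W p]
      ip_cong1[of "torsion A nabla (fscale (-1) V) X" p "fscale (-1) (torsion A nabla V X)" W]
    by (simp add: tor_scale t_def ip_scale1)
  ultimately have 3: "t X ?l W p = t X (nabla Y Z) W p - t X (nabla Z Y) W p - t X ?\<tau> W p"
    using assms by (simp add: t_add2)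
  show ?thesis using 1 2 3 by linarith
qed

lemma first_bianchi:
  assumes "VF X" "VF Y" "VF Z" "VF W" "p \<in> U"
  shows "R4 X Y Z W p + R4 Y Z X W p + R4 Z X Y W p =
    nabla_t X Y Z W p + nabla_t Y Z X W p + nabla_t Z X Y W p +
    t (torsion A nabla X Y) Z W p + t (torsion A nabla Y Z) X W p + t (torsion A nabla Z X) Y W p"
proof -
  let ?j = "fadd (fadd (lie_bracket A X (lie_bracket A Y Z)) (lie_bracket A Y (lie_bracket A Z X)))
      (lie_bracket A Z (lie_bracket A X Y))"
  have "?j p = vzero"
    using jacobi[OF open_U assms(5,1,2,3)] by (auto simp: fadd_def vec_defs)
  then have "ip ?j W p = 0" using g_zero[OF vf_tangent[OF assms(4,5)]] by (simp add: ip_def)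
  then have j: "ip (lie_bracket A X (lie_bracket A Y Z)) W p + ip (lie_bracket A Y (lie_bracket A Z X)) W p +
      ip (lie_bracket A Z (lie_bracket A X Y)) W p = 0"
    using assms by (simp add: ip_add1)
  show ?thesis
    unfolding R4_eq[OF assms(1,2,3,4,5)] R4_eq[OF assms(2,3,1,4,5)] R4_eq[OF assms(3,1,2,4,5)]
      nabla_t_eq[OF assms(1,2,3,4,5)] nabla_t_eq[OF assms(2,3,1,4,5)] nabla_t_eq[OF assms(3,1,2,4,5)]
    using nabla_difference[OF assms(1,2,3,4,5)] nabla_difference[OF assms(2,3,1,4,5)]
      nabla_difference[OF assms(3,1,2,4,5)] j
      t_skew12[of X "nabla Y Z" W p] t_skew12[of X "nabla Z Y" W p] t_skew12[of X "torsion A nabla Y Z" W p]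
      t_skew12[of Y "nabla Z X" W p] t_skew12[of Y "nabla X Z" W p] t_skew12[of Y "torsion A nabla Z X" W p]
      t_skew12[of Z "nabla X Y" W p] t_skew12[of Z "nabla Y X" W p] t_skew12[of Z "torsion A nabla X Y" W p]
      assms
    by simp
qed

section \<open>Symmetries of the derivative of the torsion\<close>

lemma vf_fun_neg:
  assumes "VF W" "p \<in> U" "smooth_fun A U h" "\<And>q. q \<in> U \<Longrightarrow> f q = - h q"
  shows "W p f = - W p h"
  using vf_fun_cong[OF assms(1,2), of f "\<lambda>q. -1 * h q"] vf_fun_cmult[OF assms(1-3), of "-1"] assms(4)
  by simp

lemma nabla_t_skew:
  assumes "VF W" "VF X" "VF Y" "VF Z" "p \<in> U"
  shows "nabla_t W X Y Z p = - nabla_t W Y X Z p" and "nabla_t W X Y Z p = - nabla_t W X Z Y p"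
proof -
  have "W p (t X Y Z) = - W p (t Y X Z)" "W p (t X Y Z) = - W p (t X Z Y)"
    by (rule vf_fun_neg[OF assms(1,5) t_smooth]; use assms t_skew12 t_skew23 in blast)+
  then show "nabla_t W X Y Z p = - nabla_t W Y X Z p" "nabla_t W X Y Z p = - nabla_t W X Z Y p"
    using t_skew12[of "nabla W X" Y Z p] t_skew12[of X "nabla W Y" Z p] t_skew12[of X Y "nabla W Z" p]
      t_skew23[of "nabla W X" Y Z p] t_skew23[of X "nabla W Y" Z p] t_skew23[of X Y "nabla W Z" p] assms
    by (simp_all add: nabla_t_def)
qed

lemma t_nabla_J:
  assumes "VF W" "VF X" "VF Y" "VF Z" "p \<in> U"
  shows "t (nabla W (fJ X)) Y Z p = t (fJ (nabla W X)) Y Z p"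
    and "t X (nabla W (fJ Y)) Z p = t X (fJ (nabla W Y)) Z p"
    and "t X Y (nabla W (fJ Z)) p = t X Y (fJ (nabla W Z)) p"
  by (rule t_pointwise; use assms nabla_J in simp)+

text \<open>J is parallel, so differentiating the rules that move J between the slots of t preserves
  them.\<close>

lemma nabla_t_J:
  assumes "VF W" "VF X" "VF Y" "VF Z" "p \<in> U"
  shows "nabla_t W X (fJ Y) Z p = nabla_t W (fJ X) Y Z p" and "nabla_t W X Y (fJ Z) p = nabla_t W (fJ X) Y Z p"
proof -
  have J13: "t X Y (fJ Z) q = t (fJ X) Y Z q" if "VF X" "VF Y" "VF Z" "q \<in> U" for X Y Z q
    using t_J12[OF that] t_J23[OF that] by simp
  have "W p (t X (fJ Y) Z) = W p (t (fJ X) Y Z)" "W p (t X Y (fJ Z)) = W p (t (fJ X) Y Z)"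
    by (rule vf_fun_cong; use assms t_J12 J13 in simp)+
  then show "nabla_t W X (fJ Y) Z p = nabla_t W (fJ X) Y Z p" "nabla_t W X Y (fJ Z) p = nabla_t W (fJ X) Y Z p"
    using assms by (simp_all add: nabla_t_def t_nabla_J t_J12 J13)
qed

lemma nabla_t_JJ:
  assumes "VF W" "VF X" "VF Y" "VF Z" "p \<in> U"
  shows "nabla_t (fJ (fJ W)) X Y Z p = - nabla_t W X Y Z p"
    and "nabla_t W (fJ (fJ X)) Y Z p = - nabla_t W X Y Z p"
proof -
  have D: "nabla (fJ (fJ W)) X p = fJ (fJ (nabla W X)) p" if "VF X" for X
  proof -
    have "nabla (fJ (fJ W)) X p = nabla (fscale (-1) W) X p" by (rule D_cong) (use assms that fJ_fJ in auto)
    then show ?thesis using assms that by (simp add: D_scale1 fJ_fJ) (simp add: fscale_def)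
  qed
  have "t (nabla (fJ (fJ W)) X) Y Z p = t (fJ (fJ (nabla W X))) Y Z p"
    "t X (nabla (fJ (fJ W)) Y) Z p = t X (fJ (fJ (nabla W Y))) Z p"
    "t X Y (nabla (fJ (fJ W)) Z) p = t X Y (fJ (fJ (nabla W Z))) p"
    by (rule t_pointwise; use assms D in simp)+
  moreover have "fJ (fJ W) p f = - W p f" for f using assms by (simp add: fJ_fJ fscale_def vscale_def)
  ultimately show "nabla_t (fJ (fJ W)) X Y Z p = - nabla_t W X Y Z p"
    using assms by (simp add: nabla_t_def t_JJ1 t_JJ2 t_JJ3)
  have "W p (t (fJ (fJ X)) Y Z) = - W p (t X Y Z)"
    by (rule vf_fun_neg[OF assms(1,5) t_smooth[OF assms(2-4)]]) (use assms t_JJ1 in simp)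
  moreover have "t (nabla W (fJ (fJ X))) Y Z p = t (fJ (fJ (nabla W X))) Y Z p"
  proof (rule t_pointwise)
    show "nabla W (fJ (fJ X)) p = fJ (fJ (nabla W X)) p"
      using nabla_J[of W "fJ X" p] nabla_J[of W X p] assms
      by (simp add: fJ_def[of "nabla W (fJ X)"] fJ_def[of "fJ (nabla W X)"])
  qed (use assms in simp_all)
  ultimately show "nabla_t W (fJ (fJ X)) Y Z p = - nabla_t W X Y Z p"
    using assms by (simp add: nabla_t_def t_JJ1)
qed

lemma R4_JJ1: "VF X \<Longrightarrow> VF Y \<Longrightarrow> VF Z \<Longrightarrow> VF W \<Longrightarrow> p \<in> U \<Longrightarrow> R4 (fJ (fJ X)) Y Z W p = - R4 X Y Z W p"
  using R4_cong1[of "fJ (fJ X)" "fscale (-1) X" Y Z W p] by (simp add: R4_scale1 fJ_fJ)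

lemma t_tor_sym: "VF X \<Longrightarrow> VF Y \<Longrightarrow> VF Z \<Longrightarrow> VF W \<Longrightarrow> p \<in> U \<Longrightarrow>
    t X Y (torsion A nabla Z W) p = t Z W (torsion A nabla X Y) p"
  by (simp add: t_def ip_sym)

lemma t_tor_J3: "VF X \<Longrightarrow> VF Y \<Longrightarrow> VF Z \<Longrightarrow> VF W \<Longrightarrow> p \<in> U \<Longrightarrow>
    t X Y (torsion A nabla (fJ Z) W) p = - t (fJ X) Y (torsion A nabla Z W) p"
  using t_tor_sym[of X Y "fJ Z" W p] t_J12[of Z W "torsion A nabla X Y" p] t_J23[of Z W "torsion A nabla X Y" p]
    t_J12[of X Y "torsion A nabla Z W" p] t_J23[of X Y "torsion A nabla Z W" p]
    ip_J[of "torsion A nabla X Y" "torsion A nabla Z W" p]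
    ip_sym[of "fJ (torsion A nabla X Y)" "torsion A nabla Z W" p]
  by (simp add: t_def)

lemma bianchi_algebra:
  assumes p: "p \<in> U"
  shows "bianchi_algebra VF fJ (\<lambda>X Y Z W. R4 X Y Z W p) (\<lambda>X Y Z W. nabla_t X Y Z W p)
    (\<lambda>X Y Z W. t X Y (torsion A nabla Z W) p)"
proof
  fix X Y Z W assume v: "VF X" "VF Y" "VF Z" "VF W"
  note h = v p
  show "R4 X Y Z W p = - R4 Y X Z W p" "R4 X Y Z W p = - R4 X Y W Z p" using h by (fact R4_12 R4_34)+
  show "R4 X Y Z (fJ W) p = - R4 X Y (fJ Z) W p" "R4 (fJ (fJ X)) Y Z W p = - R4 X Y Z W p"
    using h by (simp_all add: R4_J34 R4_JJ1)
  show "R4 X Y (fJ (fJ Z)) W p = - R4 X Y Z W p"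
    using h ip_cong2[of "fJ (fJ W)" p "fscale (-1) W" "Rm X Y Z"]
    by (simp add: R4_J34) (simp add: R4_def fJ_fJ ip_scale2)
  show "nabla_t X Y Z W p = - nabla_t X Z Y W p" "nabla_t X Y Z W p = - nabla_t X Y W Z p"
    using h by (fact nabla_t_skew)+
  show "nabla_t X Y (fJ Z) W p = nabla_t X (fJ Y) Z W p" "nabla_t X Y Z (fJ W) p = nabla_t X (fJ Y) Z W p"
    "nabla_t (fJ (fJ X)) Y Z W p = - nabla_t X Y Z W p" "nabla_t X (fJ (fJ Y)) Z W p = - nabla_t X Y Z W p"
    using h by (fact nabla_t_J nabla_t_JJ)+
  let ?s = "\<lambda>X Y Z W. t X Y (torsion A nabla Z W) p"
  have s: "?s X Y Z W = ?s Z W X Y" if "VF X" "VF Y" "VF Z" "VF W" for X Y Z W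
    using t_tor_sym[OF that p] .
  show "?s X Y Z W = - ?s Y X Z W" "?s X Y Z W = ?s Z W X Y"
    using t_skew12[OF h(1,2) vf_tor[OF h(3,4)] p] s[OF v] by simp_all
  show "?s X (fJ Y) Z W = ?s (fJ X) Y Z W" "?s X Y (fJ Z) W = - ?s (fJ X) Y Z W"
    "?s (fJ (fJ X)) Y Z W = - ?s X Y Z W"
    using h by (simp_all add: t_J12 t_tor_J3 t_JJ1 t_JJ2)
  show "?s X Y Z (fJ W) = - ?s (fJ X) Y Z W"
    using h s[of X Y Z "fJ W"] s[of X Y "fJ Z" W] t_J12[of Z W "torsion A nabla X Y" p] t_tor_J3[of X Y Z W p]
    by simp
  \<comment> \<open>Total skewness rewrites the quadratic term <\<tau>(\<tau>(X, Y), Z), W> as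
    <\<tau>(X, Y), \<tau>(Z, W)>, whose pair symmetry the algebra relies on.\<close>
  have ts: "t (torsion A nabla X Y) Z W p = ?s X Y Z W" if "VF X" "VF Y" "VF Z" "VF W" for X Y Z W
    using that p t_skew12[of "torsion A nabla X Y" Z W p] t_skew23[of Z "torsion A nabla X Y" W p] s[OF that] by simp
  show "R4 X Y Z W p + R4 Y Z X W p + R4 Z X Y W p =
      nabla_t X Y Z W p + nabla_t Y Z X W p + nabla_t Z X Y W p + ?s X Y Z W + ?s Y Z X W + ?s Z X Y W"
    using first_bianchi[OF h] ts[OF h(1,2,3,4)] ts[OF h(2,3,1,4)] ts[OF h(3,1,2,4)] by simp
qed (rule vf_fJ)

theorem torsion_parallel:
  assumes "VF W" "VF X" "VF Y" "VF Z" "p \<in> U"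
  shows "W p (t X Y Z) = t (nabla W X) Y Z p + t X (nabla W Y) Z p + t X Y (nabla W Z) p"
  using bianchi_algebra.b_zero[OF bianchi_algebra[OF assms(5)], OF assms(1-4)] by (simp add: nabla_t_def)

theorem R4_pair_sym:
  assumes "VF X" "VF Y" "VF Z" "VF W" "p \<in> U"
  shows "R4 X Y Z W p = R4 Z W X Y p"
  by (rule bianchi_algebra.R_pair_sym[OF bianchi_algebra[OF assms(5)], OF assms(1-4)])

lemma t_sub:
  assumes "VF X" "VF X'" "VF Y" "VF Z" "p \<in> U"
  shows t_sub1: "t (fsub X X') Y Z p = t X Y Z p - t X' Y Z p"
    and t_sub2: "t Y (fsub X X') Z p = t Y X Z p - t Y X' Z p"
    and t_sub3: "t Y Z (fsub X X') p = t Y Z X p - t Y Z X' p"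
proof -
  have 3: "t Y Z (fsub X X') p = t Y Z X p - t Y Z X' p" if "VF Y" "VF Z" for Y Z
    using assms that by (simp add: t_def ip_sub2)
  have 2: "t Y (fsub X X') Z p = t Y X Z p - t Y X' Z p" if "VF Y" "VF Z" for Y Z
    using 3[OF that] t_skew23[of Y "fsub X X'" Z p] t_skew23[of Y X Z p] t_skew23[of Y X' Z p] assms that by simp
  show "t (fsub X X') Y Z p = t X Y Z p - t X' Y Z p"
    using 2[OF assms(3,4)] t_skew12[of "fsub X X'" Y Z p] t_skew12[of X Y Z p] t_skew12[of X' Y Z p] assms by simp
  show "t Y (fsub X X') Z p = t Y X Z p - t Y X' Z p" "t Y Z (fsub X X') p = t Y Z X p - t Y Z X' p"
    using 2 3 assms by blast+
qed

text \<open>Since the torsion is parallel, the curvature acts trivially on it.\<close>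

lemma Rm_t:
  assumes "VF X" "VF Y" "VF B" "VF C" "VF E" "p \<in> U"
  shows "t (Rm X Y B) C E p + t B (Rm X Y C) E p + t B C (Rm X Y E) p = 0"
proof -
  let ?f = "t B C E"
  \<comment> \<open>Of the nine second-order terms the six mixed ones are together symmetric in X
    and Y, so they cancel in the commutator.\<close>
  have second: "X p (\<lambda>q. Y q ?f) =
      t (nabla X (nabla Y B)) C E p + t (nabla Y B) (nabla X C) E p + t (nabla Y B) C (nabla X E) p +
      (t (nabla X B) (nabla Y C) E p + t B (nabla X (nabla Y C)) E p + t B (nabla Y C) (nabla X E) p) +
      (t (nabla X B) C (nabla Y E) p + t B (nabla X C) (nabla Y E) p + t B C (nabla X (nabla Y E)) p)"
    if v: "VF X" "VF Y" for X Y
  proof -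
    note sm = smooth_fun_add[OF open_U]
    have "X p (\<lambda>q. Y q ?f) =
        X p (\<lambda>q. (t (nabla Y B) C E q + t B (nabla Y C) E q) + t B C (nabla Y E) q)"
      by (rule vf_fun_cong[OF v(1) assms(6)]) (use v assms torsion_parallel in auto)
    also have "\<dots> = X p (\<lambda>q. t (nabla Y B) C E q + t B (nabla Y C) E q) + X p (t B C (nabla Y E))"
      by (rule vf_fun_add[OF v(1) assms(6) sm]) (use v assms t_smooth in auto)
    also have "X p (\<lambda>q. t (nabla Y B) C E q + t B (nabla Y C) E q) =
        X p (t (nabla Y B) C E) + X p (t B (nabla Y C) E)"
      by (rule vf_fun_add[OF v(1) assms(6)]) (use v assms t_smooth in auto)
    finally show ?thesis using v assms by (simp add: torsion_parallel)
  qed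
  have "smooth_near A p ?f" using smooth_nearI[OF open_U assms(6)] t_smooth assms by blast
  then have "lie_bracket A X Y p ?f = X p (\<lambda>q. Y q ?f) - Y p (\<lambda>q. X q ?f)"
    by (simp add: lie_bracket_def)
  moreover have "lie_bracket A X Y p ?f = t (nabla (lie_bracket A X Y) B) C E p +
      t B (nabla (lie_bracket A X Y) C) E p + t B C (nabla (lie_bracket A X Y) E) p"
    using assms by (simp add: torsion_parallel)
  ultimately show ?thesis
    unfolding second[OF assms(1,2)] second[OF assms(2,1)] Rm_def using assms by (simp add: t_sub)
qed

end

section \<open>Vanishing of the torsion at a point of definite Ricci curvature\<close>

lemma fsub_apply: "fsub X Y p = vsub (X p) (Y p)"
  and fadd_apply: "fadd X Y p = vadd (X p) (Y p)"
  by (simp_all add: fsub_def fadd_def)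

context nk_region
begin

text \<open>The expansion of X is known at p only, with numerical coefficients, so the induction
  subtracts summands from the field X. Two families F and G accommodate the real and imaginary parts
  of a complex expansion.\<close>

lemma ip_sum:
  assumes "finite I" "\<And>i. i \<in> I \<Longrightarrow> VF (F i)" "\<And>i. i \<in> I \<Longrightarrow> VF (G i)" "VF Z" "p \<in> U" "VF X"
    and "\<And>f. X p f = (\<Sum>i\<in>I. a i * F i p f + b i * G i p f)"
  shows "ip Z X p = (\<Sum>i\<in>I. a i * ip Z (F i) p + b i * ip Z (G i) p)"
  using assms(1-3,6,7)
proof (induction I arbitrary: X rule: finite_induct)
  case empty
  then have "X p = fscale 0 Z p" by (auto simp: fscale_def vscale_def)
  then show ?case using ip_cong2[of X p "fscale 0 Z" Z] assms(4,5) by (simp add: ip_scale2)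
next
  case (insert i I)
  let ?S = "fadd (fscale (a i) (F i)) (fscale (b i) (G i))"
  have v: "VF (F i)" "VF (G i)" using insert by auto
  have "ip Z (fsub X ?S) p = (\<Sum>i\<in>I. a i * ip Z (F i) p + b i * ip Z (G i) p)"
  proof (rule insert.IH)
    show "fsub X ?S p f = (\<Sum>i\<in>I. a i * F i p f + b i * G i p f)" for f
      using insert by (simp add: fsub_apply fadd_apply fscale_def vec_defs)
  qed (use insert v in auto)
  then show ?case using insert v assms(4,5) by (simp add: ip_sub2 ip_add2 ip_scale2)
qed

lemma curvature_parts:
  fixes X Y Z :: "('m, complex) field"
  defines "X1 \<equiv> re_field X" and "X2 \<equiv> im_field X" and "Y1 \<equiv> re_field Y" and "Y2 \<equiv> im_field Y"
    and "Z1 \<equiv> re_field Z" and "Z2 \<equiv> im_field Z"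
  assumes v: "VF X1" "VF X2" "VF Y1" "VF Y2" "VF Z1" "VF Z2" and p: "p \<in> U"
  shows "re_vec (curvature A nabla X Y Z p) =
      fsub (fsub (Rm X1 Y1 Z1) (Rm X2 Y2 Z1)) (fadd (Rm X1 Y2 Z2) (Rm X2 Y1 Z2)) p"
    and "im_vec (curvature A nabla X Y Z p) =
      fadd (fsub (Rm X1 Y1 Z2) (Rm X2 Y2 Z2)) (fadd (Rm X1 Y2 Z1) (Rm X2 Y1 Z1)) p"
proof -
  have re: "re_field (ext_C B X Y) = fsub (B (re_field X) (re_field Y)) (B (im_field X) (im_field Y))"
    and im: "im_field (ext_C B X Y) = fadd (B (re_field X) (im_field Y)) (B (im_field X) (re_field Y))"
    for B and X Y :: "('m, complex) field"
    by (auto simp: re_field_def im_field_def re_vec_def im_vec_def ext_C_def complex_vec_def fsub_def fadd_def)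
  have rv: "re_vec (vsub (vsub (ext_C B P Q q) (ext_C B P' Q' q)) (ext_C B P'' Q'' q)) =
      vsub (vsub (re_field (ext_C B P Q) q) (re_field (ext_C B P' Q') q)) (re_field (ext_C B P'' Q'') q)"
    and iv: "im_vec (vsub (vsub (ext_C B P Q q) (ext_C B P' Q' q)) (ext_C B P'' Q'' q)) =
      vsub (vsub (im_field (ext_C B P Q) q) (im_field (ext_C B P' Q') q)) (im_field (ext_C B P'' Q'') q)"
    for B P Q q P' Q' P'' Q''
    by (auto simp: re_field_def im_field_def re_vec_def im_vec_def vsub_def)
  show "re_vec (curvature A nabla X Y Z p) =
      fsub (fsub (Rm X1 Y1 Z1) (Rm X2 Y2 Z1)) (fadd (Rm X1 Y2 Z2) (Rm X2 Y1 Z2)) p"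
    unfolding curvature_def Let_def rv re im assms(1-6)[symmetric]
    using v p
    by (simp add: fsub_apply fadd_apply Rm_def D_sub1 D_sub2 D_add1 D_add2) (auto simp: vec_defs)
  show "im_vec (curvature A nabla X Y Z p) =
      fadd (fsub (Rm X1 Y1 Z2) (Rm X2 Y2 Z2)) (fadd (Rm X1 Y2 Z1) (Rm X2 Y1 Z1)) p"
    unfolding curvature_def Let_def iv re im assms(1-6)[symmetric]
    using v p
    by (simp add: fsub_apply fadd_apply Rm_def D_sub1 D_sub2 D_add1 D_add2) (auto simp: vec_defs)
qed

text \<open>The sums over a basis of the three cyclic terms obtained from \<open>Rm_t\<close> agree, which is why the
  vanishing of their sum forces each of them to vanish.\<close>

lemma torsion_zero_of_definite:
  fixes q :: "('m, real) field \<Rightarrow> ('m, real) field \<Rightarrow> real" and \<epsilon> :: real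
  assumes p: "p \<in> U" and I: "finite I" and E: "\<And>i. i \<in> I \<Longrightarrow> VF (E i)"
    and parseval: "\<And>X Y. VF X \<Longrightarrow> VF Y \<Longrightarrow> ip X Y p = \<kappa> * (\<Sum>i\<in>I. ip X (E i) p * ip Y (E i) p)"
    and L: "finite L" and F: "\<And>l. l \<in> L \<Longrightarrow> VF (F l)" "\<And>l. l \<in> L \<Longrightarrow> VF (G l)"
    and q: "\<And>X Y. q X Y = (\<Sum>l\<in>L. R4 (F l) (G l) X Y p)"
    and def: "\<And>X. VF X \<Longrightarrow> X p \<noteq> vzero \<Longrightarrow> \<epsilon> * q X (fJ X) > 0"
    and X: "VF X" "VF Y" "VF Z"
  shows "t X Y Z p = 0"
proof -
  \<comment> \<open>Here \<open>q\<close> X Y is <S X, Y> with S the sum of the operators R(F l, G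
    l); the claim is that S annihilates \<tau>.\<close>
  have qt: "q B (torsion A nabla C H) + q C (torsion A nabla H B) + q H (torsion A nabla B C) = 0"
    if v: "VF B" "VF C" "VF H" for B C H
  proof -
    have "R4 (F l) (G l) B (torsion A nabla C H) p + R4 (F l) (G l) C (torsion A nabla H B) p +
        R4 (F l) (G l) H (torsion A nabla B C) p = 0" if "l \<in> L" for l
    proof -
      let ?R = "Rm (F l) (G l)"
      note v = v F(1)[OF that] F(2)[OF that] p
      show ?thesis
        using Rm_t[OF v(4,5,1,2,3) p] v t_skew12[of "?R B" C H p] t_skew23[of C "?R B" H p]
          t_skew12[of B H "?R C" p] t_skew23[of B "?R C" H p]
          ip_sym[of "?R B" "torsion A nabla C H" p] ip_sym[of "?R C" "torsion A nabla H B" p]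
          ip_sym[of "?R H" "torsion A nabla B C" p]
        by (simp add: R4_def t_def)
    qed
    then show ?thesis unfolding q sum.distrib[symmetric] by simp
  qed
  have q_parseval: "q X Y = \<kappa> * (\<Sum>i\<in>I. q X (E i) * ip Y (E i) p)" if "VF X" "VF Y" for X Y
  proof -
    have "q X Y = (\<Sum>l\<in>L. \<kappa> * (\<Sum>i\<in>I. R4 (F l) (G l) X (E i) p * ip Y (E i) p))"
      unfolding q R4_def by (rule sum.cong) (use that F in \<open>simp_all add: parseval[symmetric]\<close>)
    also have "\<dots> = \<kappa> * (\<Sum>i\<in>I. q X (E i) * ip Y (E i) p)"
      unfolding q sum_distrib_right sum_distrib_left by (rule sum.swap)
    finally show ?thesis .
  qed
  have q_skew: "q X Y = - q Y X" if "VF X" "VF Y" for X Y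
  proof -
    have "R4 (F l) (G l) X Y p = - R4 (F l) (G l) Y X p" if "l \<in> L" for l
      using R4_34[OF F(1)[OF that] F(2)[OF that] \<open>VF X\<close> \<open>VF Y\<close> p] .
    then show ?thesis unfolding q by (simp add: sum_negf)
  qed
  let ?\<tau> = "\<lambda>i j. torsion A nabla (E i) (E j)"
  \<comment> \<open>The J in the second factor is essential: contracted with t itself, the sum over
    i would be a multiple of q(\<tau>, \<tau>), which is 0 by skewness of \<open>q\<close>. With J
    it becomes a Ricci term.\<close>
  define s where "s i j k = q (E i) (?\<tau> j k) * t (fJ (E i)) (E j) (E k) p" for i j k
  \<comment> \<open>Parseval's formula in the first slot. The sign from <\<tau>, J(E i)> = -
    <J\<tau>, E i> cancels the one from the skewness of \<open>q\<close>.\<close>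
  have s1: "\<kappa> * (\<Sum>i\<in>I. s i j k) = q (?\<tau> j k) (fJ (?\<tau> j k))" if "j \<in> I" "k \<in> I" for j k
  proof -
    have "s i j k = q (?\<tau> j k) (E i) * ip (fJ (?\<tau> j k)) (E i) p" if "i \<in> I" for i
      using q_skew[of "E i" "?\<tau> j k"] E p \<open>j \<in> I\<close> \<open>k \<in> I\<close> that t_J12[of "E i" "E j" "E k" p]
        t_J23[of "E i" "E j" "E k" p] t_skew12[of "E i" "E j" "fJ (E k)" p] t_skew23[of "E j" "E i" "fJ (E k)" p]
        t_J23[of "E j" "E k" "E i" p] ip_J[of "?\<tau> j k" "E i" p]
      by (simp add: s_def t_def)
    then have "(\<Sum>i\<in>I. s i j k) = (\<Sum>i\<in>I. q (?\<tau> j k) (E i) * ip (fJ (?\<tau> j k)) (E i) p)" by simp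
    then show ?thesis using q_parseval[of "?\<tau> j k" "fJ (?\<tau> j k)"] E that by simp
  qed
  \<comment> \<open>t(Ja, b, c) is invariant under cyclic permutation of a, b, c, so it factors out
    and leaves \<open>qt\<close>.\<close>
  have cyc: "s i j k + s j k i + s k i j = 0" if "i \<in> I" "j \<in> I" "k \<in> I" for i j k
  proof -
    note v = E[OF that(1)] E[OF that(2)] E[OF that(3)] p
    have "t (fJ (E j)) (E k) (E i) p = t (fJ (E i)) (E j) (E k) p"
      "t (fJ (E k)) (E i) (E j) p = t (fJ (E i)) (E j) (E k) p"
      using v t_J12[of "E j" "E k" "E i" p] t_J23[of "E j" "E k" "E i" p] t_skew23[of "E j" "E k" "fJ (E i)" p]
        t_skew12[of "E j" "fJ (E i)" "E k" p] t_J12[of "E k" "E i" "E j" p] t_skew12[of "E k" "fJ (E i)" "E j" p]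
        t_skew23[of "fJ (E i)" "E k" "E j" p]
      by simp_all
    then have "s i j k + s j k i + s k i j = (q (E i) (?\<tau> j k) + q (E j) (?\<tau> k i) + q (E k) (?\<tau> i j)) *
        t (fJ (E i)) (E j) (E k) p"
      by (simp add: s_def algebra_simps)
    then show ?thesis using qt[OF v(1,2,3)] by simp
  qed
  have swap: "(\<Sum>i\<in>I. \<Sum>j\<in>I. \<Sum>k\<in>I. h i j k) = (\<Sum>j\<in>I. \<Sum>k\<in>I. \<Sum>i\<in>I. h i j k)"
    for h :: "_ \<Rightarrow> _ \<Rightarrow> _ \<Rightarrow> real"
    by (subst sum.swap) (rule sum.cong[OF refl sum.swap])
  have "0 = (\<Sum>i\<in>I. \<Sum>j\<in>I. \<Sum>k\<in>I. s i j k + s j k i + s k i j)"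
    by (intro sum.neutral[symmetric] ballI) (use cyc in auto)
  also have "\<dots> = (\<Sum>i\<in>I. \<Sum>j\<in>I. \<Sum>k\<in>I. s i j k) + (\<Sum>i\<in>I. \<Sum>j\<in>I. \<Sum>k\<in>I. s j k i) +
      (\<Sum>i\<in>I. \<Sum>j\<in>I. \<Sum>k\<in>I. s k i j)"
    by (simp only: sum.distrib)
  also have "\<dots> = 3 * (\<Sum>j\<in>I. \<Sum>k\<in>I. \<Sum>i\<in>I. s i j k)"
    using swap[of s] swap[of "\<lambda>i j k. s j k i"] swap[of "\<lambda>k i j. s k i j"] swap[of "\<lambda>j k i. s k i j"] by argo
  finally have "(\<Sum>j\<in>I. \<Sum>k\<in>I. \<Sum>i\<in>I. s i j k) = 0" by simp
  then have "0 = (\<Sum>j\<in>I. \<Sum>k\<in>I. \<epsilon> * (\<kappa> * (\<Sum>i\<in>I. s i j k)))"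
    by (simp add: sum_distrib_left[symmetric])
  also have "\<dots> = (\<Sum>j\<in>I. \<Sum>k\<in>I. \<epsilon> * q (?\<tau> j k) (fJ (?\<tau> j k)))"
    using s1 by simp
  finally have sum0: "(\<Sum>j\<in>I. \<Sum>k\<in>I. \<epsilon> * q (?\<tau> j k) (fJ (?\<tau> j k))) = 0" by simp
  have nonneg: "\<epsilon> * q X (fJ X) \<ge> 0" if "VF X" for X
  proof (cases "X p = vzero")
    case True
    then have "ip X Y p = 0" if "VF Y" for Y using g_zero[OF vf_tangent[OF that p]] by (simp add: ip_def)
    then have "q (fJ X) X = 0"
      unfolding q R4_def using F p \<open>VF X\<close> by (intro sum.neutral) (simp add: ip_sym[of _ X])
    then show ?thesis using q_skew[of X "fJ X"] that by simp
  qed (use def[OF that] in simp)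
  have \<tau>0: "?\<tau> j k p = vzero" if "j \<in> I" "k \<in> I" for j k
  proof -
    have "(\<Sum>k\<in>I. \<epsilon> * q (?\<tau> j k) (fJ (?\<tau> j k))) = 0"
      using sum0 that nonneg E I by (subst (asm) sum_nonneg_eq_0_iff) (auto intro!: sum_nonneg)
    then have "\<epsilon> * q (?\<tau> j k) (fJ (?\<tau> j k)) = 0"
      using that nonneg E I by (subst (asm) sum_nonneg_eq_0_iff) auto
    then show ?thesis using def[of "?\<tau> j k"] E that by fastforce
  qed
  \<comment> \<open>From the frame to all fields, one slot at a time, by Parseval's formula and
    skewness.\<close>
  have t2: "t (E i) (E j) Y p = 0" if "i \<in> I" "j \<in> I" "VF Y" for i j Y
    using \<tau>0[OF that(1,2)] g_zero[OF vf_tangent[OF that(3) p]] by (simp add: t_def ip_def)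
  have t1: "t Y (E i) X p = 0" if "i \<in> I" "VF X" "VF Y" for i X Y
  proof -
    have "t Y (E i) (E j) p = 0" if "j \<in> I" for j
      using t2[OF \<open>i \<in> I\<close> that \<open>VF Y\<close>] t_skew12[of Y "E i" "E j" p] t_skew23[of "E i" Y "E j" p]
        E[OF that] E[OF \<open>i \<in> I\<close>] \<open>VF Y\<close> p by simp
    then show ?thesis using parseval[of "torsion A nabla Y (E i)" X] that E by (simp add: t_def)
  qed
  have "t X Y (E i) p = 0" if "i \<in> I" for i
    using t1[OF that, of Y X] t_skew23[of X Y "E i" p] X E[OF that] p by simp
  then show ?thesis using parseval[of "torsion A nabla X Y" Z] X by (simp add: t_def)
qed

end

section \<open>The Ricci form in a unitary frame\<close>

locale frame_region = nk_region A J g U nabla D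
  for A :: "('m::{t2_space,second_countable_topology}, 'e::euclidean_space) chart set"
    and J g U nabla D +
  fixes n :: nat and e :: "nat \<Rightarrow> ('m, complex) field" and p :: 'm
  assumes frame: "unitary_frame n A J g U e" and p: "p \<in> U"
begin

definition u :: "nat \<Rightarrow> ('m, real) field" where "u l = re_field (e l)"
definition v :: "nat \<Rightarrow> ('m, real) field" where "v l = im_field (e l)"

lemmas frame' = frame[unfolded unitary_frame_def]

lemma e_10: "l < n \<Longrightarrow> field_10 A J U (e l)"
  using conjunct1[OF frame'] by simp

lemma vf_uv [simp]: "l < n \<Longrightarrow> VF (u l)" "l < n \<Longrightarrow> VF (v l)"
  using e_10 unfolding field_10_def complex_vfield_def u_def v_def by simp_all

lemma v_eq: "l < n \<Longrightarrow> v l p = fscale (-1) (fJ (u l)) p"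
proof -
  assume "l < n"
  then have "e l p \<in> T10 A J p" using e_10 p unfolding field_10_def by simp
  then have "endo_C J p (e l p) f = vscale \<i> (e l p) f" for f by (simp add: T10_def)
  then have "Complex (fJ (u l) p f) (fJ (v l) p f) = \<i> * e l p f" for f
    by (simp add: endo_C_def complex_vec_def fJ_def u_def v_def re_field_def im_field_def vscale_def)
  then have "fJ (u l) p f = - v l p f" for f
    by (simp add: complex_eq_iff v_def im_field_def im_vec_def)
  then show ?thesis by (auto simp: fscale_def vscale_def)
qed

text \<open>Unitarity reads |u|^2 + |v|^2 = 1 with v = - Ju, so both parts have squared length 1/2
  at p. This is the origin of the factor 2 in \<open>parseval\<close>.\<close>

lemma ip_uu:
  assumes "i < n" "j < n"
  shows "ip (u i) (u j) p = (if i = j then 1 / 2 else 0)" and "ip (u i) (fJ (u j)) p = 0"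
proof -
  have v: "ip X (v l) p = - ip X (fJ (u l)) p" "ip (v l) X p = - ip (fJ (u l)) X p" if "l < n" "VF X" for l X
    using ip_cong2[of "v l" p "fscale (-1) (fJ (u l))" X] ip_cong1[of "v l" p "fscale (-1) (fJ (u l))" X]
      v_eq that p by (simp_all add: ip_scale1 ip_scale2)
  have "metric_C g p (e i p) (cnj_field (e j) p) = (if i = j then 1 else 0)"
    using conjunct2[OF conjunct2[OF frame']] p assms by simp
  moreover have "re_vec (cnj_field (e j) p) = u j p" "im_vec (cnj_field (e j) p) = fscale (-1) (v j) p"
    by (auto simp: cnj_field_def re_vec_def im_vec_def u_def v_def re_field_def im_field_def fscale_def vscale_def)
  moreover have "re_vec (e i p) = u i p" "im_vec (e i p) = v i p"
    by (simp_all add: u_def v_def re_field_def im_field_def)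
  ultimately have "Complex (ip (u i) (u j) p - ip (v i) (fscale (-1) (v j)) p)
      (ip (u i) (fscale (-1) (v j)) p + ip (v i) (u j) p) = (if i = j then 1 else 0)"
    unfolding metric_C_def ip_def by simp
  then have "ip (u i) (u j) p + ip (fJ (u i)) (fJ (u j)) p = (if i = j then 1 else 0)"
    "ip (u i) (fJ (u j)) p - ip (fJ (u i)) (u j) p = 0"
    using assms p by (simp_all add: ip_scale2 v complex_eq_iff split: if_splits)
  moreover have "ip (fJ (u i)) (fJ (u j)) p = ip (u i) (u j) p"
    using herm[OF vf_tangent[OF vf_uv(1)[OF assms(1)] p] vf_tangent[OF vf_uv(1)[OF assms(2)] p]]
    by (simp add: ip_def fJ_def)
  ultimately show "ip (u i) (u j) p = (if i = j then 1 / 2 else 0)" "ip (u i) (fJ (u j)) p = 0"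
    using ip_J[of "u i" "u j" p] assms p by (simp_all split: if_splits)
qed

text \<open>Expand X - iJX in the frame and separate real and imaginary parts. The same coefficients
  are later inserted in the Ricci form.\<close>

lemma expand:
  assumes "VF X"
  obtains c :: "nat \<Rightarrow> complex" where "\<forall>f. X p f = (\<Sum>i<n. Re (c i) * u i p f + - Im (c i) * v i p f)"
    and "\<forall>f. fscale (-1) (fJ X) p f = (\<Sum>i<n. Re (c i) * v i p f + Im (c i) * u i p f)"
proof -
  have "complex_vec (X p) (fscale (-1) (fJ X) p) \<in> T10 A J p" using type_10_vec assms p by blast
  then obtain c where c: "complex_vec (X p) (fscale (-1) (fJ X) p) = (\<lambda>f. \<Sum>i<n. c i * e i p f)"
    using conjunct1[OF conjunct2[OF frame']] p by blast
  have "Complex (X p f) (fscale (-1) (fJ X) p f) = (\<Sum>i<n. c i * e i p f)" for f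
    using fun_cong[OF c, of f] by (simp add: complex_vec_def)
  then have "X p f = Re (\<Sum>i<n. c i * e i p f)" "fscale (-1) (fJ X) p f = Im (\<Sum>i<n. c i * e i p f)" for f
    by (metis complex.sel)+
  then show thesis
    by (intro that[of c])
      (simp_all add: u_def v_def re_field_def im_field_def re_vec_def im_vec_def)
qed

definition E :: "nat \<times> bool \<Rightarrow> ('m, real) field" where "E i = (if snd i then u (fst i) else fJ (u (fst i)))"
definition I :: "(nat \<times> bool) set" where "I = {..<n} \<times> UNIV"

lemma sum_I: "(\<Sum>i\<in>I. h i) = (\<Sum>l<n. h (l, True) + h (l, False))"
  unfolding I_def sum.cartesian_product' by (simp add: UNIV_bool add.commute)

lemma vf_E: "i \<in> I \<Longrightarrow> VF (E i)"
  by (auto simp: I_def E_def)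

lemma parseval:
  assumes X: "VF X" and Y: "VF Y"
  shows "ip X Y p = 2 * (\<Sum>i\<in>I. ip X (E i) p * ip Y (E i) p)"
proof -
  obtain c where "\<forall>f. X p f = (\<Sum>i<n. Re (c i) * u i p f + - Im (c i) * v i p f)"
    using expand[OF X] by blast
  then have c: "X p f = (\<Sum>i<n. Re (c i) * u i p f + Im (c i) * fJ (u i) p f)" for f
    by (simp add: v_eq fscale_def vscale_def)
  have e: "ip Z X p = (\<Sum>i<n. Re (c i) * ip Z (u i) p + Im (c i) * ip Z (fJ (u i)) p)" if "VF Z" for Z
    by (rule ip_sum) (use that X p c in auto)
  have JJ: "ip (fJ (u j)) (fJ (u i)) p = ip (u j) (u i) p" if "j < n" "i < n" for i j
    using herm[OF vf_tangent[OF vf_uv(1)[OF that(1)] p] vf_tangent[OF vf_uv(1)[OF that(2)] p]]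
    by (simp add: ip_def fJ_def)
  have "ip X (u j) p = Re (c j) / 2" "ip X (fJ (u j)) p = Im (c j) / 2" if "j < n" for j
  proof -
    have "ip (u j) X p = (\<Sum>i<n. if i = j then Re (c i) / 2 else 0)"
      unfolding e[OF vf_uv(1)[OF that]] by (rule sum.cong) (use that in \<open>auto simp: ip_uu\<close>)
    then show "ip X (u j) p = Re (c j) / 2" using ip_sym[of X "u j" p] X that p by simp
    have "ip (fJ (u j)) X p = (\<Sum>i<n. if i = j then Im (c i) / 2 else 0)"
      unfolding e[OF vf_fJ[OF vf_uv(1)[OF that]]]
      by (rule sum.cong) (use that p in \<open>auto simp: ip_uu ip_J[of "u j" "u _"] JJ\<close>)
    then show "ip X (fJ (u j)) p = Im (c j) / 2" using ip_sym[of X "fJ (u j)" p] X that p by simp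
  qed
  note c1 = this
  have c2: "Re (c j) = 2 * ip X (u j) p" "Im (c j) = 2 * ip X (fJ (u j)) p" if "j < n" for j
    using c1[OF that] by linarith+
  have "ip X Y p = (\<Sum>i<n. Re (c i) * ip Y (u i) p + Im (c i) * ip Y (fJ (u i)) p)"
    using e[OF Y] ip_sym[OF X Y p] by simp
  also have "\<dots> = (\<Sum>i<n. 2 * (ip X (u i) p * ip Y (u i) p + ip X (fJ (u i)) p * ip Y (fJ (u i)) p))"
    by (intro sum.cong refl) (simp add: c2 algebra_simps)
  finally show ?thesis unfolding sum_I by (simp add: E_def sum_distrib_left)
qed

text \<open>Up to a constant and the insertion of J in one slot this is the Ricci form at p, see
  \<open>ricci_form\<close>.\<close>

definition q :: "('m, real) field \<Rightarrow> ('m, real) field \<Rightarrow> real" where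
  "q X Y = (\<Sum>l<n. R4 (u l) (fJ (u l)) X Y p)"

lemma q_skew: "VF X \<Longrightarrow> VF Y \<Longrightarrow> q X Y = - q Y X"
proof -
  assume "VF X" "VF Y"
  then have "R4 (u l) (fJ (u l)) X Y p = - R4 (u l) (fJ (u l)) Y X p" if "l < n" for l
    using R4_34[of "u l" "fJ (u l)" X Y p] p that by simp
  then show ?thesis by (simp add: q_def sum_negf)
qed

lemma q_sum:
  assumes "finite K" "\<And>i. i \<in> K \<Longrightarrow> VF (F i)" "\<And>i. i \<in> K \<Longrightarrow> VF (G i)" "VF Z" "VF X"
    and "\<And>f. X p f = (\<Sum>i\<in>K. a i * F i p f + b i * G i p f)"
  shows "q Z X = (\<Sum>i\<in>K. a i * q Z (F i) + b i * q Z (G i))"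
proof -
  have "q Z X = (\<Sum>l<n. \<Sum>i\<in>K. a i * R4 (u l) (fJ (u l)) Z (F i) p + b i * R4 (u l) (fJ (u l)) Z (G i) p)"
    unfolding q_def R4_def by (intro sum.cong ip_sum) (use assms p in auto)
  also have "\<dots> = (\<Sum>i\<in>K. a i * q Z (F i) + b i * q Z (G i))"
    unfolding q_def sum_distrib_left sum.distrib[symmetric] by (rule sum.swap)
  finally show ?thesis .
qed

text \<open>Pair symmetry exchanges the pair from e l with the one from e i and e j. Since R(e l,
  cnj(e l)) = 2i R(u l, J(u l)), H is 2i times the complex bilinear extension of \<open>c\<close> at
  e i and cnj(e j).\<close>

lemma curvature4_frame:
  assumes ij: "i < n" "j < n" and l: "l < n"
  defines "H \<equiv> curvature4 A g nabla (e l) (cnj_field (e l)) (e i) (cnj_field (e j)) p"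
    and "c \<equiv> \<lambda>X Y. R4 (u l) (fJ (u l)) X Y p"
  shows "Re H = 2 * (c (u i) (v j) - c (v i) (u j))" and "Im H = 2 * (c (u i) (u j) + c (v i) (v j))"
proof -
  let ?w = "fscale (-1) (v j)"
  have cnj: "re_field (cnj_field (e k)) = u k" "im_field (cnj_field (e k)) = fscale (-1) (v k)" for k
    by (auto simp: cnj_field_def re_vec_def im_vec_def u_def v_def re_field_def im_field_def fscale_def vscale_def)
  let ?C = "curvature A nabla (e i) (cnj_field (e j)) (e l) p"
  let ?R = "fsub (fsub (Rm (u i) (u j) (u l)) (Rm (v i) ?w (u l))) (fadd (Rm (u i) ?w (v l)) (Rm (v i) (u j) (v l)))"
  let ?I = "fadd (fsub (Rm (u i) (u j) (v l)) (Rm (v i) ?w (v l))) (fadd (Rm (u i) ?w (u l)) (Rm (v i) (u j) (u l)))"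
  have C: "re_vec ?C = ?R p" "im_vec ?C = ?I p"
    using curvature_parts[of "e i" "cnj_field (e j)" "e l" p] ij l p
    unfolding cnj u_def[symmetric] v_def[symmetric] by simp_all
  have "re_vec (cnj_field (e l) p) = u l p" "im_vec (cnj_field (e l) p) = fscale (-1) (v l) p"
    using fun_cong[OF cnj(1), of l p] fun_cong[OF cnj(2), of l p] by (simp_all add: re_field_def im_field_def)
  then have H: "Re H = ip ?R (u l) p + ip ?I (v l) p" "Im H = ip ?I (u l) p - ip ?R (v l) p"
    using ij l p ip_scale2[of "v l" ?I p "-1"] ip_scale2[of "v l" ?R p "-1"]
    unfolding H_def curvature4_def metric_C_def C ip_def by simp_all
  have vl: "R4 X Y (u l) (v l) p = - c X Y" if "VF X" "VF Y" for X Y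
    using ip_cong2[of "v l" p "fscale (-1) (fJ (u l))" "Rm X Y (u l)"] v_eq[OF l] that l p
      R4_pair_sym[of X Y "u l" "fJ (u l)" p]
    by (simp add: R4_def c_def ip_scale2)
  have zero: "R4 X Y Z Z p = 0" if "VF X" "VF Y" "VF Z" for X Y Z
    using R4_34[OF that that(3) p] by simp
  have vu: "R4 X Y (v l) (u l) p = c X Y" if "VF X" "VF Y" for X Y
    using R4_34[of X Y "v l" "u l" p] vl[OF that] that l p by simp
  have cw: "c X ?w = - c X (v j)" if "VF X" for X
    using that ij l p by (simp add: c_def R4_def ip_scale2)
  have ip: "ip (Rm X Y Z) W p = R4 X Y Z W p" for X Y Z W by (simp add: R4_def)
  have vf: "VF (u i)" "VF (u j)" "VF (v i)" "VF (v j)" "VF (u l)" "VF (v l)" "VF ?w" using ij l by auto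
  show "Re H = 2 * (c (u i) (v j) - c (v i) (u j))" "Im H = 2 * (c (u i) (u j) + c (v i) (v j))"
    unfolding H using vf p by (simp_all add: ip_sub1 ip_add1 ip zero vl vu cw)
qed

lemma first_ricci_frame:
  assumes ij: "i < n" "j < n"
  shows "Re (first_ricci n A g nabla e p i j) = 2 * (q (u i) (v j) - q (v i) (u j))"
    and "Im (first_ricci n A g nabla e p i j) = 2 * (q (u i) (u j) + q (v i) (v j))"
  using ij by (simp_all add: first_ricci_def q_def curvature4_frame sum_subtractf sum.distrib sum_distrib_left)

text \<open>The real part of each summand is twice the symmetrization of \<open>P\<close>, and
  \<open>P\<close> sums to q X (- JX); hence the 4 and the sign.\<close>

lemma ricci_form:
  assumes "VF X" and c: "\<And>f. X p f = (\<Sum>i<n. Re (c i) * u i p f + - Im (c i) * v i p f)"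
    "\<And>f. fscale (-1) (fJ X) p f = (\<Sum>i<n. Re (c i) * v i p f + Im (c i) * u i p f)"
  shows "Re (\<Sum>i<n. \<Sum>j<n. first_ricci n A g nabla e p i j * c i * cnj (c j)) = - 4 * q X (fJ X)"
proof -
  let ?Y = "fscale (-1) (fJ X)"
  define P where "P i j = Re (c i) * Re (c j) * q (u i) (v j) + Re (c i) * Im (c j) * q (u i) (u j)
    - Im (c i) * Re (c j) * q (v i) (v j) - Im (c i) * Im (c j) * q (v i) (u j)" for i j
  have T: "Re (first_ricci n A g nabla e p i j * c i * cnj (c j)) = 2 * (P i j + P j i)"
    if "i < n" "j < n" for i j
  proof -
    have "q (v i) (u j) = - q (u j) (v i)" "q (v j) (u i) = - q (u i) (v j)"
      "q (u j) (u i) = - q (u i) (u j)" "q (v j) (v i) = - q (v i) (v j)"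
      using that by (auto intro: q_skew)
    moreover have "Re (h * a * cnj b) = Re h * (Re a * Re b + Im a * Im b) - Im h * (Im a * Re b - Re a * Im b)"
      for h a b by (simp add: algebra_simps)
    ultimately show ?thesis
      unfolding P_def using that by (simp only: first_ricci_frame) (simp add: algebra_simps)
  qed
  have R: "q Z ?Y = (\<Sum>j<n. Re (c j) * q Z (v j) + Im (c j) * q Z (u j))" if "VF Z" for Z
    by (rule q_sum) (use that assms in auto)
  have "q ?Y X = (\<Sum>i<n. Re (c i) * q ?Y (u i) + - Im (c i) * q ?Y (v i))"
    by (rule q_sum) (use assms in auto)
  then have "q X ?Y = (\<Sum>i<n. Re (c i) * q (u i) ?Y - Im (c i) * q (v i) ?Y)"
    using q_skew[of X ?Y] assms(1) by (simp add: q_skew[of ?Y "u _"] q_skew[of ?Y "v _"] sum_negf[symmetric])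
  also have "\<dots> = (\<Sum>i<n. \<Sum>j<n. P i j)"
    by (intro sum.cong refl)
      (simp add: R P_def sum_distrib_left sum_subtractf[symmetric] algebra_simps)
  finally have "q X ?Y = (\<Sum>i<n. \<Sum>j<n. P i j)" .
  moreover have "(\<Sum>i<n. \<Sum>j<n. P j i) = (\<Sum>i<n. \<Sum>j<n. P i j)" by (rule sum.swap)
  moreover have "Re (\<Sum>i<n. \<Sum>j<n. first_ricci n A g nabla e p i j * c i * cnj (c j)) =
      (\<Sum>i<n. \<Sum>j<n. 2 * (P i j + P j i))"
    unfolding Re_sum by (intro sum.cong refl) (use T in auto)
  ultimately have "Re (\<Sum>i<n. \<Sum>j<n. first_ricci n A g nabla e p i j * c i * cnj (c j)) = 4 * q X ?Y"
    by (simp add: sum_distrib_left[symmetric] sum.distrib)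
  moreover have "q X ?Y = - q X (fJ X)"
  proof -
    have "R4 (u l) (fJ (u l)) X ?Y p = - R4 (u l) (fJ (u l)) X (fJ X) p" if "l < n" for l
      using that assms(1) p by (simp add: R4_def ip_scale2)
    then show ?thesis by (simp add: q_def sum_negf)
  qed
  ultimately show ?thesis by simp
qed

text \<open>The factor \<epsilon> will be 1 or -1 and treats both signs of the Ricci curvature at
  once; the minus sign is that of \<open>ricci_form\<close>.\<close>

lemma q_definite:
  assumes "pos_definite n (\<lambda>i j. \<epsilon> * first_ricci n A g nabla e p i j)" and "VF X" "X p \<noteq> vzero" "\<epsilon> \<in> \<real>"
  shows "- Re \<epsilon> * q X (fJ X) > 0"
proof -
  obtain c where c: "\<forall>f. X p f = (\<Sum>i<n. Re (c i) * u i p f + - Im (c i) * v i p f)"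
    "\<forall>f. fscale (-1) (fJ X) p f = (\<Sum>i<n. Re (c i) * v i p f + Im (c i) * u i p f)"
    using expand[OF assms(2)] by blast
  have "\<exists>i<n. c i \<noteq> 0"
  proof (rule ccontr)
    assume "\<not> ?thesis"
    then have "X p f = 0" for f using c(1) by simp
    then show False using assms(3) by (auto simp: vzero_def)
  qed
  then have "0 < Re (\<Sum>i<n. \<Sum>j<n. \<epsilon> * first_ricci n A g nabla e p i j * c i * cnj (c j))"
    using assms(1) unfolding pos_definite_def by blast
  also have "(\<Sum>i<n. \<Sum>j<n. \<epsilon> * first_ricci n A g nabla e p i j * c i * cnj (c j)) =
      \<epsilon> * (\<Sum>i<n. \<Sum>j<n. first_ricci n A g nabla e p i j * c i * cnj (c j))"
    by (simp add: sum_distrib_left mult.assoc)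
  also have "Re \<dots> = Re \<epsilon> * Re (\<Sum>i<n. \<Sum>j<n. first_ricci n A g nabla e p i j * c i * cnj (c j))"
    using assms(4) by (auto elim!: Reals_cases)
  finally show ?thesis unfolding ricci_form[OF assms(2) c[rule_format]] by simp
qed

theorem torsion_zero:
  assumes "pos_definite n (first_ricci n A g nabla e p) \<or> neg_definite n (first_ricci n A g nabla e p)"
    and "VF X" "VF Y" "VF Z"
  shows "t X Y Z p = 0"
proof -
  obtain \<epsilon> :: complex where \<epsilon>: "\<epsilon> \<in> \<real>" "pos_definite n (\<lambda>i j. \<epsilon> * first_ricci n A g nabla e p i j)"
    using assms(1) that[of 1] that[of "-1"] unfolding neg_definite_def by auto
  have fin: "finite I" by (simp add: I_def)
  show ?thesis
    by (rule torsion_zero_of_definite[OF p fin vf_E parseval finite_lessThan[of n], of u "\<lambda>l. fJ (u l)" q "- Re \<epsilon>"])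
      (use q_definite[OF \<epsilon>(2) _ _ \<epsilon>(1)] assms q_def in auto)
qed

end

section \<open>Propagation of the vanishing of the torsion\<close>

text \<open>Gronwall's argument: for the sum of squares N, the bound on y' and the Cauchy-Schwarz
  inequality give N' \<le> K N with K = 2 M card Q, so exp(-K s) N is nonincreasing and starts at
  0.\<close>

lemma linear_ode_zero:
  fixes y y' :: "'i \<Rightarrow> real \<Rightarrow> real"
  assumes Q: "finite Q"
    and deriv: "\<And>a s. a \<in> Q \<Longrightarrow> 0 \<le> s \<Longrightarrow> s \<le> 1 \<Longrightarrow> (y a has_real_derivative y' a s) (at s)"
    and bound: "\<And>a s. a \<in> Q \<Longrightarrow> 0 \<le> s \<Longrightarrow> s \<le> 1 \<Longrightarrow> \<bar>y' a s\<bar> \<le> M * (\<Sum>b\<in>Q. \<bar>y b s\<bar>)"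
    and M: "M \<ge> 0" and init: "\<And>a. a \<in> Q \<Longrightarrow> y a 0 = 0" and a: "a \<in> Q"
  shows "y a 1 = 0"
proof -
  define N where "N s = (\<Sum>a\<in>Q. (y a s)\<^sup>2)" for s
  define K where "K = 2 * M * real (card Q)"
  define F where "F s = exp (- K * s) * N s" for s
  have "\<exists>z. (F has_real_derivative z) (at s) \<and> z \<le> 0" if s: "0 \<le> s" "s \<le> 1" for s
  proof -
    let ?N' = "\<Sum>a\<in>Q. 2 * (y a s) * y' a s"
    have "(N has_real_derivative ?N') (at s)"
      unfolding N_def using deriv[OF _ s] by (auto intro!: derivative_eq_intros simp: mult_ac)
    then have F: "(F has_real_derivative exp (- K * s) * (?N' - K * N s)) (at s)"
      unfolding F_def by (auto intro!: derivative_eq_intros simp: algebra_simps)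
    have "?N' \<le> (\<Sum>a\<in>Q. 2 * \<bar>y a s\<bar> * (M * (\<Sum>b\<in>Q. \<bar>y b s\<bar>)))"
    proof (rule sum_mono)
      fix a assume "a \<in> Q"
      have "y a s * y' a s \<le> \<bar>y a s\<bar> * \<bar>y' a s\<bar>" by (metis abs_ge_self abs_mult)
      also have "\<dots> \<le> \<bar>y a s\<bar> * (M * (\<Sum>b\<in>Q. \<bar>y b s\<bar>))"
        by (rule mult_left_mono[OF bound[OF \<open>a \<in> Q\<close> s]]) simp
      finally show "2 * y a s * y' a s \<le> 2 * \<bar>y a s\<bar> * (M * (\<Sum>b\<in>Q. \<bar>y b s\<bar>))" by simp
    qed
    also have "\<dots> = 2 * M * (\<Sum>b\<in>Q. \<bar>y b s\<bar>)\<^sup>2"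
      by (simp add: sum_distrib_right[symmetric] sum_distrib_left[symmetric] power2_eq_square mult_ac)
    also have "\<dots> \<le> 2 * M * ((\<Sum>b\<in>Q. \<bar>y b s\<bar>\<^sup>2) * real (card Q))"
      by (rule mult_left_mono[OF sum_squared_le_sum_of_squares]) (use M in simp)
    also have "\<dots> = K * N s" by (simp add: K_def N_def)
    finally show ?thesis using F by (intro exI conjI) (auto simp: mult_nonneg_nonpos)
  qed
  then have "F 1 \<le> F 0" using DERIV_nonpos_imp_nonincreasing[of 0 1 F] by auto
  moreover have "F 0 = 0" using init by (simp add: F_def N_def)
  ultimately have "N 1 \<le> 0" by (simp add: F_def mult_le_0_iff)
  then have "N 1 = 0" unfolding N_def by (meson antisym sum_nonneg zero_le_power2)
  then show ?thesis using a Q unfolding N_def by (simp add: sum_nonneg_eq_0_iff)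
qed

context nk_region
begin

text \<open>Skewness moves X into the slot of the inner product, where \<open>ip_sum\<close> expands
  it in the coordinate fields.\<close>

lemma t_coord1:
  assumes c: "c \<in> A" "U \<subseteq> fst c" and v: "VF X" "VF Y" "VF Z" and p: "p \<in> U"
  shows "t X Y Z p = (\<Sum>b\<in>Basis. X p (\<lambda>q. snd c q \<bullet> b) * t (chart_vec A c b) Y Z p)"
proof -
  have E: "VF (chart_vec A c b)" for b
    by (rule vfield_subset[OF chart_vec_vfield[OF c(1)] c(2)])
  have rot: "t X Y Z p = ip (torsion A nabla Y Z) X p" if "VF X" for X
    using t_skew12[of X Y Z p] t_skew23[of Y X Z p] that v p by (simp add: t_def)
  let ?E = "chart_vec A c" and ?a = "\<lambda>b. X p (\<lambda>q. snd c q \<bullet> b)"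
  have x: "X p f = (\<Sum>b\<in>Basis. ?a b * ?E b p f + 0 * ?E b p f)" for f
    using fun_cong[OF tangent_coords[OF c(1) subsetD[OF c(2) p] vf_tangent[OF v(1) p]], of f] by simp
  have "ip (torsion A nabla Y Z) X p = (\<Sum>b\<in>Basis. ?a b * ip (torsion A nabla Y Z) (?E b) p +
      0 * ip (torsion A nabla Y Z) (?E b) p)"
    by (rule ip_sum[where a = ?a and b = "\<lambda>_. 0" and F = ?E and G = ?E,
          OF finite_Basis E E vf_tor[OF v(2,3)] p v(1) x])
  then show ?thesis using rot v(1) E by simp
qed

lemma t_zero_coord:
  assumes c: "c \<in> A" "U \<subseteq> fst c" and v: "VF X" "VF Y" "VF Z" and p: "p \<in> U"
    and zero: "\<And>i j k. i \<in> Basis \<Longrightarrow> j \<in> Basis \<Longrightarrow> k \<in> Basis \<Longrightarrow>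
      t (chart_vec A c i) (chart_vec A c j) (chart_vec A c k) p = 0"
  shows "t X Y Z p = 0"
proof -
  have E: "VF (chart_vec A c b)" for b
    by (rule vfield_subset[OF chart_vec_vfield[OF c(1)] c(2)])
  have 1: "t X (chart_vec A c j) (chart_vec A c k) p = 0" if "j \<in> Basis" "k \<in> Basis" "VF X" for j k X
    using t_coord1[OF c that(3) E E p] zero that by simp
  have 2: "t X Y (chart_vec A c k) p = 0" if "k \<in> Basis" "VF X" "VF Y" for k X Y
    using t_coord1[OF c that(3,2) E p] t_skew12[OF that(2,3) E p] t_skew12[OF E that(2) E p] 1[OF _ that(1,2)]
    by simp
  show ?thesis
    using t_coord1[OF c v(3,1,2) p] t_skew12[OF v(3,1,2) p] t_skew23[OF v(1,3,2) p]
      t_skew12[OF E v(1,2) p] t_skew23[OF v(1) E v(2) p] 2[OF _ v(1,2)] v by simp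
qed

text \<open>\<open>torsion_parallel\<close> read in coordinates. Expanding the covariant derivatives
  by \<open>t_coord1\<close> turns it into a homogeneous linear system for the components of the
  torsion.\<close>

lemma t_derivative_chart:
  assumes c: "c \<in> A" "U = fst c" and v: "VF X" "VF Y" "VF Z" and p: "p \<in> U"
  shows "frechet_derivative (t X Y Z \<circ> chart_inv c) (at (snd c p)) w =
    (\<Sum>l\<in>Basis. (w \<bullet> l) * (t (nabla (chart_vec A c l) X) Y Z p + t X (nabla (chart_vec A c l) Y) Z p +
      t X Y (nabla (chart_vec A c l) Z) p))"
proof -
  have E: "VF (chart_vec A c b)" for b using chart_vec_vfield[OF c(1)] c(2) by simp
  have "frechet_derivative (t X Y Z \<circ> chart_inv c) (at (snd c p)) w = chart_vec A c w p (t X Y Z)"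
    using smooth_nearI[OF open_U p t_smooth[OF v]] by (simp add: chart_vec_def)
  also have "\<dots> = chart_vec A c (\<Sum>l\<in>Basis. (w \<bullet> l) *\<^sub>R l) p (t X Y Z)"
    by (simp only: euclidean_representation)
  also have "\<dots> = (\<Sum>l\<in>Basis. (w \<bullet> l) * chart_vec A c l p (t X Y Z))"
    by (rule chart_vec_linear(4)) (use c p in auto)
  finally show ?thesis using torsion_parallel[OF E v p] by simp
qed

text \<open>The bounded quantities are the Christoffel symbols of nabla in the chart. The sum of
  their absolute values is continuous on K, which gives one bound for all indices.\<close>

lemma christoffel_bound:
  assumes c: "c \<in> A" "U = fst c" and K: "compact K" "K \<subseteq> snd c ` U"
  obtains C where "C \<ge> 0" and "\<And>l i m q. l \<in> Basis \<Longrightarrow> i \<in> Basis \<Longrightarrow> m \<in> Basis \<Longrightarrow> q \<in> U \<Longrightarrow> snd c q \<in> K \<Longrightarrow>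
    \<bar>nabla (chart_vec A c l) (chart_vec A c i) q (\<lambda>r. snd c r \<bullet> m)\<bar> \<le> C"
proof -
  define G where "G l i m q = nabla (chart_vec A c l) (chart_vec A c i) q (\<lambda>r. snd c r \<bullet> m)" for l i m q
  define S where "S x = (\<Sum>l\<in>Basis. \<Sum>i\<in>Basis. \<Sum>m\<in>Basis. \<bar>(G l i m \<circ> chart_inv c) x\<bar>)" for x
  have E: "VF (chart_vec A c b)" for b using chart_vec_vfield[OF c(1)] c(2) by simp
  have "smooth_fun A U (G l i m)" for l i m
    unfolding G_def using vfield_smooth[OF open_U vf_D[OF E E]] smooth_fun_coord[OF c(1)] c(2) by simp
  then have "continuous_on (snd c ` U) (G l i m \<circ> chart_inv c)" for l i m
    using smooth_on_continuous[OF smooth_funD[OF _ c(1), of U "G l i m"]] c(2) by simp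
  then have "continuous_on K (G l i m \<circ> chart_inv c)" for l i m
    using K(2) continuous_on_subset by blast
  then have "continuous_on K S"
    unfolding S_def by (intro continuous_on_sum continuous_on_rabs) auto
  then have "bounded (S ` K)" using K(1) compact_continuous_image compact_imp_bounded by blast
  then obtain C where C: "\<And>x. x \<in> K \<Longrightarrow> \<bar>S x\<bar> \<le> C" unfolding bounded_iff by auto
  show thesis
  proof (rule that[of "\<bar>C\<bar>"])
    fix l i m :: 'e and q assume b: "l \<in> Basis" "i \<in> Basis" "m \<in> Basis" and q: "q \<in> U" "snd c q \<in> K"
    have "\<bar>G l i m q\<bar> \<le> (\<Sum>m\<in>Basis. \<bar>G l i m q\<bar>)"
      by (rule member_le_sum[of m Basis "\<lambda>m. \<bar>G l i m q\<bar>"]) (use b in auto)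
    also have "\<dots> \<le> (\<Sum>i\<in>Basis. \<Sum>m\<in>Basis. \<bar>G l i m q\<bar>)"
      by (rule member_le_sum[of i Basis "\<lambda>i. \<Sum>m\<in>Basis. \<bar>G l i m q\<bar>"]) (use b in \<open>auto intro: sum_nonneg\<close>)
    also have "\<dots> \<le> (\<Sum>l\<in>Basis. \<Sum>i\<in>Basis. \<Sum>m\<in>Basis. \<bar>G l i m q\<bar>)"
      by (rule member_le_sum[of l Basis "\<lambda>l. \<Sum>i\<in>Basis. \<Sum>m\<in>Basis. \<bar>G l i m q\<bar>"])
        (use b in \<open>auto intro!: sum_nonneg\<close>)
    also have "\<dots> = S (snd c q)" using q c by (simp add: S_def)
    also have "\<dots> \<le> \<bar>C\<bar>" using C[OF q(2)] by linarith
    finally show "\<bar>nabla (chart_vec A c l) (chart_vec A c i) q (\<lambda>r. snd c r \<bullet> m)\<bar> \<le> \<bar>C\<bar>"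
      by (simp add: G_def)
  qed simp
qed

text \<open>Along the straight segment between the two coordinate points the components of t solve a
  homogeneous linear system with bounded coefficients and start at 0. A closed ball is convex, so it
  contains the segment, and compact, so the bound applies.\<close>

lemma t_zero_ball:
  assumes c: "c \<in> A" "U = fst c" and K: "cball z r \<subseteq> snd c ` U"
    and p: "p \<in> U" "snd c p \<in> cball z r" and q: "q \<in> U" "snd c q \<in> cball z r"
    and zero: "\<And>i j k. i \<in> Basis \<Longrightarrow> j \<in> Basis \<Longrightarrow> k \<in> Basis \<Longrightarrow>
      t (chart_vec A c i) (chart_vec A c j) (chart_vec A c k) p = 0"
    and ijk: "i \<in> Basis" "j \<in> Basis" "k \<in> Basis"
  shows "t (chart_vec A c i) (chart_vec A c j) (chart_vec A c k) q = 0"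
proof -
  let ?E = "chart_vec A c"
  let ?B = "Basis :: 'e set"
  define T where "T a = t (?E (fst a)) (?E (fst (snd a))) (?E (snd (snd a)))" for a
  define Q where "Q = ?B \<times> ?B \<times> ?B"
  define w where "w = snd c q - snd c p"
  define x where "x s = snd c p + s *\<^sub>R w" for s
  define y where "y a s = (T a \<circ> chart_inv c) (x s)" for a s
  define y' where "y' a s = frechet_derivative (T a \<circ> chart_inv c) (at (x s)) w" for a s
  have E: "VF (?E b)" for b using chart_vec_vfield[OF c(1)] c(2) by simp
  obtain C where C: "C \<ge> 0" "\<And>l i m q. l \<in> Basis \<Longrightarrow> i \<in> Basis \<Longrightarrow> m \<in> Basis \<Longrightarrow> q \<in> U \<Longrightarrow> snd c q \<in> cball z r \<Longrightarrow>
    \<bar>nabla (?E l) (?E i) q (\<lambda>r. snd c r \<bullet> m)\<bar> \<le> C"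
    using christoffel_bound[OF c compact_cball K] by blast
  \<comment> \<open>Each of the three slots contributes at most \<open>C\<close> times the sum of
    all |components|; the velocity w enters through its coordinates.\<close>
  define M where "M = (\<Sum>l\<in>?B. \<bar>w \<bullet> l\<bar>) * (3 * C)"
  have M: "M \<ge> 0" unfolding M_def using C(1) by (simp add: sum_nonneg)
  have fin: "finite Q" by (simp add: Q_def)
  have x: "x s \<in> cball z r" if "0 \<le> s" "s \<le> 1" for s
  proof -
    have "x s = (1 - s) *\<^sub>R snd c p + s *\<^sub>R snd c q" by (simp add: x_def w_def algebra_simps)
    then show ?thesis using convexD[OF convex_cball p(2) q(2)] that by simp
  qed
  \<comment> \<open>Varying one index of a component runs injectively through a part of
    \<open>Q\<close>.\<close>
  have sum_sub: "(\<Sum>m\<in>?B. \<bar>T (h m) q'\<bar>) \<le> (\<Sum>b\<in>Q. \<bar>T b q'\<bar>)" if "inj_on h ?B" "h ` ?B \<subseteq> Q" for h q'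
  proof -
    have "(\<Sum>m\<in>?B. \<bar>T (h m) q'\<bar>) = (\<Sum>b\<in>h ` ?B. \<bar>T b q'\<bar>)" using that(1) by (simp add: sum.reindex)
    also have "\<dots> \<le> (\<Sum>b\<in>Q. \<bar>T b q'\<bar>)" by (rule sum_mono2[OF fin that(2)]) simp
    finally show ?thesis .
  qed
  have "y (i, j, k) 1 = 0"
  proof (rule linear_ode_zero[OF fin _ _ M])
    fix a s assume a: "a \<in> Q" and s: "0 \<le> (s::real)" "s \<le> 1"
    obtain q' where q': "q' \<in> U" "x s = snd c q'" using x[OF s] K by blast
    have sm: "smooth_fun A U (T a)" unfolding T_def by (rule t_smooth[OF E E E])
    have "(T a \<circ> chart_inv c) differentiable (at (x s))"
      using smooth_near_differentiable[OF smooth_nearI[OF open_U q'(1) sm] c(1)] q' c(2) by simp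
    then have d: "((T a \<circ> chart_inv c) has_derivative frechet_derivative (T a \<circ> chart_inv c) (at (x s))) (at (x s))"
      by (simp add: frechet_derivative_works)
    have "(x has_derivative (\<lambda>h. h *\<^sub>R w)) (at s)"
      unfolding x_def by (auto intro!: derivative_eq_intros)
    from has_derivative_compose[OF this d]
    have "(y a has_derivative (\<lambda>h. frechet_derivative (T a \<circ> chart_inv c) (at (x s)) (h *\<^sub>R w))) (at s)"
      by (simp add: y_def[abs_def])
    moreover have "frechet_derivative (T a \<circ> chart_inv c) (at (x s)) (h *\<^sub>R w) = y' a s * h" for h
      using linear_cmul[OF has_derivative_linear[OF d], of h w] by (simp add: y'_def)
    ultimately show "(y a has_real_derivative y' a s) (at s)"
      by (simp add: has_field_derivative_def)
    let ?S = "\<Sum>b\<in>Q. \<bar>T b q'\<bar>"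
    obtain i j k where ijk: "a = (i, j, k)" "i \<in> ?B" "j \<in> ?B" "k \<in> ?B" using a by (auto simp: Q_def)
    have tm: "\<bar>\<Sum>m\<in>?B. nabla (?E l) (?E i') q' (\<lambda>r. snd c r \<bullet> m) * T (h m) q'\<bar> \<le> C * ?S"
      if "l \<in> ?B" "i' \<in> ?B" "inj_on h ?B" "h ` ?B \<subseteq> Q" for l i' h
    proof -
      have "\<bar>\<Sum>m\<in>?B. nabla (?E l) (?E i') q' (\<lambda>r. snd c r \<bullet> m) * T (h m) q'\<bar> \<le>
          (\<Sum>m\<in>?B. \<bar>nabla (?E l) (?E i') q' (\<lambda>r. snd c r \<bullet> m) * T (h m) q'\<bar>)" by (rule sum_abs)
      also have "\<dots> \<le> (\<Sum>m\<in>?B. C * \<bar>T (h m) q'\<bar>)"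
        unfolding abs_mult using C(2)[OF that(1,2) _ q'(1)] x[OF s] q'(2) by (intro sum_mono mult_right_mono) auto
      also have "\<dots> \<le> C * ?S"
        unfolding sum_distrib_left[symmetric] by (rule mult_left_mono[OF sum_sub[OF that(3,4)] C(1)])
      finally show ?thesis .
    qed
    have h: "inj_on (\<lambda>m. (m, j, k)) ?B" "(\<lambda>m. (m, j, k)) ` ?B \<subseteq> Q"
      "inj_on (\<lambda>m. (i, m, k)) ?B" "(\<lambda>m. (i, m, k)) ` ?B \<subseteq> Q"
      "inj_on (\<lambda>m. (i, j, m)) ?B" "(\<lambda>m. (i, j, m)) ` ?B \<subseteq> Q"
      using ijk by (auto simp: Q_def inj_on_def)
    have tc: "t (nabla (?E l) (?E i)) (?E j) (?E k) q' =
        (\<Sum>m\<in>?B. nabla (?E l) (?E i) q' (\<lambda>r. snd c r \<bullet> m) * t (?E m) (?E j) (?E k) q')" for l i j k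
      by (rule t_coord1[OF c(1) eq_refl[OF c(2)] vf_D[OF E E] E E q'(1)])
    have t1: "\<bar>t (nabla (?E l) (?E i)) (?E j) (?E k) q'\<bar> \<le> C * ?S" if "l \<in> ?B" for l
      using tm[OF that ijk(2) h(1,2)] tc[of l i j k] by (simp add: T_def)
    \<comment> \<open>The coordinate expansion \<open>tc\<close> is for the first slot; skewness
      brings the other two slots there.\<close>
    have t2: "\<bar>t (?E i) (nabla (?E l) (?E j)) (?E k) q'\<bar> \<le> C * ?S" if "l \<in> ?B" for l
    proof -
      have "t (nabla (?E l) (?E j)) (?E i) (?E k) q' =
          - (\<Sum>m\<in>?B. nabla (?E l) (?E j) q' (\<lambda>r. snd c r \<bullet> m) * T (i, m, k) q')"
        using tc[of l j i k] t_skew12[OF E E E q'(1), of _ i k] by (simp add: T_def sum_negf)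
      then show ?thesis
        using tm[OF that ijk(3) h(3,4)] t_skew12[OF E vf_D[OF E E] E q'(1), of i l j k] by simp
    qed
    have t3: "\<bar>t (?E i) (?E j) (nabla (?E l) (?E k)) q'\<bar> \<le> C * ?S" if "l \<in> ?B" for l
    proof -
      have "t (?E m) (?E i) (?E j) q' = T (i, j, m) q'" for m
        using t_skew12[OF E E E q'(1), of m i j] t_skew23[OF E E E q'(1), of i m j] by (simp add: T_def)
      then have "t (nabla (?E l) (?E k)) (?E i) (?E j) q' =
          (\<Sum>m\<in>?B. nabla (?E l) (?E k) q' (\<lambda>r. snd c r \<bullet> m) * T (i, j, m) q')"
        using tc[of l k i j] by simp
      then show ?thesis
        using tm[OF that ijk(4) h(5,6)] t_skew12[OF vf_D[OF E E] E E q'(1), of l k i j]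
          t_skew23[OF E vf_D[OF E E] E q'(1), of i l k j]
        by simp
    qed
    have "\<bar>y' a s\<bar> = \<bar>\<Sum>l\<in>?B. (w \<bullet> l) * (t (nabla (?E l) (?E i)) (?E j) (?E k) q' +
        t (?E i) (nabla (?E l) (?E j)) (?E k) q' + t (?E i) (?E j) (nabla (?E l) (?E k)) q')\<bar>"
      using t_derivative_chart[OF c E E E q'(1), of i j k w] by (simp add: y'_def T_def ijk(1) q'(2) o_def)
    also have "\<dots> \<le> (\<Sum>l\<in>?B. \<bar>w \<bullet> l\<bar> * (3 * C * ?S))"
    proof (rule order_trans[OF sum_abs], rule sum_mono)
      fix l assume "l \<in> ?B"
      then have "\<bar>t (nabla (?E l) (?E i)) (?E j) (?E k) q' +
        t (?E i) (nabla (?E l) (?E j)) (?E k) q' + t (?E i) (?E j) (nabla (?E l) (?E k)) q'\<bar> \<le> 3 * C * ?S"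
        using t1[of l] t2[of l] t3[of l] by linarith
      then show "\<bar>(w \<bullet> l) * (t (nabla (?E l) (?E i)) (?E j) (?E k) q' +
        t (?E i) (nabla (?E l) (?E j)) (?E k) q' + t (?E i) (?E j) (nabla (?E l) (?E k)) q')\<bar> \<le>
        \<bar>w \<bullet> l\<bar> * (3 * C * ?S)"
        unfolding abs_mult by (rule mult_left_mono) simp
    qed
    also have "\<dots> = M * ?S" by (simp add: M_def sum_distrib_right mult.assoc)
    also have "?S = (\<Sum>b\<in>Q. \<bar>y b s\<bar>)" using q' c by (simp add: y_def)
    finally show "\<bar>y' a s\<bar> \<le> M * (\<Sum>b\<in>Q. \<bar>y b s\<bar>)" .
  next
    show "y a 0 = 0" if "a \<in> Q" for a
      using that zero p c by (auto simp: y_def x_def T_def Q_def)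
    show "(i, j, k) \<in> Q" using ijk by (simp add: Q_def)
  qed
  then show ?thesis using q c by (simp add: y_def x_def w_def T_def)
qed

section \<open>Vanishing torsion implies Kaehler\<close>

lemma lb_of_torsion_zero:
  assumes "VF X" "VF Y" "p \<in> U" "\<And>Z. VF Z \<Longrightarrow> t X Y Z p = 0"
  shows "lie_bracket A X Y p = fsub (nabla X Y) (nabla Y X) p"
proof (rule ip_eqI)
  show "ip (lie_bracket A X Y) Z p = ip (fsub (nabla X Y) (nabla Y X)) Z p" if "VF Z" for Z
    using assms(4)[OF that] that assms(1-3) by (simp add: t_def tor_eq ip_sub1)
qed (use assms in auto)

text \<open>With every bracket equal to nabla X Y - nabla Y X and J parallel, the eight terms cancel
  in pairs.\<close>

lemma nijenhuis_zero:
  assumes v: "VF X" "VF Y" "p \<in> U" and zero: "\<And>X Y Z. VF X \<Longrightarrow> VF Y \<Longrightarrow> VF Z \<Longrightarrow> t X Y Z p = 0"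
  shows "nijenhuis A J X Y p = vzero"
proof -
  have lb: "lie_bracket A X Y p = vsub (nabla X Y p) (nabla Y X p)" if "VF X" "VF Y" for X Y
    using lb_of_torsion_zero[OF that v(3)] zero that by (simp add: fsub_def)
  have J: "nabla X (\<lambda>q. J q (Y q)) p = J p (nabla X Y p)" if "VF X" "VF Y" for X Y
    using nabla_J[OF that v(3)] by (simp add: fJ_def)
  have VJ: "VF (\<lambda>q. J q (X q))" if "VF X" for X using vf_fJ[OF that] by (simp add: fJ_def)
  note T = vf_tangent[OF vf_D v(3)]
  show ?thesis
    unfolding nijenhuis_def Let_def using v VJ
    by (simp add: lb J J_sub J_J T J_tangent) (simp add: vec_defs)
qed

text \<open>Where the torsion vanishes, the exterior derivative is the alternation of the covariant
  derivative, and \<omega> is parallel because g and J are.\<close>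

lemma fundamental_form_closed:
  assumes v: "VF X" "VF Y" "VF Z" "p \<in> U" and zero: "\<And>X Y Z. VF X \<Longrightarrow> VF Y \<Longrightarrow> VF Z \<Longrightarrow> t X Y Z p = 0"
  defines "\<omega> \<equiv> fundamental_form J g"
  shows "X p (\<lambda>q. \<omega> q (Y q) (Z q)) + Y p (\<lambda>q. \<omega> q (Z q) (X q)) + Z p (\<lambda>q. \<omega> q (X q) (Y q))
    - \<omega> p (lie_bracket A X Y p) (Z p) - \<omega> p (lie_bracket A Y Z p) (X p) - \<omega> p (lie_bracket A Z X p) (Y p) = 0"
proof -
  have \<omega>: "(\<lambda>q. \<omega> q (Y q) (Z q)) = ip (fJ Y) Z" for Y Z
    by (auto simp: \<omega>_def fundamental_form_def ip_def fJ_def)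
  have \<omega>p: "\<omega> p (Y p) (Z p) = ip (fJ Y) Z p" for Y Z
    by (auto simp: \<omega>_def fundamental_form_def ip_def fJ_def)
  have d: "X p (ip (fJ Y) Z) = ip (fJ (nabla X Y)) Z p - ip (fJ (nabla X Z)) Y p"
    if "VF X" "VF Y" "VF Z" for X Y Z
    using D_metric[of X "fJ Y" Z p] ip_cong1[of "nabla X (fJ Y)" p "fJ (nabla X Y)" Z] nabla_J[of X Y p]
      ip_sym[of "fJ Y" "nabla X Z" p] ip_J[of "nabla X Z" Y p] that v(4) by simp
  have l: "ip (fJ (lie_bracket A X Y)) Z p = ip (fJ (nabla X Y)) Z p - ip (fJ (nabla Y X)) Z p"
    if "VF X" "VF Y" "VF Z" for X Y Z
  proof -
    have "fJ (lie_bracket A X Y) p = fsub (fJ (nabla X Y)) (fJ (nabla Y X)) p"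
      using lb_of_torsion_zero[OF that(1,2) v(4)] zero that J_sub[OF vf_tangent[OF vf_D v(4)] vf_tangent[OF vf_D v(4)]]
      by (simp add: fJ_def fsub_def)
    then show ?thesis
      using ip_cong1[of "fJ (lie_bracket A X Y)" p "fsub (fJ (nabla X Y)) (fJ (nabla Y X))" Z] that v(4)
      by (simp add: ip_sub1)
  qed
  show ?thesis unfolding \<omega> \<omega>p using v(1-3) by (simp add: d l)
qed

lemma t_eq: "t X Y Z p = g p (torsion A nabla X Y p) (Z p)"
  by (simp add: t_def ip_def)

end

section \<open>The zero set of the torsion on a connected manifold\<close>

lemma nk_regionI:
  assumes "almost_hermitian n A J g" "levi_civita A g D"
    and "\<forall>U X. open U \<and> vfield A U X \<longrightarrow> (\<forall>p\<in>U. cov_deriv_J D J X X p = vzero)"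
    and "canonical_connection A J g nabla" and "open U"
  shows "nk_region A J g U nabla D"
proof -
  note h = assms(1)[unfolded almost_hermitian_def] and l = assms(2)[unfolded levi_civita_def]
    and c = assms(4)[unfolded canonical_connection_def]
  show ?thesis
    by unfold_locales (use h l c assms(3,5) in auto)
qed

theorem theorem1p3:
  fixes n :: nat
    and A :: "('m::{t2_space,second_countable_topology}, 'e::euclidean_space) chart set"
    and J :: "'m endo" and g :: "'m metric" and nabla :: "'m conn"
  assumes "nearly_kaehler n A J g"
    and "connected (UNIV :: 'm set)"
    and "canonical_connection A J g nabla"
    and "\<exists>p. ricci_positive_at n A J g nabla p \<or> ricci_negative_at n A J g nabla p"
  shows "kaehler n A J g"
proof -
  have ah: "almost_hermitian n A J g" using assms(1) by (simp add: nearly_kaehler_def)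
  obtain D where D: "levi_civita A g D"
    "\<forall>U X. open U \<and> vfield A U X \<longrightarrow> (\<forall>p\<in>U. cov_deriv_J D J X X p = vzero)"
    using assms(1) unfolding nearly_kaehler_def by blast
  have R: "nk_region A J g U nabla D" if "open U" for U
    using nk_regionI[OF ah D assms(3) that] .
  interpret atlas A using ah by unfold_locales (simp add: almost_hermitian_def)
  \<comment> \<open>The same values as t, written without the locale because several open sets occur
    below.\<close>
  define T where "T X Y Z p = g p (torsion A nabla X Y p) (Z p)" for X Y Z p
  note T_eq = nk_region.t_eq[OF R, folded T_def]
  \<comment> \<open>Quantifying over all charts at p avoids a choice of chart;
    \<open>V_chart\<close> shows that a single chart decides membership.\<close>
  define V where "V = {p. \<forall>c\<in>A. p \<in> fst c \<longrightarrow>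
    (\<forall>i\<in>Basis. \<forall>j\<in>Basis. \<forall>k\<in>Basis. T (chart_vec A c i) (chart_vec A c j) (chart_vec A c k) p = 0)}"
  have zero: "T X Y Z p = 0"
    if "c \<in> A" "p \<in> fst c" "open U" "p \<in> U" and v: "vfield A U X" "vfield A U Y" "vfield A U Z"
      and E: "\<And>i j k. i \<in> Basis \<Longrightarrow> j \<in> Basis \<Longrightarrow> k \<in> Basis \<Longrightarrow>
        T (chart_vec A c i) (chart_vec A c j) (chart_vec A c k) p = 0" for c p U X Y Z
  proof -
    have W: "open (U \<inter> fst c)" "p \<in> U \<inter> fst c" "U \<inter> fst c \<subseteq> fst c"
      using that chart_open[OF that(1)] by auto
    show ?thesis
      using nk_region.t_zero_coord[OF R[OF W(1)] that(1) W(3) vfield_subset[OF v(1)] vfield_subset[OF v(2)]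
          vfield_subset[OF v(3)] W(2)] E
      unfolding T_eq[OF W(1)] by simp
  qed
  have V_chart: "p \<in> V" if c: "c \<in> A" "p \<in> fst c"
    and E: "\<And>i j k. i \<in> Basis \<Longrightarrow> j \<in> Basis \<Longrightarrow> k \<in> Basis \<Longrightarrow>
        T (chart_vec A c i) (chart_vec A c j) (chart_vec A c k) p = 0" for c p
    unfolding V_def
  proof (intro CollectI ballI impI)
    fix d and i j k :: 'e assume d: "d \<in> A" "p \<in> fst d"
    note E' = chart_vec_vfield[OF d(1)]
    show "T (chart_vec A d i) (chart_vec A d j) (chart_vec A d k) p = 0"
      by (rule zero[OF c chart_open[OF d(1)] d(2) E' E' E']) (rule E)
  qed
  \<comment> \<open>One local alternative yields both openness and closedness of \<open>V\<close>:
    propagation by \<open>t_zero_ball\<close> works from any point of the coordinate ball to any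
    other.\<close>
  have local: "\<exists>W. open W \<and> p \<in> W \<and> (W \<subseteq> V \<or> W \<inter> V = {})" for p
  proof -
    obtain c where c: "c \<in> A" "p \<in> fst c" using ex_chart by blast
    have o: "open (fst c)" "open (snd c ` fst c)" using chart[OF c(1)] by (auto simp: is_chart_def)
    then obtain r where r: "r > 0" "cball (snd c p) r \<subseteq> snd c ` fst c"
      using c(2) open_contains_cball by blast
    define W where "W = fst c \<inter> snd c -` ball (snd c p) r"
    have "continuous_on (fst c) (snd c)" using chart[OF c(1)] by (auto simp: is_chart_def homeomorphism_def)
    then have "open W" unfolding W_def using o(1) by (intro continuous_open_preimage) auto
    have "q' \<in> V" if "q \<in> W" "q' \<in> W" "q \<in> V" for q q'
    proof (rule V_chart[OF c(1)])
      show "q' \<in> fst c" using that(2) by (simp add: W_def)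
      fix i j k :: 'e assume "i \<in> Basis" "j \<in> Basis" "k \<in> Basis"
      then show "T (chart_vec A c i) (chart_vec A c j) (chart_vec A c k) q' = 0"
        using nk_region.t_zero_ball[OF R[OF o(1)] c(1) refl r(2), of q q' i j k] that c(1)
        unfolding T_eq[OF o(1)] by (simp add: W_def V_def)
    qed
    then have "W \<subseteq> V \<or> W \<inter> V = {}" by blast
    moreover have "p \<in> W" using c(2) r(1) by (simp add: W_def)
    ultimately show ?thesis using \<open>open W\<close> by blast
  qed
  have "\<exists>W. open W \<and> p \<in> W \<and> W \<subseteq> V" if "p \<in> V" for p
    using local[of p] that by auto
  then have "open V" unfolding open_subopen[of V] by blast
  moreover have "\<exists>W. open W \<and> p \<in> W \<and> W \<subseteq> - V" if "p \<in> - V" for p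
    using local[of p] that by auto
  then have "open (- V)" unfolding open_subopen[of "- V"] by blast
  moreover have "V \<noteq> {}"
  proof -
    obtain p U e where U: "open U" "p \<in> U" "unitary_frame n A J g U e"
      and def: "pos_definite n (first_ricci n A g nabla e p) \<or> neg_definite n (first_ricci n A g nabla e p)"
      using assms(4) unfolding ricci_positive_at_def ricci_negative_at_def by blast
    obtain c where c: "c \<in> A" "p \<in> fst c" using ex_chart by blast
    \<comment> \<open>The frame and the coordinate fields have to live on the same open set.\<close>
    let ?W = "U \<inter> fst c"
    have W: "open ?W" "p \<in> ?W" using U c chart_open[OF c(1)] by auto
    have "unitary_frame n A J g ?W e"
      using U(3) vfield_subset[of U _ ?W]
      unfolding unitary_frame_def field_10_def complex_vfield_def by auto
    then have "frame_region A J g ?W nabla D n e p"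
      using R[OF W(1)] W(2) by (simp add: frame_region_def frame_region_axioms_def)
    then have "T X Y Z p = 0" if "vfield A ?W X" "vfield A ?W Y" "vfield A ?W Z" for X Y Z
      using frame_region.torsion_zero[OF _ def that] T_eq[OF W(1)] by simp
    then have "p \<in> V"
      using vfield_subset[OF chart_vec_vfield[OF c(1)], of ?W] by (intro V_chart[OF c]) auto
    then show ?thesis by blast
  qed
  ultimately have V: "V = UNIV"
    using connectedD[OF assms(2), of V "- V"] by blast
  have T0: "nk_region.t A g nabla X Y Z p = 0" if "open U" "p \<in> U" "vfield A U X" "vfield A U Y" "vfield A U Z"
    for U X Y Z p
  proof -
    obtain c where c: "c \<in> A" "p \<in> fst c" using ex_chart by blast
    have "p \<in> V" using V by simp
    then show ?thesis
      using zero[OF c that] c unfolding T_eq[OF that(1)] V_def by simp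
  qed
  have "integrable_acs A J"
    unfolding integrable_acs_def
  proof (intro allI impI ballI)
    fix U X Y p assume h: "open U \<and> vfield A U X \<and> vfield A U Y" "p \<in> U"
    then have U: "open U" "vfield A U X" "vfield A U Y" by auto
    show "nijenhuis A J X Y p = vzero"
      by (rule nk_region.nijenhuis_zero[OF R[OF U(1)] U(2,3) h(2)]) (rule T0[OF U(1) h(2)])
  qed
  moreover have "closed_2form A (fundamental_form J g)"
    unfolding closed_2form_def
  proof (intro allI impI ballI)
    fix U X Y Z p assume h: "open U \<and> vfield A U X \<and> vfield A U Y \<and> vfield A U Z" "p \<in> U"
    then have U: "open U" "vfield A U X" "vfield A U Y" "vfield A U Z" by auto
    let ?\<omega> = "fundamental_form J g"
    show "X p (\<lambda>q. ?\<omega> q (Y q) (Z q)) + Y p (\<lambda>q. ?\<omega> q (Z q) (X q)) + Z p (\<lambda>q. ?\<omega> q (X q) (Y q))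
        - ?\<omega> p (lie_bracket A X Y p) (Z p) - ?\<omega> p (lie_bracket A Y Z p) (X p)
        - ?\<omega> p (lie_bracket A Z X p) (Y p) = 0"
      by (rule nk_region.fundamental_form_closed[OF R[OF U(1)] U(2-4) h(2)]) (rule T0[OF U(1) h(2)])
  qed
  ultimately show ?thesis using ah by (simp add: kaehler_def)
qed

end
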